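(* Let $\Omega=\mathbb{R}^{2}$ and let $\omega\subset\Omega$ be a bounded subset of positive measure. There exists $\delta>0$ depending only on $\omega$ such that the following holds. Let $\boldsymbol{u}$ and $\tilde{\boldsymbol{u}}$ be two weak solutions of the stationary Navier--Stokes equations in $\Omega$ for the same source term $\boldsymbol{f}=\boldsymbol{\nabla}\cdot\mathbf{F}$ with $\mathbf{F}\in L^{2}(\Omega)$, having the same mean value $\frac{1}{|\omega|}\int_{\omega}\boldsymbol{u}=\frac{1}{|\omega|}\int_{\omega}\tilde{\boldsymbol{u}}$, and both satisfying the energy inequality, i.e. \[ \|\boldsymbol{\nabla}\boldsymbol{u}\|_{L^{2}(\Omega)}^{2}\leq\langle\mathbf{F},\boldsymbol{\nabla}\boldsymbol{u}\rangle_{L^{2}(\Omega)}\quad\text{and}\quad\|\boldsymbol{\nabla}\tilde{\boldsymbol{u}}\|_{L^{2}(\Omega)}^{2}\leq\langle\mathbf{F},\boldsymbol{\nabla}\tilde{\boldsymbol{u}}\rangle_{L^{2}(\Omega)}. \] If \[ |\tilde{\boldsymbol{u}}(\boldsymbol{x})-\boldsymbol{u}_{\infty}|\leq\frac{\delta}{\langle\boldsymbol{x}\rangle\langle\log\langle\boldsymbol{x}\rangle\rangle} \] for some $\boldsymbol{u}_{\infty}\in\mathbb{R}^{2}$, then $\boldsymbol{u}=\tilde{\boldsymbol{u}}$.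
   Context: Notation: $\langle\boldsymbol{x}\rangle=1+|\boldsymbol{x}|$, also for scalars, so $\langle\log\langle\boldsymbol{x}\rangle\rangle=1+\log(1+|\boldsymbol{x}|)$. The stationary Navier--Stokes equations are $\Delta\boldsymbol{u}-\boldsymbol{\nabla}p=\boldsymbol{u}\cdot\boldsymbol{\nabla}\boldsymbol{u}+\boldsymbol{f}$, $\boldsymbol{\nabla}\cdot\boldsymbol{u}=0$, where $(\boldsymbol{u}\cdot\boldsymbol{\nabla}\boldsymbol{v})_i=\sum_j u_j\partial_j v_i$. For $\Omega=\mathbb{R}^2$: $\dot{H}^{1}(\Omega)$ is the linear space of vector fields $\{\boldsymbol{u}\in L^1_{\mathrm{loc}}(\Omega):\boldsymbol{\nabla}\boldsymbol{u}\in L^2(\Omega)\}$ with the semi-norm $\|\boldsymbol{u}\|_{\dot H^1(\Omega)}=\|\boldsymbol{\nabla}\boldsymbol{u}\|_{L^2(\Omega)}$; $\dot{H}^1_\sigma(\Omega)$ is its subspace of weakly divergence-free vector fields; $C_{0,\sigma}^{\infty}(\Omega)$ is the space of smooth divergence-free vector fields with compact support in $\Omega$. The bracket $\langle\cdot,\cdot\rangle_{L^2(\Omega)}$ denotes the integral over $\Omega$ of the pointwise Euclidean (or Frobenius) inner product. Definition (weak solution in $\Omega=\mathbb{R}^2$): given a rank-two tensor $\mathbf{F}\in L^2(\Omega)$, a vector field $\boldsymbol{u}:\Omega\to\mathbb{R}^2$ is a weak solution of the Navier--Stokes equations in $\Omega$ with $\boldsymbol{f}=\boldsymbol{\nabla}\cdot\mathbf{F}$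 if $\boldsymbol{u}\in\dot{H}^1_\sigma(\Omega)$ and \[ \langle\boldsymbol{\nabla}\boldsymbol{u},\boldsymbol{\nabla}\boldsymbol{\varphi}\rangle_{L^{2}(\Omega)}+\langle\boldsymbol{u}\cdot\boldsymbol{\nabla}\boldsymbol{u},\boldsymbol{\varphi}\rangle_{L^{2}(\Omega)}=\langle\mathbf{F},\boldsymbol{\nabla}\boldsymbol{\varphi}\rangle_{L^{2}(\Omega)} \] for all $\boldsymbol{\varphi}\in C_{0,\sigma}^{\infty}(\Omega)$. *)

theory Defs
  imports "HOL-Analysis.Analysis"
begin

type_synonym plane = "real^2"
type_synonym tensor = "real^2^2"

definition jbracket :: "'a::real_normed_vector \<Rightarrow> real" where
  "jbracket x = 1 + norm x"

subsection \<open>Smooth functions and test functions\<close>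

definition partial_deriv :: "2 \<Rightarrow> (plane \<Rightarrow> 'a::real_normed_vector) \<Rightarrow> plane \<Rightarrow> 'a" where
  "partial_deriv j f = (\<lambda>x. frechet_derivative f (at x) (axis j 1))"

text \<open>
  Smoothness: every iterated partial derivative is Frechet differentiable on the whole plane.
  Differentiability of all higher derivatives gives their continuity, so no separate
  continuity clause is needed.
\<close>

definition smooth :: "(plane \<Rightarrow> 'a::real_normed_vector) \<Rightarrow> bool" where
  "smooth f \<longleftrightarrow> (\<forall>js :: 2 list. foldr partial_deriv js f differentiable_on UNIV)"

definition test_function :: "(plane \<Rightarrow> 'a::real_normed_vector) \<Rightarrow> bool" where
  "test_function \<phi> \<longleftrightarrow> smooth \<phi> \<and> compact (closure (support_on UNIV \<phi>))"

text \<open>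
  Gradients of vector fields follow the convention of the library's \<open>jacobian\<close>: the entry in
  row \<open>i\<close> and column \<open>j\<close> is the \<open>j\<close>-th partial derivative of the \<open>i\<close>-th component. In
  particular the divergence is the trace of the gradient.
\<close>

abbreviation grad :: "(plane \<Rightarrow> plane) \<Rightarrow> plane \<Rightarrow> tensor" where
  "grad \<phi> \<equiv> (\<lambda>x. jacobian \<phi> (at x))"

definition sol_test_field :: "(plane \<Rightarrow> plane) \<Rightarrow> bool" where
  "sol_test_field \<phi> \<longleftrightarrow> test_function \<phi> \<and> (\<forall>x. trace (grad \<phi> x) = 0)"

subsection \<open>Lebesgue spaces\<close>

definition locally_integrable :: "(plane \<Rightarrow> 'a::{banach, second_countable_topology}) \<Rightarrow> bool" where
  "locally_integrable f \<longleftrightarrow> (\<forall>K. compact K \<longrightarrow> f absolutely_integrable_on K)"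

definition in_L2 :: "(plane \<Rightarrow> 'a::euclidean_space) \<Rightarrow> bool" where
  "in_L2 f \<longleftrightarrow> f \<in> borel_measurable lebesgue \<and> integrable lebesgue (\<lambda>x. (norm (f x))\<^sup>2)"

text \<open>On \<^typ>\<open>real^2^2\<close> the library's inner product and norm are the Frobenius ones.\<close>

definition L2_inner :: "(plane \<Rightarrow> 'a::euclidean_space) \<Rightarrow> (plane \<Rightarrow> 'a) \<Rightarrow> real" where
  "L2_inner f g = (LINT x|lebesgue. f x \<bullet> g x)"

definition L2_norm :: "(plane \<Rightarrow> 'a::euclidean_space) \<Rightarrow> real" where
  "L2_norm f = sqrt (LINT x|lebesgue. (norm (f x))\<^sup>2)"

definition mean_value :: "plane set \<Rightarrow> (plane \<Rightarrow> plane) \<Rightarrow> plane" where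
  "mean_value \<omega> u = (1 / measure lebesgue \<omega>) *\<^sub>R (LINT x:\<omega>|lebesgue. u x)"

subsection \<open>Weak derivatives and the homogeneous Sobolev space\<close>

definition has_weak_gradient :: "(plane \<Rightarrow> plane) \<Rightarrow> (plane \<Rightarrow> tensor) \<Rightarrow> bool" where
  "has_weak_gradient u G \<longleftrightarrow> locally_integrable u \<and> locally_integrable G \<and>
     (\<forall>\<eta> :: plane \<Rightarrow> real. test_function \<eta> \<longrightarrow>
        (\<forall>i j. (LINT x|lebesgue. u x $ i * partial_deriv j \<eta> x)
               = - (LINT x|lebesgue. G x $ i $ j * \<eta> x)))"

text \<open>
  A weak gradient is determined up to a null set; \<open>weak_grad\<close> picks a representative, and
  everything below is insensitive to the choice.
\<close>

definition weak_grad :: "(plane \<Rightarrow> plane) \<Rightarrow> plane \<Rightarrow> tensor" where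
  "weak_grad u = (SOME G. has_weak_gradient u G)"

definition weakly_div_free :: "(plane \<Rightarrow> plane) \<Rightarrow> bool" where
  "weakly_div_free u \<longleftrightarrow>
     (\<forall>\<eta> :: plane \<Rightarrow> real. test_function \<eta> \<longrightarrow>
        (LINT x|lebesgue. (\<Sum>j\<in>UNIV. u x $ j * partial_deriv j \<eta> x)) = 0)"

definition H1_dot :: "(plane \<Rightarrow> plane) \<Rightarrow> bool" where
  "H1_dot u \<longleftrightarrow> locally_integrable u \<and> (\<exists>G. has_weak_gradient u G) \<and> in_L2 (weak_grad u)"

definition H1_dot_sigma :: "(plane \<Rightarrow> plane) \<Rightarrow> bool" where
  "H1_dot_sigma u \<longleftrightarrow> H1_dot u \<and> weakly_div_free u"

subsection \<open>Weak solutions\<close>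

text \<open>
  With the above convention for gradients, the convection term with components
  \<open>\<Sum>j. u j * \<partial>j (v i)\<close> is the matrix \<open>weak_grad v x\<close> applied to the vector \<open>u x\<close>.
\<close>

definition convection :: "(plane \<Rightarrow> plane) \<Rightarrow> (plane \<Rightarrow> plane) \<Rightarrow> plane \<Rightarrow> plane" where
  "convection u v = (\<lambda>x. weak_grad v x *v u x)"

definition weak_solution :: "(plane \<Rightarrow> tensor) \<Rightarrow> (plane \<Rightarrow> plane) \<Rightarrow> bool" where
  "weak_solution F u \<longleftrightarrow> H1_dot_sigma u \<and>
     (\<forall>\<phi>. sol_test_field \<phi> \<longrightarrow>
        L2_inner (weak_grad u) (grad \<phi>) + L2_inner (convection u u) \<phi> = L2_inner F (grad \<phi>))"

definition energy_inequality :: "(plane \<Rightarrow> tensor) \<Rightarrow> (plane \<Rightarrow> plane) \<Rightarrow> bool" where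
  "energy_inequality F u \<longleftrightarrow> (L2_norm (weak_grad u))\<^sup>2 \<le> L2_inner F (weak_grad u)"

end

theory Submission
  imports Defs
begin

text \<open>
  Write \<open>d = u - v\<close> and \<open>v' = v - uinf\<close>. Testing the equation of \<open>u\<close> with \<open>v'\<close>, that of \<open>v\<close> with \<open>u\<close>, and
  inserting both energy inequalities yields \<open>|grad d|^2 \<le> \<integral> (d . grad d) . v'\<close> in \<open>L^2\<close> norms. The logarithmic Hardy inequality
  bounds \<open>d / (<x> <log <x>>)\<close> in \<open>L^2\<close> by \<open>grad d\<close>, because \<open>d\<close> has mean zero on \<open>\<omega>\<close>; hence the right-hand side is
  at most \<open>C \<delta> |grad d|^2\<close>, and \<open>d\<close> vanishes for small \<open>\<delta>\<close>.

  Neither \<open>v'\<close> nor \<open>u\<close> is an admissible test field. Both are mollified and written as rotated gradients of stream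
  functions, which are multiplied by a cutoff in the variable \<open>log log |x|\<close>. The stream function of a field decaying
  like \<open>1 / (<x> <log <x>>)\<close> grows at most like \<open>log log |x|\<close>, which is just what the derivative of this
  cutoff compensates; for \<open>u\<close> a second Hardy inequality, for the stream function, plays the same role. The
  equation of \<open>v\<close> needs only convergence of gradients: its convection term can be put in the form \<open>- \<integral> v' \<otimes> v : grad \<phi>\<close>,
  where \<open>v' \<otimes> v\<close> is square integrable.
\<close>

text \<open>A square integrable gradient does not control a plane field at infinity:
  \<open>u\<close> and \<open>v\<close> lie in \<open>L^2\<close> only after multiplication by
  \<open>log_weight\<close>. An integral of velocity times gradient times test field is therefore
  finite only if the test field is bounded by \<open>log_weight\<close>, which is exactly the decay
  assumed of \<open>v'\<close>; hence the borderline rate in the hypothesis. The identity behind the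
  energy estimate, with \<open>G\<close> and \<open>H\<close> the gradients of \<open>u\<close> and
  \<open>v\<close>: the energy inequalities give \<open>|G - H|^2 \<le> F:G + F:H - 2 G:H\<close>.
  The two tested equations replace \<open>F:G\<close> and \<open>F:H\<close>, and what remains is
  the integral of \<open>(d . grad u) . v'\<close>. Since \<open>(d . grad v') . v'\<close> is the
  divergence of \<open>d |v'|^2 / 2\<close>, it integrates to zero, and \<open>grad u\<close> may be
  replaced by \<open>grad d\<close>. Both sides are then quadratic in \<open>grad d\<close>, so a
  small \<open>v'\<close> suffices, whatever the size of \<open>F\<close> and \<open>u\<close>.
  Approximations are made in two layers: at a fixed mollification the cutoff is removed first, and
  the mollification afterwards. Only then do the stream functions have all classical
  derivatives.\<close>

section \<open>Calculus of partial derivatives in the plane\<close>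

lemma partial_deriv_eq: "(f has_derivative f') (at x) \<Longrightarrow> partial_deriv j f x = f' (axis j 1)"
  by (metis frechet_derivative_at partial_deriv_def)

lemma vec_eq_sum_axis: "(h::plane) = (\<Sum>j\<in>UNIV. h $ j *\<^sub>R axis j 1)"
  by (simp add: vec_eq_iff axis_def if_distrib sum.delta cong: if_cong)

text \<open>Normal form of the derivative: the rules for sums, products, composition and reflection
  below are library rules applied to this form and evaluated at \<open>axis j 1\<close>.\<close>

lemma has_derivative_partials:
  fixes f :: "plane \<Rightarrow> 'a::real_normed_vector"
  assumes "f differentiable (at x)"
  shows "(f has_derivative (\<lambda>h. \<Sum>j\<in>UNIV. h $ j *\<^sub>R partial_deriv j f x)) (at x)"
proof -
  let ?D = "frechet_derivative f (at x)"
  have d: "(f has_derivative ?D) (at x)" using assms frechet_derivative_works by blast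
  then have lin: "linear ?D" by (rule has_derivative_linear)
  have "?D h = (\<Sum>j\<in>UNIV. h $ j *\<^sub>R partial_deriv j f x)" for h
    by (subst vec_eq_sum_axis) (simp add: linear_sum[OF lin] linear_scale[OF lin] partial_deriv_def)
  with d show ?thesis by (metis (no_types, lifting) ext)
qed

lemma differentiable_at: "f differentiable_on UNIV \<Longrightarrow> f differentiable (at x)"
  by (simp add: differentiable_on_def)

lemma partial_deriv_const [simp]: "partial_deriv j (\<lambda>_. c) = (\<lambda>_. 0)"
  by (rule ext) (rule partial_deriv_eq, rule has_derivative_const)

lemma partial_deriv_component: "partial_deriv j (\<lambda>x. x $ i) = (\<lambda>_. if i = j then 1 else 0)"
proof
  fix x :: plane
  have "((\<lambda>x::plane. x $ i) has_derivative (\<lambda>h. h $ i)) (at x)"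
    by (rule bounded_linear.has_derivative[OF bounded_linear_vec_nth has_derivative_ident])
  from partial_deriv_eq[OF this] show "partial_deriv j (\<lambda>x. x $ i) x = (if i = j then 1 else 0)"
    by (simp add: axis_def)
qed

lemma partial_deriv_add_at:
  assumes "f differentiable (at x)" "g differentiable (at x)"
  shows "partial_deriv j (\<lambda>x. f x + g x) x = partial_deriv j f x + partial_deriv j g x"
  using partial_deriv_eq[OF has_derivative_add[OF has_derivative_partials[OF assms(1)] has_derivative_partials[OF assms(2)]], of j]
  by (simp add: axis_def if_distrib[of "\<lambda>x. x *\<^sub>R _"] cong: if_cong)

lemma partial_deriv_mult_at:
  fixes f g :: "plane \<Rightarrow> real"
  assumes "f differentiable (at x)" "g differentiable (at x)"
  shows "partial_deriv j (\<lambda>x. f x * g x) x = partial_deriv j f x * g x + f x * partial_deriv j g x"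
  using partial_deriv_eq[OF has_derivative_mult[OF has_derivative_partials[OF assms(1)] has_derivative_partials[OF assms(2)]], of j]
  by (simp add: axis_def if_distrib[of "\<lambda>x. x * _"] cong: if_cong)

lemma has_derivative_compose_real:
  fixes f :: "plane \<Rightarrow> real"
  assumes "f differentiable (at x)" "(g has_real_derivative g') (at (f x))"
  shows "((\<lambda>x. g (f x)) has_derivative (\<lambda>h. (\<Sum>j\<in>UNIV. h $ j *\<^sub>R partial_deriv j f x) * g')) (at x)"
  by (rule DERIV_compose_FDERIV[OF assms(2) has_derivative_partials[OF assms(1)]])

lemma partial_deriv_compose_at:
  fixes f :: "plane \<Rightarrow> real"
  assumes "f differentiable (at x)" "(g has_real_derivative g') (at (f x))"
  shows "partial_deriv j (\<lambda>x. g (f x)) x = g' * partial_deriv j f x"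
  using partial_deriv_eq[OF has_derivative_compose_real[OF assms], of j]
  by (simp add: axis_def if_distrib[of "\<lambda>x. x * _"] cong: if_cong)

lemma partial_deriv_reflect:
  fixes f :: "plane \<Rightarrow> real"
  assumes "f differentiable_on UNIV"
  shows "(\<lambda>y. f (a - y)) differentiable_on UNIV"
    "partial_deriv j (\<lambda>y. f (a - y)) = (\<lambda>y. - partial_deriv j f (a - y))"
proof -
  have *: "((\<lambda>y. f (a - y)) has_derivative (\<lambda>h. \<Sum>j\<in>UNIV. (0 - h) $ j *\<^sub>R partial_deriv j f (a - y))) (at y)" for y
    by (rule has_derivative_compose[of "\<lambda>y. a - y" "\<lambda>h. 0 - h" _ _ f, OF _ has_derivative_partials[OF differentiable_at[OF assms]]])
      (auto intro!: derivative_eq_intros)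
  then show "(\<lambda>y. f (a - y)) differentiable_on UNIV" unfolding differentiable_on_def differentiable_def by auto
  show "partial_deriv j (\<lambda>y. f (a - y)) = (\<lambda>y. - partial_deriv j f (a - y))"
    by (rule ext, subst partial_deriv_eq[OF *])
      (simp add: axis_def sum_negf if_distrib[of "\<lambda>x. x * _"] cong: if_cong)
qed

section \<open>Closure properties of smoothness\<close>

text \<open>Truncating at order \<open>n\<close> makes closure properties accessible to induction:
  the partial derivatives of a product or a composition of order \<open>Suc n\<close> are sums of
  products of functions of order \<open>n\<close>.\<close>

definition smooth_ord :: "nat \<Rightarrow> (plane \<Rightarrow> 'a::real_normed_vector) \<Rightarrow> bool" where
  "smooth_ord n f \<longleftrightarrow> (\<forall>js :: 2 list. length js \<le> n \<longrightarrow> foldr partial_deriv js f differentiable_on UNIV)"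

lemma smooth_iff_smooth_ord: "smooth f \<longleftrightarrow> (\<forall>n. smooth_ord n f)"
  unfolding smooth_def smooth_ord_def by blast

lemma smooth_ord_0: "smooth_ord 0 f \<longleftrightarrow> f differentiable_on UNIV"
  by (simp add: smooth_ord_def)

lemma smooth_ord_Suc: "smooth_ord (Suc n) f \<longleftrightarrow> f differentiable_on UNIV \<and> (\<forall>j. smooth_ord n (partial_deriv j f))"
proof
  assume l: "smooth_ord (Suc n) f"
  have "foldr partial_deriv js (partial_deriv j f) differentiable_on UNIV" if "length js \<le> n" for js j
    using l[unfolded smooth_ord_def, rule_format, of "js @ [j]"] that by simp
  moreover have "f differentiable_on UNIV" using l[unfolded smooth_ord_def, rule_format, of "[]"] by simp
  ultimately show "f differentiable_on UNIV \<and> (\<forall>j. smooth_ord n (partial_deriv j f))"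
    unfolding smooth_ord_def by blast
next
  assume r: "f differentiable_on UNIV \<and> (\<forall>j. smooth_ord n (partial_deriv j f))"
  have "foldr partial_deriv js f differentiable_on UNIV" if "length js \<le> Suc n" for js
  \<comment> \<open>\<open>foldr\<close> applies the last index of the list first, so the innermost
    derivative is split off at the end.\<close>
  proof (cases js rule: rev_cases)
    case Nil then show ?thesis using r by simp
  next
    case (snoc ks j) then show ?thesis using r that unfolding smooth_ord_def by simp
  qed
  then show "smooth_ord (Suc n) f" unfolding smooth_ord_def by blast
qed

lemma smooth_ord_mono: "smooth_ord (Suc n) f \<Longrightarrow> smooth_ord n f"
  by (simp add: smooth_ord_def)

lemma smooth_ord_diff: "smooth_ord n f \<Longrightarrow> f differentiable_on UNIV"
  by (cases n) (simp_all add: smooth_ord_0 smooth_ord_Suc)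

lemma smooth_diff: "smooth f \<Longrightarrow> f differentiable_on UNIV"
  by (metis smooth_iff_smooth_ord smooth_ord_0)

lemma smooth_diff_at: "smooth f \<Longrightarrow> f differentiable (at x)"
  by (simp add: smooth_diff differentiable_at)

lemma smooth_continuous: "smooth f \<Longrightarrow> continuous_on UNIV f"
  by (simp add: smooth_diff differentiable_imp_continuous_on)

lemma smooth_isCont: "smooth f \<Longrightarrow> isCont f x"
  using smooth_continuous continuous_on_eq_continuous_at by blast

lemma smooth_measurable: "smooth f \<Longrightarrow> f \<in> borel_measurable borel"
  by (simp add: borel_measurable_continuous_onI smooth_continuous)

lemma smooth_partial_deriv: "smooth f \<Longrightarrow> smooth (partial_deriv j f)"
  by (meson smooth_iff_smooth_ord smooth_ord_Suc)

lemma smooth_partialsI: "f differentiable_on UNIV \<Longrightarrow> (\<And>j. smooth (partial_deriv j f)) \<Longrightarrow> smooth f"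
  by (metis not0_implies_Suc smooth_iff_smooth_ord smooth_ord_0 smooth_ord_Suc)

lemma smooth_ord_const: "smooth_ord n (\<lambda>_. c)"
  by (induction n arbitrary: c) (simp_all add: smooth_ord_0 smooth_ord_Suc)

lemma smooth_const [simp]: "smooth (\<lambda>_. c)"
  by (simp add: smooth_iff_smooth_ord smooth_ord_const)

lemma smooth_component: "smooth (\<lambda>x. x $ i)"
  by (rule smooth_partialsI)
    (auto simp: partial_deriv_component differentiable_on_def intro!: bounded_linear_imp_differentiable bounded_linear_vec_nth)

lemma smooth_ord_add:
  "smooth_ord n f \<Longrightarrow> smooth_ord n g \<Longrightarrow> smooth_ord n (\<lambda>x. f x + g x)"
proof (induction n arbitrary: f g)
  case 0 then show ?case by (simp add: smooth_ord_0 differentiable_on_add)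
next
  case (Suc n)
  then have d: "f differentiable_on UNIV" "g differentiable_on UNIV" by (auto dest: smooth_ord_diff)
  have "partial_deriv j (\<lambda>x. f x + g x) = (\<lambda>x. partial_deriv j f x + partial_deriv j g x)" for j
    by (rule ext) (rule partial_deriv_add_at[OF differentiable_at[OF d(1)] differentiable_at[OF d(2)]])
  then show ?case using Suc d by (simp add: smooth_ord_Suc differentiable_on_add)
qed

lemma smooth_add: "smooth f \<Longrightarrow> smooth g \<Longrightarrow> smooth (\<lambda>x. f x + g x)"
  by (simp add: smooth_iff_smooth_ord smooth_ord_add)

lemma partial_deriv_add:
  "smooth f \<Longrightarrow> smooth g \<Longrightarrow> partial_deriv j (\<lambda>x. f x + g x) = (\<lambda>x. partial_deriv j f x + partial_deriv j g x)"
  by (rule ext) (rule partial_deriv_add_at[OF smooth_diff_at smooth_diff_at])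

lemma smooth_ord_mult:
  fixes f g :: "plane \<Rightarrow> real"
  shows "smooth_ord n f \<Longrightarrow> smooth_ord n g \<Longrightarrow> smooth_ord n (\<lambda>x. f x * g x)"
proof (induction n arbitrary: f g)
  case 0 then show ?case by (simp add: smooth_ord_0 differentiable_on_mult)
next
  case (Suc n)
  then have d: "f differentiable_on UNIV" "g differentiable_on UNIV" by (auto dest: smooth_ord_diff)
  have "partial_deriv j (\<lambda>x. f x * g x) = (\<lambda>x. partial_deriv j f x * g x + f x * partial_deriv j g x)" for j
    by (rule ext) (rule partial_deriv_mult_at[OF differentiable_at[OF d(1)] differentiable_at[OF d(2)]])
  then show ?case using Suc d smooth_ord_mono[OF Suc.prems(1)] smooth_ord_mono[OF Suc.prems(2)]
    by (simp add: smooth_ord_Suc differentiable_on_mult smooth_ord_add)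
qed

lemma smooth_mult:
  fixes f g :: "plane \<Rightarrow> real" shows "smooth f \<Longrightarrow> smooth g \<Longrightarrow> smooth (\<lambda>x. f x * g x)"
  by (simp add: smooth_iff_smooth_ord smooth_ord_mult)

lemma partial_deriv_mult:
  fixes f g :: "plane \<Rightarrow> real" shows
  "smooth f \<Longrightarrow> smooth g \<Longrightarrow> partial_deriv j (\<lambda>x. f x * g x) = (\<lambda>x. partial_deriv j f x * g x + f x * partial_deriv j g x)"
  by (rule ext) (rule partial_deriv_mult_at[OF smooth_diff_at smooth_diff_at])

lemma smooth_cmult: "smooth f \<Longrightarrow> smooth (\<lambda>x. c * f x :: real)"
  by (simp add: smooth_mult)

lemma partial_deriv_cmult: "smooth f \<Longrightarrow> partial_deriv j (\<lambda>x. c * f x :: real) = (\<lambda>x. c * partial_deriv j f x)"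
  using partial_deriv_mult[of "\<lambda>_. c" f j] by simp

lemma smooth_minus: "smooth f \<Longrightarrow> smooth (\<lambda>x. - f x :: real)"
  using smooth_cmult[of f "-1"] by simp

lemma partial_deriv_minus: "smooth f \<Longrightarrow> partial_deriv j (\<lambda>x. - f x :: real) = (\<lambda>x. - partial_deriv j f x)"
  using partial_deriv_cmult[of f j "-1"] by simp

lemma smooth_diff_fun: "smooth f \<Longrightarrow> smooth g \<Longrightarrow> smooth (\<lambda>x. f x - g x :: real)"
  using smooth_add[OF _ smooth_minus, of f g] by simp

lemma partial_deriv_diff:
  "smooth f \<Longrightarrow> smooth g \<Longrightarrow> partial_deriv j (\<lambda>x. f x - g x :: real) = (\<lambda>x. partial_deriv j f x - partial_deriv j g x)"
  using partial_deriv_add[OF _ smooth_minus, of f g j] by (simp add: partial_deriv_minus)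

lemma smooth_sum: "(\<And>i. i \<in> A \<Longrightarrow> smooth (f i)) \<Longrightarrow> smooth (\<lambda>x. \<Sum>i\<in>A. f i x)"
  by (induction A rule: infinite_finite_induct) (auto intro: smooth_add)

lemma partial_deriv_sum: "(\<And>i. i \<in> A \<Longrightarrow> smooth (f i)) \<Longrightarrow> partial_deriv j (\<lambda>x. \<Sum>i\<in>A. f i x) = (\<lambda>x. \<Sum>i\<in>A. partial_deriv j (f i) x)"
  by (induction A rule: infinite_finite_induct) (auto simp: partial_deriv_add smooth_sum)

lemma smooth_ord_reflect:
  fixes f :: "plane \<Rightarrow> real"
  shows "smooth_ord n f \<Longrightarrow> smooth_ord n (\<lambda>y. f (a - y))"
proof (induction n arbitrary: f)
  case 0 then show ?case by (simp add: smooth_ord_0 partial_deriv_reflect)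
next
  case (Suc n)
  then have "smooth_ord n (\<lambda>y. (\<lambda>_. -1) y * partial_deriv j f (a - y))" for j
    by (intro smooth_ord_mult smooth_ord_const) (simp add: smooth_ord_Suc)
  with Suc.prems show ?case by (simp add: smooth_ord_Suc partial_deriv_reflect)
qed

lemma smooth_reflect: "smooth f \<Longrightarrow> smooth (\<lambda>y. f (a - y) :: real)"
  by (simp add: smooth_iff_smooth_ord smooth_ord_reflect)

text \<open>The chain rule turns \<open>D k\<close> into \<open>D (Suc k)\<close>, so all
  derivatives of the outer function are supplied as a family and the induction runs for every
  \<open>k\<close> at once. The set \<open>S\<close> allows outer functions such as
  \<open>1 / t\<close>, differentiable only on the range of \<open>f\<close>.\<close>

lemma smooth_ord_compose:
  fixes f :: "plane \<Rightarrow> real"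
  assumes D: "\<And>k t. t \<in> S \<Longrightarrow> (D k has_real_derivative D (Suc k) t) (at t)" and S: "\<And>x. f x \<in> S"
  shows "smooth_ord n f \<Longrightarrow> smooth_ord n (\<lambda>x. D k (f x))"
proof (induction n arbitrary: k)
  case 0
  then show ?case
    unfolding smooth_ord_0 differentiable_on_def
    using has_derivative_compose_real[where f=f, OF _ D[OF S]] differentiableI by blast
next
  case (Suc n)
  then have d: "f differentiable_on UNIV" by (auto dest: smooth_ord_diff)
  have "partial_deriv j (\<lambda>x. D k (f x)) = (\<lambda>x. D (Suc k) (f x) * partial_deriv j f x)" for j
    by (rule ext) (rule partial_deriv_compose_at[OF differentiable_at[OF d] D[OF S]])
  moreover have "(\<lambda>x. D k (f x)) differentiable_on UNIV"
    using Suc.IH[OF smooth_ord_mono[OF Suc.prems]] by (rule smooth_ord_diff)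
  ultimately show ?case using Suc.IH[OF smooth_ord_mono[OF Suc.prems]] Suc.prems
    by (simp add: smooth_ord_Suc smooth_ord_mult)
qed

lemma smooth_compose:
  fixes f :: "plane \<Rightarrow> real"
  assumes "\<And>k t. t \<in> S \<Longrightarrow> (D k has_real_derivative D (Suc k) t) (at t)" "\<And>x. f x \<in> S" "smooth f"
  shows "smooth (\<lambda>x. D k (f x))"
  using assms(3) smooth_ord_compose[where S=S and D=D and f=f, OF assms(1,2)] by (simp add: smooth_iff_smooth_ord)

lemma smooth_inverse:
  fixes f :: "plane \<Rightarrow> real"
  assumes "\<And>x. f x > 0" "smooth f"
  shows "smooth (\<lambda>x. 1 / f x)"
proof -
  define D where "D k t = (-1) ^ k * fact k / t ^ Suc k" for k :: nat and t :: real
  have "(D k has_real_derivative D (Suc k) t) (at t)" if "t \<in> {0<..}" for k t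
  proof -
    have "((\<lambda>t. c / t ^ Suc k) has_real_derivative (0 * t ^ Suc k - c * (real (Suc k) * t ^ (Suc k - Suc 0))) / (t ^ Suc k * t ^ Suc k)) (at t)" for c :: real
      using that by (intro DERIV_divide DERIV_const DERIV_pow) auto
    moreover have "(0 * t ^ Suc k - c * (real (Suc k) * t ^ (Suc k - Suc 0))) / (t ^ Suc k * t ^ Suc k) = - c * real (Suc k) / t ^ Suc (Suc k)" for c
      using that by (simp add: field_simps)
    ultimately have "((\<lambda>t. c / t ^ Suc k) has_real_derivative - c * real (Suc k) / t ^ Suc (Suc k)) (at t)" for c by metis
    from this[of "(-1) ^ k * fact k"] show ?thesis unfolding D_def by (simp add: mult_ac)
  qed
  then have "smooth (\<lambda>x. D 0 (f x))" by (rule smooth_compose[where S="{0<..}"]) (use assms in auto)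
  then show ?thesis by (simp add: D_def)
qed

lemma partial_deriv_ln:
  fixes f :: "plane \<Rightarrow> real"
  assumes "\<And>x. f x > 0" "smooth f"
  shows "partial_deriv j (\<lambda>x. ln (f x)) = (\<lambda>x. 1 / f x * partial_deriv j f x)"
  by (rule ext, rule partial_deriv_compose_at[OF smooth_diff_at[OF assms(2)]])
    (use assms(1) DERIV_ln_divide in blast)

lemma smooth_ln:
  fixes f :: "plane \<Rightarrow> real"
  assumes "\<And>x. f x > 0" "smooth f"
  shows "smooth (\<lambda>x. ln (f x))"
proof (rule smooth_partialsI)
  show "(\<lambda>x. ln (f x)) differentiable_on UNIV"
    unfolding differentiable_on_def
    using has_derivative_compose_real[OF smooth_diff_at[OF assms(2)] DERIV_ln_divide[OF assms(1)]] differentiableI by blast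
  show "smooth (partial_deriv j (\<lambda>x. ln (f x)))" for j
    unfolding partial_deriv_ln[OF assms] by (intro smooth_mult smooth_inverse smooth_partial_deriv assms)
qed

lemma partial_deriv_vec:
  fixes f :: "2 \<Rightarrow> plane \<Rightarrow> real"
  assumes "\<And>i. f i differentiable_on UNIV"
  shows "(\<lambda>x. \<chi> i. f i x) differentiable_on UNIV"
    "partial_deriv j (\<lambda>x. \<chi> i. f i x) = (\<lambda>x. \<chi> i. partial_deriv j (f i) x)"
proof -
  have *: "((\<lambda>x. \<chi> i. f i x) has_derivative (\<lambda>h. \<chi> i. \<Sum>j\<in>UNIV. h $ j *\<^sub>R partial_deriv j (f i) x)) (at x)" for x
    unfolding has_derivative_componentwise_within[of "\<lambda>x. \<chi> i. f i x"] Basis_vec_def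
    by (auto simp: inner_axis intro!: has_derivative_partials[OF differentiable_at[OF assms], simplified])
  then show "(\<lambda>x. \<chi> i. f i x) differentiable_on UNIV"
    unfolding differentiable_on_def differentiable_def by blast
  show "partial_deriv j (\<lambda>x. \<chi> i. f i x) = (\<lambda>x. \<chi> i. partial_deriv j (f i) x)"
    by (rule ext, subst partial_deriv_eq[OF *])
      (simp add: axis_def if_distrib[of "\<lambda>x. x * _"] cong: if_cong)
qed

lemma smooth_ord_vec:
  fixes f :: "2 \<Rightarrow> plane \<Rightarrow> real"
  shows "(\<And>i. smooth_ord n (f i)) \<Longrightarrow> smooth_ord n (\<lambda>x. \<chi> i. f i x)"
proof (induction n arbitrary: f)
  case 0 then show ?case by (simp add: smooth_ord_0 partial_deriv_vec)
next
  case (Suc n) then show ?case by (simp add: smooth_ord_Suc partial_deriv_vec)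
qed

lemma smooth_vec:
  fixes f :: "2 \<Rightarrow> plane \<Rightarrow> real"
  shows "(\<And>i. smooth (f i)) \<Longrightarrow> smooth (\<lambda>x. \<chi> i. f i x)"
  by (simp add: smooth_iff_smooth_ord smooth_ord_vec)

lemma grad_vec:
  fixes f :: "2 \<Rightarrow> plane \<Rightarrow> real"
  assumes "\<And>i. smooth (f i)"
  shows "grad (\<lambda>x. \<chi> i. f i x) x $ i $ j = partial_deriv j (f i) x"
  using fun_cong[OF partial_deriv_vec(2)[of f j], of x] assms
  by (simp add: jacobian_def matrix_def partial_deriv_def vec_eq_iff smooth_diff)

lemma smooth_vec_component:
  fixes f :: "plane \<Rightarrow> plane"
  assumes "smooth f"
  shows "smooth (\<lambda>x. f x $ i)" "partial_deriv j (\<lambda>x. f x $ i) = (\<lambda>x. grad f x $ i $ j)"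
proof -
  have p: "(\<lambda>x. g x $ i) differentiable_on UNIV" "partial_deriv j (\<lambda>x. g x $ i) = (\<lambda>x. partial_deriv j g x $ i)"
    if g: "g differentiable_on UNIV" for g :: "plane \<Rightarrow> plane" and j
  proof -
    have *: "((\<lambda>x. g x $ i) has_derivative (\<lambda>h. (\<Sum>j\<in>UNIV. h $ j *\<^sub>R partial_deriv j g x) $ i)) (at x)" for x
      by (rule bounded_linear.has_derivative[OF bounded_linear_vec_nth has_derivative_partials[OF differentiable_at[OF g]]])
    then show "(\<lambda>x. g x $ i) differentiable_on UNIV" unfolding differentiable_on_def differentiable_def by blast
    show "partial_deriv j (\<lambda>x. g x $ i) = (\<lambda>x. partial_deriv j g x $ i)"
      by (rule ext, subst partial_deriv_eq[OF *])
        (simp add: axis_def if_distrib[of "\<lambda>x. x * _"] cong: if_cong)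
  qed
  have "smooth_ord n g \<Longrightarrow> smooth_ord n (\<lambda>x. g x $ i)" for n and g :: "plane \<Rightarrow> plane"
    by (induction n arbitrary: g) (auto simp: smooth_ord_0 smooth_ord_Suc p)
  then show "smooth (\<lambda>x. f x $ i)" using assms by (simp add: smooth_iff_smooth_ord)
  show "partial_deriv j (\<lambda>x. f x $ i) = (\<lambda>x. grad f x $ i $ j)"
    using p(2)[OF smooth_diff[OF assms]] by (simp add: jacobian_def matrix_def partial_deriv_def)
qed

subsection \<open>Test functions\<close>

lemma test_function_iff:
  "test_function f \<longleftrightarrow> smooth f \<and> (\<exists>R. \<forall>x. norm x > R \<longrightarrow> f x = 0)"
proof -
  have "compact (closure (support_on UNIV f)) \<longleftrightarrow> bounded (support_on UNIV f)"
    by (simp add: compact_closure)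
  also have "\<dots> \<longleftrightarrow> (\<exists>R. \<forall>x. norm x > R \<longrightarrow> f x = 0)"
  proof
    assume "bounded (support_on UNIV f)"
    then obtain R where "\<And>x. f x \<noteq> 0 \<Longrightarrow> norm x \<le> R"
      unfolding bounded_iff support_on_def by auto
    then show "\<exists>R. \<forall>x. norm x > R \<longrightarrow> f x = 0" by (meson linorder_not_le)
  next
    assume "\<exists>R. \<forall>x. norm x > R \<longrightarrow> f x = 0"
    then obtain R where "\<And>x. norm x > R \<Longrightarrow> f x = 0" by blast
    then have "\<forall>x\<in>support_on UNIV f. norm x \<le> R"
      unfolding support_on_def by (auto simp: not_less[symmetric])
    then show "bounded (support_on UNIV f)" unfolding bounded_iff by blast
  qed
  finally show ?thesis by (simp add: test_function_def)
qed

lemma test_function_smooth: "test_function f \<Longrightarrow> smooth f"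
  by (simp add: test_function_def)

lemma partial_deriv_zero_outside:
  assumes "\<And>x. norm x > R \<Longrightarrow> f x = 0" "norm x > R"
  shows "partial_deriv j f x = 0"
proof -
  have "open {x::plane. norm x > R}" by (intro open_Collect_less continuous_intros)
  then have "(f has_derivative (\<lambda>_. 0)) (at x)"
    by (rule has_derivative_transform_within_open[OF has_derivative_const]) (use assms in auto)
  then show ?thesis by (simp add: partial_deriv_eq)
qed

lemma test_function_cases:
  assumes "test_function f" obtains R where "R > 0" "\<And>x. norm x \<ge> R \<Longrightarrow> f x = 0"
    "\<And>j x. norm x \<ge> R \<Longrightarrow> partial_deriv j f x = 0"
proof -
  obtain R where R: "\<And>x. norm x > R \<Longrightarrow> f x = 0" using assms test_function_iff by blast
  show thesis
    \<comment> \<open>One unit of slack makes the radius positive and turns the strict inequality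
      into a weak one.\<close>
    by (rule that[of "\<bar>R\<bar> + 1"]) (use R partial_deriv_zero_outside[of R f] in auto)
qed

lemma test_functionI: "smooth f \<Longrightarrow> (\<And>x. norm x > R \<Longrightarrow> f x = 0) \<Longrightarrow> test_function f"
  unfolding test_function_iff by blast

lemma test_function_partial_deriv:
  assumes "test_function f" shows "test_function (partial_deriv j f)"
proof -
  obtain R where R: "\<And>x. norm x > R \<Longrightarrow> f x = 0" using assms test_function_iff by blast
  show ?thesis
  proof (rule test_functionI[of _ R])
    show "smooth (partial_deriv j f)" using assms by (simp add: smooth_partial_deriv test_function_smooth)
    show "partial_deriv j f x = 0" if "norm x > R" for x
      by (rule partial_deriv_zero_outside[of R f, OF _ that]) (rule R)
  qed
qed

lemma test_function_mult_left:
  fixes f g :: "plane \<Rightarrow> real" shows "test_function f \<Longrightarrow> smooth g \<Longrightarrow> test_function (\<lambda>x. f x * g x)"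
  unfolding test_function_iff by (auto simp: smooth_mult)

lemma test_function_mult_right:
  fixes f g :: "plane \<Rightarrow> real" shows "test_function g \<Longrightarrow> smooth f \<Longrightarrow> test_function (\<lambda>x. f x * g x)"
  unfolding test_function_iff by (auto simp: smooth_mult)

lemma test_function_add:
  assumes "test_function f" "test_function g" shows "test_function (\<lambda>x. f x + g x)"
proof -
  obtain R where "\<And>x. norm x \<ge> R \<Longrightarrow> f x = 0" using test_function_cases[OF assms(1)] by metis
  moreover obtain S where "\<And>x. norm x \<ge> S \<Longrightarrow> g x = 0" using test_function_cases[OF assms(2)] by metis
  ultimately show ?thesis
    by (intro test_functionI[of _ "max R S"]) (use assms in \<open>auto simp: test_function_smooth smooth_add\<close>)
qed

lemma test_function_sum: "finite A \<Longrightarrow> (\<And>i. i \<in> A \<Longrightarrow> test_function (f i)) \<Longrightarrow> test_function (\<lambda>x. \<Sum>i\<in>A. f i x)"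
proof (induction A rule: finite_induct)
  case empty
  then show ?case by (simp add: test_functionI)
next
  case (insert x F)
  then show ?case using test_function_add by force
qed

lemma test_function_reflect:
  fixes f :: "plane \<Rightarrow> real"
  assumes "test_function f" shows "test_function (\<lambda>y. f (a - y))"
proof -
  obtain R where R: "\<And>x. norm x \<ge> R \<Longrightarrow> f x = 0" using test_function_cases[OF assms(1)] by metis
  show ?thesis
  proof (rule test_functionI[of _ "R + norm a"])
    show "smooth (\<lambda>y. f (a - y))" using assms by (simp add: smooth_reflect test_function_smooth)
    show "f (a - x) = 0" if "norm x > R + norm a" for x
      using norm_triangle_ineq2[of x a] that by (intro R) (simp add: norm_minus_commute)
  qed
qed

lemma continuous_bounded_support:
  fixes f :: "plane \<Rightarrow> real"
  assumes "continuous_on UNIV f" "\<And>x. norm x \<ge> R \<Longrightarrow> f x = 0"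
  obtains M where "M > 0" "\<And>x. \<bar>f x\<bar> \<le> M"
proof -
  have "compact (f ` cball 0 R)"
    using assms(1) continuous_on_subset by (intro compact_continuous_image) auto
  then obtain M where M: "\<And>x. x \<in> cball 0 R \<Longrightarrow> \<bar>f x\<bar> \<le> M"
    by (metis bounded_real compact_imp_bounded image_eqI)
  show thesis
  proof (rule that[of "\<bar>M\<bar> + 1"])
    show "\<bar>f x\<bar> \<le> \<bar>M\<bar> + 1" for x
      using M[of x] assms(2)[of x] by (cases "norm x \<le> R") auto
  qed simp
qed

lemma test_function_bounded:
  fixes f :: "plane \<Rightarrow> real"
  assumes "test_function f" obtains M where "M > 0" "\<And>x. \<bar>f x\<bar> \<le> M"
proof -
  obtain R where "\<And>x. norm x \<ge> R \<Longrightarrow> f x = 0" using test_function_cases[OF assms] by metis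
  then show thesis
    using continuous_bounded_support[OF smooth_continuous[OF test_function_smooth[OF assms]]] that by metis
qed

lemma smooth_ray_derivative:
  fixes f :: "plane \<Rightarrow> real"
  assumes "smooth f"
  shows "((\<lambda>t. f (z + t *\<^sub>R h)) has_real_derivative (\<Sum>j\<in>UNIV. h $ j * partial_deriv j f (z + t *\<^sub>R h))) (at t within S)"
proof -
  have "((\<lambda>t. f (z + t *\<^sub>R h)) has_derivative (\<lambda>s. \<Sum>j\<in>UNIV. (s *\<^sub>R h) $ j *\<^sub>R partial_deriv j f (z + t *\<^sub>R h))) (at t within S)"
    by (rule has_derivative_compose[of "\<lambda>t. z + t *\<^sub>R h" "\<lambda>s. s *\<^sub>R h" _ _ f, OF _ has_derivative_partials[OF smooth_diff_at[OF assms]]])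
      (auto intro!: derivative_eq_intros)
  moreover have "(\<lambda>s. \<Sum>j\<in>UNIV. (s *\<^sub>R h) $ j *\<^sub>R partial_deriv j f (z + t *\<^sub>R h)) = (*) (\<Sum>j\<in>UNIV. h $ j * partial_deriv j f (z + t *\<^sub>R h))"
    by (rule ext) (simp add: sum_distrib_left sum_distrib_right mult_ac)
  ultimately show ?thesis unfolding has_field_derivative_def by metis
qed

lemma abs_component_sum_le:
  fixes h :: plane
  assumes "\<And>j. \<bar>c j\<bar> \<le> M"
  shows "\<bar>\<Sum>j\<in>UNIV. h $ j * c j\<bar> \<le> 2 * M * norm h"
proof -
  have "\<bar>\<Sum>j\<in>UNIV. h $ j * c j\<bar> \<le> (\<Sum>j\<in>(UNIV::2 set). norm h * M)"
    by (rule order_trans[OF sum_abs sum_mono]) (auto simp: abs_mult intro!: mult_mono component_le_norm_cart assms)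
  then show ?thesis by (simp add: mult_ac)
qed

lemma smooth_Lipschitz:
  fixes f :: "plane \<Rightarrow> real"
  assumes "smooth f" "\<And>j x. \<bar>partial_deriv j f x\<bar> \<le> M"
  shows "\<bar>f (z + h) - f z\<bar> \<le> 2 * M * norm h"
proof -
  obtain t where t: "0 < t" "t < 1"
    "f (z + 1 *\<^sub>R h) - f (z + 0 *\<^sub>R h) = (1 - 0) * (\<Sum>j\<in>UNIV. h $ j * partial_deriv j f (z + t *\<^sub>R h))"
    using MVT2[of 0 1 "\<lambda>t. f (z + t *\<^sub>R h)", OF _ smooth_ray_derivative[OF assms(1)]] by fastforce
  then show ?thesis using abs_component_sum_le[of "\<lambda>j. partial_deriv j f (z + t *\<^sub>R h)" M h] assms(2) by simp
qed

text \<open>The mean value theorem along the segment, followed by a Lipschitz bound for the first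
  derivatives. The point is that the quadratic remainder is uniform in \<open>z\<close>: this lets
  convolutions be differentiated under the integral by a direct estimate.\<close>

lemma test_function_Taylor:
  fixes f :: "plane \<Rightarrow> real"
  assumes "test_function f"
  obtains M where "M > 0" "\<And>z h. \<bar>f (z + h) - f z - (\<Sum>j\<in>UNIV. h $ j * partial_deriv j f z)\<bar> \<le> M * (norm h)\<^sup>2"
proof -
  have "\<exists>M>0. \<forall>x. \<bar>partial_deriv i (partial_deriv j f) x\<bar> \<le> M" for i j
    using test_function_bounded[OF test_function_partial_deriv[OF test_function_partial_deriv[OF assms]]] by metis
  then obtain M where M: "\<And>i j. M i j > 0" "\<And>i j x. \<bar>partial_deriv i (partial_deriv j f) x\<bar> \<le> M i j" by metis
  define N where "N = (\<Sum>i\<in>UNIV. \<Sum>j\<in>UNIV. M i j)"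
  have "M i j \<le> N" for i j
    unfolding N_def by (rule order_trans[OF member_le_sum[of j UNIV] member_le_sum[of i UNIV]]) (auto intro: less_imp_le M sum_nonneg)
  then have N: "\<bar>partial_deriv i (partial_deriv j f) x\<bar> \<le> N" for i j x using M(2) order_trans by blast
  have N0: "N > 0" using M(1) by (simp add: N_def sum_pos)
  have sm: "smooth f" using assms test_function_smooth by blast
  show thesis
  proof (rule that[of "4 * N"])
    fix z h :: plane
    obtain t where t: "0 < t" "t < 1"
      "f (z + 1 *\<^sub>R h) - f (z + 0 *\<^sub>R h) = (1 - 0) * (\<Sum>j\<in>UNIV. h $ j * partial_deriv j f (z + t *\<^sub>R h))"
      using MVT2[of 0 1 "\<lambda>t. f (z + t *\<^sub>R h)", OF _ smooth_ray_derivative[OF sm]] by fastforce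
    have "f (z + h) - f z - (\<Sum>j\<in>UNIV. h $ j * partial_deriv j f z)
      = (\<Sum>j\<in>UNIV. h $ j * (partial_deriv j f (z + t *\<^sub>R h) - partial_deriv j f z))"
      using t by (simp add: right_diff_distrib sum_subtractf)
    moreover have "\<bar>partial_deriv j f (z + t *\<^sub>R h) - partial_deriv j f z\<bar> \<le> 2 * N * norm h" for j
    proof -
      have "\<bar>partial_deriv j f (z + t *\<^sub>R h) - partial_deriv j f z\<bar> \<le> 2 * N * norm (t *\<^sub>R h)"
        by (rule smooth_Lipschitz[OF smooth_partial_deriv[OF sm] N])
      also have "\<dots> \<le> 2 * N * norm h" using t N0 by (simp add: mult_left_le_one_le)
      finally show ?thesis .
    qed
    ultimately show "\<bar>f (z + h) - f z - (\<Sum>j\<in>UNIV. h $ j * partial_deriv j f z)\<bar> \<le> 4 * N * (norm h)\<^sup>2"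
      using abs_component_sum_le[of "\<lambda>j. partial_deriv j f (z + t *\<^sub>R h) - partial_deriv j f z" "2 * N * norm h" h]
      by (simp add: power2_eq_square mult_ac)
  qed (use N0 in simp)
qed

subsection \<open>A smooth bump\<close>

lemma tendsto_poly_mult_exp_minus: "((\<lambda>x. poly p x * exp (- x)) \<longlongrightarrow> (0::real)) at_top"
proof -
  have "((\<lambda>x. \<Sum>i\<le>degree p. coeff p i * (x ^ i / exp x)) \<longlongrightarrow> (\<Sum>i\<le>degree p. coeff p i * 0)) at_top"
    by (rule tendsto_sum, rule tendsto_mult_left, rule tendsto_power_div_exp_0)
  moreover have "poly p x * exp (- x) = (\<Sum>i\<le>degree p. coeff p i * (x ^ i / exp x))" for x
    unfolding poly_altdef sum_distrib_right by (rule sum.cong) (simp_all add: exp_minus field_simps)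
  ultimately show ?thesis by simp
qed

text \<open>With \<open>s = 1 / t\<close>, the derivative of \<open>p(s) exp(-s)\<close> with
  respect to \<open>t\<close> is \<open>s^2 (p - p')(s) exp(-s)\<close>. Thus
  \<open>bump_D k\<close> is the \<open>k\<close>-th derivative of \<open>exp(-1/t)\<close>,
  continued by zero to \<open>t \<le> 0\<close>.\<close>

primrec bump_poly :: "nat \<Rightarrow> real poly" where
  "bump_poly 0 = 1"
| "bump_poly (Suc k) = [:0, 0, 1:] * (bump_poly k - pderiv (bump_poly k))"

definition bump_D :: "nat \<Rightarrow> real \<Rightarrow> real" where
  "bump_D k t = (if t > 0 then poly (bump_poly k) (1 / t) * exp (- (1 / t)) else 0)"

lemma bump_D_deriv: "(bump_D k has_real_derivative bump_D (Suc k) t) (at t)"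
proof -
  consider "t > 0" | "t < 0" | "t = 0" by (metis linorder_less_linear)
  then show ?thesis
  proof cases
    case 1
    have "((\<lambda>t. poly (bump_poly k) (1 / t) * exp (- (1 / t))) has_real_derivative bump_D (Suc k) t) (at t)"
    proof -
      have d: "((\<lambda>t. 1 / t) has_real_derivative - (1 / t\<^sup>2)) (at t)"
        using 1 by (auto intro!: derivative_eq_intros simp: power2_eq_square)
      show ?thesis
        by (rule DERIV_cong[OF DERIV_mult[OF DERIV_chain2[OF poly_DERIV d] DERIV_chain2[OF DERIV_exp DERIV_minus[OF d]]]])
          (use 1 in \<open>simp add: bump_D_def power2_eq_square algebra_simps\<close>)
    qed
    then show ?thesis
      by (rule has_field_derivative_transform_within_open[where S="{0<..}"]) (use 1 in \<open>auto simp: bump_D_def\<close>)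
  next
    case 2
    have "((\<lambda>t. 0) has_real_derivative bump_D (Suc k) t) (at t)" using 2 by (simp add: bump_D_def)
    then show ?thesis
      by (rule has_field_derivative_transform_within_open[where S="{..<0}"]) (use 2 in \<open>auto simp: bump_D_def\<close>)
  next
    case 3
    \<comment> \<open>At the origin the difference quotient from the right is again a polynomial in
      \<open>1 / h\<close> times \<open>exp (- 1 / h)\<close>; the extra factor
      \<open>[:0, 1:]\<close> is the division by \<open>h\<close>.\<close>
    have "((\<lambda>h. poly ([:0, 1:] * bump_poly k) (inverse h) * exp (- inverse h)) \<longlongrightarrow> 0) (at_right 0)"
      by (rule filterlim_compose[OF tendsto_poly_mult_exp_minus filterlim_inverse_at_top_right])
    then have "((\<lambda>h. bump_D k h / h) \<longlongrightarrow> 0) (at_right 0)"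
      by (rule Lim_transform_eventually)
        (auto simp: eventually_at_filter bump_D_def field_simps)
    moreover have "((\<lambda>h. bump_D k h / h) \<longlongrightarrow> 0) (at_left 0)"
      by (rule Lim_transform_eventually[OF tendsto_const]) (auto simp: eventually_at_filter bump_D_def)
    ultimately have "((\<lambda>h. bump_D k h / h) \<longlongrightarrow> 0) (at 0)" by (simp add: filterlim_split_at)
    then show ?thesis unfolding has_field_derivative_iff using 3 by (simp add: bump_D_def)
  qed
qed

lemma bump_D_0: "bump_D 0 t = (if t > 0 then exp (- (1 / t)) else 0)"
  by (simp add: bump_D_def)

lemma bump_D_nonpos: "t \<le> 0 \<Longrightarrow> bump_D k t = 0"
  by (simp add: bump_D_def)

lemma bump_D_1_nonneg: "bump_D 1 t \<ge> 0"
  by (simp add: bump_D_def power2_eq_square[symmetric])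

text \<open>The range \<open>t \<le> 1\<close> is enough because the argument
  \<open>1 - loglog x / N\<close> of the cutoff never exceeds 1. Boundedness comes from compactness
  of \<open>{0..1}\<close> and vanishing to its left.\<close>

lemma bump_D_bounded: "\<exists>M>0. \<forall>t\<le>1. \<bar>bump_D k t\<bar> \<le> M"
proof -
  have "continuous_on {0..1} (bump_D k)"
    by (intro continuous_at_imp_continuous_on ballI DERIV_isCont[OF bump_D_deriv])
  then have "compact (bump_D k ` {0..1})" by (rule compact_continuous_image) simp
  then obtain M where M: "\<And>t. t \<in> {0..1} \<Longrightarrow> \<bar>bump_D k t\<bar> \<le> M"
    by (metis bounded_real compact_imp_bounded image_eqI)
  have "\<bar>bump_D k t\<bar> \<le> \<bar>M\<bar> + 1" if "t \<le> 1" for t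
    using M[of t] that by (cases "t \<ge> 0") (auto simp: bump_D_nonpos)
  then show ?thesis by (intro exI[of _ "\<bar>M\<bar> + 1"]) auto
qed

lemma smooth_bump_compose: "smooth f \<Longrightarrow> smooth (\<lambda>x. bump_D k (f x))"
proof -
  assume "smooth f"
  have "smooth (\<lambda>x. (\<lambda>m. bump_D (k + m)) 0 (f x))"
    by (rule smooth_compose[where S=UNIV]) (use bump_D_deriv \<open>smooth f\<close> in auto)
  then show ?thesis by simp
qed

lemma norm_sq_plane: "(norm (x::plane))\<^sup>2 = (\<Sum>j\<in>UNIV. x $ j * x $ j)"
  by (simp add: norm_vec_def L2_set_def sum_nonneg power2_eq_square)

lemma smooth_norm_sq: "smooth (\<lambda>x::plane. (norm x)\<^sup>2)"
  unfolding norm_sq_plane by (intro smooth_sum smooth_mult smooth_component)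

lemma partial_deriv_norm_sq: "partial_deriv j (\<lambda>x::plane. (norm x)\<^sup>2) = (\<lambda>x. 2 * x $ j)"
  using exhaust_2[of j] unfolding norm_sq_plane
  by (auto simp: partial_deriv_add partial_deriv_mult smooth_mult smooth_component partial_deriv_component sum_2)

subsection \<open>Integration over the plane\<close>

abbreviation LB :: "plane measure" where "LB \<equiv> lborel"

lemma nn_integral_translate:
  fixes f :: "plane \<Rightarrow> ennreal"
  assumes [measurable]: "f \<in> borel_measurable borel"
  shows "(\<integral>\<^sup>+x. f (x + a) \<partial>lborel) = (\<integral>\<^sup>+x. f x \<partial>lborel)"
  by (subst (2) lborel_distr_plus[of a, symmetric], subst nn_integral_distr) (auto simp: add.commute)

lemma integral_translate:
  fixes f :: "plane \<Rightarrow> real"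
  assumes [measurable]: "f \<in> borel_measurable borel"
  shows "(\<integral>x. f (x + a) \<partial>lborel) = (\<integral>x. f x \<partial>lborel)"
  by (subst (2) lborel_distr_plus[of a, symmetric], subst integral_distr) (auto simp: add.commute)

lemma integrable_translate:
  fixes f :: "plane \<Rightarrow> real"
  assumes f: "integrable lborel f"
  shows "integrable lborel (\<lambda>x. f (x + a))"
proof -
  have [measurable]: "f \<in> borel_measurable borel" using f by auto
  have "integrable (distr lborel borel ((+) a)) f" using f by (simp add: lborel_distr_plus)
  then show ?thesis by (subst (asm) integrable_distr_eq) (auto simp: add.commute)
qed

lemma integral_reflect:
  fixes f :: "plane \<Rightarrow> real"
  assumes [measurable]: "f \<in> borel_measurable borel"
  shows "(\<integral>x. f (a - x) \<partial>lborel) = (\<integral>x. f x \<partial>lborel)"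
  by (subst (2) lborel_affine[of "-1" a], simp, subst integral_density)
    (auto simp: integral_distr)

lemma integrable_indicator_cball: "integrable LB (\<lambda>x. indicator (cball 0 R) x * c :: real)"
  using emeasure_lborel_cball_finite[of "0::plane" R] by (intro integrable_mult_left) (auto simp: less_top)

lemma integrable_bounded_support:
  fixes f :: "plane \<Rightarrow> real"
  assumes [measurable]: "f \<in> borel_measurable borel"
    and "\<And>x. norm x \<le> R \<Longrightarrow> \<bar>f x\<bar> \<le> M" "\<And>x. norm x > R \<Longrightarrow> f x = 0"
  shows "integrable lborel f"
proof (rule Bochner_Integration.integrable_bound[OF integrable_indicator_cball[of R M]])
  show "AE x in lborel. norm (f x) \<le> norm (indicator (cball 0 R) x * M)"
    using assms by (intro AE_I2) (fastforce simp: indicator_def not_le)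
qed simp

lemma test_function_integrable:
  fixes f :: "plane \<Rightarrow> real"
  assumes "test_function f" shows "integrable lborel f"
proof -
  obtain R where R: "\<And>x. norm x \<ge> R \<Longrightarrow> f x = 0" using test_function_cases[OF assms] by metis
  obtain M where "\<And>x. \<bar>f x\<bar> \<le> M" using test_function_bounded[OF assms] by metis
  then show ?thesis
    using R by (intro integrable_bounded_support[of _ R M]) (auto simp: smooth_measurable test_function_smooth assms)
qed

text \<open>Every difference quotient has integral zero by translation invariance. A Lipschitz
  constant times the indicator of a slightly larger ball dominates all of them, so the limit has
  integral zero as well.\<close>

lemma integral_partial_deriv_test:
  fixes f :: "plane \<Rightarrow> real"
  assumes t: "test_function f"
  shows "(\<integral>x. partial_deriv j f x \<partial>lborel) = 0"
proof -
  have sm: "smooth f" by (rule test_function_smooth[OF t])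
  note m [measurable] = smooth_measurable[OF sm] smooth_measurable[OF smooth_partial_deriv[OF sm]]
  obtain R where R: "R > 0" "\<And>x. norm x \<ge> R \<Longrightarrow> f x = 0" using test_function_cases[OF t] by metis
  have "\<exists>M>0. \<forall>x. \<bar>partial_deriv i f x\<bar> \<le> M" for i
    using test_function_bounded[OF test_function_partial_deriv[OF t]] by metis
  then obtain M where M: "\<And>i. M i > 0" "\<And>i x. \<bar>partial_deriv i f x\<bar> \<le> M i" by metis
  define N where "N = (\<Sum>i\<in>UNIV. M i)"
  have "M i \<le> N" for i unfolding N_def by (rule member_le_sum) (auto intro: less_imp_le M)
  then have N: "\<bar>partial_deriv i f x\<bar> \<le> N" for i x using M(2) order_trans by blast
  define e :: plane where "e = axis j 1"
  have ne: "norm e = 1" by (simp add: e_def)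
  define g where "g n x = (f (x + inverse (real (Suc n)) *\<^sub>R e) - f x) / inverse (real (Suc n))" for n x
  have [measurable]: "g n \<in> borel_measurable borel" for n unfolding g_def by measurable
  have mollified: "partial_deriv j f \<in> borel_measurable lborel" and mg: "g n \<in> borel_measurable lborel" for n
    by simp_all
  have "(\<lambda>n. \<integral>x. g n x \<partial>lborel) \<longlonglongrightarrow> (\<integral>x. partial_deriv j f x \<partial>lborel)"
  proof (rule integral_dominated_convergence[where w="\<lambda>x. indicator (cball 0 (R + 1)) x * (2 * N)"])
    show "AE x in lborel. (\<lambda>n. g n x) \<longlonglongrightarrow> partial_deriv j f x"
    proof (rule AE_I2)
      fix x
      have "((\<lambda>t. f (x + t *\<^sub>R e)) has_real_derivative (\<Sum>k\<in>UNIV. e $ k * partial_deriv k f (x + 0 *\<^sub>R e))) (at 0)"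
        by (rule smooth_ray_derivative[OF sm])
      moreover have "(\<Sum>k\<in>UNIV. e $ k * partial_deriv k f (x + 0 *\<^sub>R e)) = partial_deriv j f x"
        by (simp add: e_def axis_def if_distrib[of "\<lambda>x. x * _"] cong: if_cong)
      ultimately have l: "((\<lambda>h. (f (x + h *\<^sub>R e) - f x) / h) \<longlongrightarrow> partial_deriv j f x) (at 0)"
        unfolding has_field_derivative_iff by simp
      have "filterlim (\<lambda>n. inverse (real (Suc n))) (at 0) sequentially"
        using LIMSEQ_inverse_real_of_nat by (simp add: filterlim_at)
      from filterlim_compose[OF l this] show "(\<lambda>n. g n x) \<longlonglongrightarrow> partial_deriv j f x"
        by (simp add: g_def)
    qed
    show "AE x in lborel. norm (g n x) \<le> indicator (cball 0 (R + 1)) x * (2 * N)" for n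
    proof (rule AE_I2)
      fix x
      let ?s = "inverse (real (Suc n))"
      have s: "?s > 0" "?s \<le> 1" by (auto simp: field_simps)
      show "norm (g n x) \<le> indicator (cball 0 (R + 1)) x * (2 * N)"
      proof (cases "norm x \<le> R + 1")
        case True
        have "\<bar>f (x + ?s *\<^sub>R e) - f x\<bar> \<le> 2 * N * norm (?s *\<^sub>R e)"
          by (rule smooth_Lipschitz[OF sm N])
        then have "\<bar>f (x + ?s *\<^sub>R e) - f x\<bar> / ?s \<le> 2 * N"
          using ne s(1) by (simp only: pos_divide_le_eq norm_scaleR)
        then show ?thesis using True by (simp add: g_def abs_divide)
      next
        case False
        have "norm (x + ?s *\<^sub>R e) \<ge> R"
          using norm_triangle_ineq4[of "x + ?s *\<^sub>R e" "?s *\<^sub>R e"] False ne s by simp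
        then show ?thesis using False R(2)[of x] R(2)[of "x + ?s *\<^sub>R e"] by (simp add: g_def)
      qed
    qed
  qed (rule mollified mg integrable_indicator_cball)+
  moreover have "(\<integral>x. g n x \<partial>lborel) = 0" for n
  proof -
    have "(\<integral>x. g n x \<partial>lborel) = (\<integral>x. f (x + inverse (real (Suc n)) *\<^sub>R e) - f x \<partial>lborel) / inverse (real (Suc n))"
      unfolding g_def by simp
    then show ?thesis
      using integrable_translate[OF test_function_integrable[OF t]] test_function_integrable[OF t]
      by (simp add: integral_translate)
  qed
  ultimately show ?thesis using LIMSEQ_const_iff[of 0 "(\<integral>x. partial_deriv j f x \<partial>lborel)"] by simp
qed

lemma integral_by_parts_test:
  fixes f g :: "plane \<Rightarrow> real"
  assumes "test_function f" "smooth g"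
  shows "(\<integral>x. g x * partial_deriv j f x \<partial>lborel) = - (\<integral>x. partial_deriv j g x * f x \<partial>lborel)"
proof -
  have sm: "smooth f" using assms(1) by (rule test_function_smooth)
  have "(\<integral>x. partial_deriv j (\<lambda>x. g x * f x) x \<partial>lborel) = 0"
    by (rule integral_partial_deriv_test[OF test_function_mult_right[OF assms]])
  moreover have "integrable lborel (\<lambda>x. g x * partial_deriv j f x)" "integrable lborel (\<lambda>x. partial_deriv j g x * f x)"
    using assms by (auto intro!: test_function_integrable test_function_mult_right test_function_partial_deriv smooth_partial_deriv)
  ultimately show ?thesis using assms(2) sm by (simp add: partial_deriv_mult)
qed

subsection \<open>Local and square integrability\<close>

text \<open>Borel measurable counterpart of \<open>locally_integrable\<close> for scalar functions;
  closed balls around the origin replace general compact sets.\<close>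

definition loc_int :: "(plane \<Rightarrow> real) \<Rightarrow> bool" where
  "loc_int f \<longleftrightarrow> f \<in> borel_measurable borel \<and> (\<forall>R. integrable lborel (\<lambda>x. indicator (cball 0 R) x * f x))"

definition sq_int :: "(plane \<Rightarrow> real) \<Rightarrow> bool" where
  "sq_int f \<longleftrightarrow> f \<in> borel_measurable borel \<and> integrable lborel (\<lambda>x. (f x)\<^sup>2)"

lemma loc_int_measurable: "loc_int f \<Longrightarrow> f \<in> borel_measurable borel"
  by (simp add: loc_int_def)

lemma sq_int_mult:
  assumes "sq_int f" "sq_int g" shows "integrable lborel (\<lambda>x. f x * g x)"
proof (rule Bochner_Integration.integrable_bound)
  show "integrable lborel (\<lambda>x. (f x)\<^sup>2 + (g x)\<^sup>2)" using assms by (simp add: sq_int_def)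
  have [measurable]: "f \<in> borel_measurable borel" "g \<in> borel_measurable borel" using assms by (auto simp: sq_int_def)
  show "(\<lambda>x. f x * g x) \<in> borel_measurable lborel" by measurable
  have "\<bar>f x * g x\<bar> \<le> \<bar>(f x)\<^sup>2 + (g x)\<^sup>2\<bar>" for x
  proof -
    have "0 \<le> \<bar>f x\<bar> * \<bar>g x\<bar>" by simp
    then show ?thesis using sum_squares_bound[of "\<bar>f x\<bar>" "\<bar>g x\<bar>"] unfolding abs_mult power2_abs by linarith
  qed
  then show "AE x in lborel. norm (f x * g x) \<le> norm ((f x)\<^sup>2 + (g x)\<^sup>2)" by simp
qed

lemma sq_int_dominated:
  assumes "sq_int g" "f \<in> borel_measurable borel" "AE x in lborel. \<bar>f x\<bar> \<le> C * \<bar>g x\<bar>"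
  shows "sq_int f"
proof -
  have [measurable]: "f \<in> borel_measurable borel" by fact
  have "integrable lborel (\<lambda>x. (f x)\<^sup>2)"
  proof (rule Bochner_Integration.integrable_bound)
    show "integrable lborel (\<lambda>x. C\<^sup>2 * (g x)\<^sup>2)" using assms by (simp add: sq_int_def)
    show "AE x in lborel. norm ((f x)\<^sup>2) \<le> norm (C\<^sup>2 * (g x)\<^sup>2)"
      using assms(3)
    proof eventually_elim
      case (elim x)
      then have "\<bar>f x\<bar>\<^sup>2 \<le> (C * \<bar>g x\<bar>)\<^sup>2" by (intro power_mono) auto
      then show ?case by (simp add: power_mult_distrib)
    qed
  qed measurable
  then show ?thesis by (simp add: sq_int_def)
qed

lemma sq_int_cmult: "sq_int f \<Longrightarrow> sq_int (\<lambda>x. c * f x)"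
  by (auto simp: sq_int_def power_mult_distrib)

lemma sq_int_minus: "sq_int f \<Longrightarrow> sq_int (\<lambda>x. - f x)"
  by (auto simp: sq_int_def)

lemma sq_int_add:
  assumes "sq_int f" "sq_int g" shows "sq_int (\<lambda>x. f x + g x)"
  using assms sq_int_mult[OF assms] by (auto simp: sq_int_def power2_sum mult.assoc)

lemma sq_int_diff: "sq_int f \<Longrightarrow> sq_int g \<Longrightarrow> sq_int (\<lambda>x. f x - g x)"
  using sq_int_add[OF _ sq_int_minus, of f g] by simp

lemma sq_int_zero: "sq_int (\<lambda>_. 0)"
  by (simp add: sq_int_def)

lemma Cauchy_Schwarz_sq_int:
  assumes "sq_int f" "sq_int g"
  shows "(\<integral>x. f x * g x \<partial>lborel)\<^sup>2 \<le> (\<integral>x. (f x)\<^sup>2 \<partial>lborel) * (\<integral>x. (g x)\<^sup>2 \<partial>lborel)"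
proof -
  define A where "A = (\<integral>x. (f x)\<^sup>2 \<partial>lborel)"
  define B where "B = (\<integral>x. f x * g x \<partial>lborel)"
  define C where "C = (\<integral>x. (g x)\<^sup>2 \<partial>lborel)"
  have i: "integrable lborel (\<lambda>x. (f x)\<^sup>2)" "integrable lborel (\<lambda>x. (g x)\<^sup>2)" "integrable lborel (\<lambda>x. f x * g x)"
    using assms sq_int_mult[OF assms] by (auto simp: sq_int_def)
  have q: "0 \<le> s\<^sup>2 * A - 2 * s * t * B + t\<^sup>2 * C" for s t
  proof -
    have "0 \<le> (\<integral>x. (s * f x - t * g x)\<^sup>2 \<partial>lborel)" by simp
    also have "(\<lambda>x. (s * f x - t * g x)\<^sup>2) = (\<lambda>x. s\<^sup>2 * (f x)\<^sup>2 - 2 * s * t * (f x * g x) + t\<^sup>2 * (g x)\<^sup>2)"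
      by (rule ext) (simp add: power2_eq_square algebra_simps)
    finally show ?thesis using i by (simp add: A_def B_def C_def)
  qed
  have AC: "A \<ge> 0" "C \<ge> 0" by (auto simp: A_def C_def)
  have "B\<^sup>2 \<le> A * C"
  proof (cases "C = 0")
    case True
    have "B = 0"
    proof (rule ccontr)
      assume "B \<noteq> 0"
      \<comment> \<open>For \<open>C = 0\<close> the quadratic form is affine in \<open>t\<close>;
        this choice gives it the value \<open>A - (A + 1) = -1\<close>.\<close>
      then show False using q[of 1 "(A + 1) / (2 * B)"] True by (simp add: field_simps)
    qed
    then show ?thesis using True by simp
  next
    case False
    \<comment> \<open>The ratio \<open>t / s = B / C\<close> minimises the quadratic form; scaling
      by \<open>C\<close> clears the denominator.\<close>
    have "0 \<le> C * (A * C - B\<^sup>2)" using q[of C B] by (simp add: power2_eq_square algebra_simps)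
    then show ?thesis using False AC by (simp add: zero_le_mult_iff)
  qed
  then show ?thesis by (simp add: A_def B_def C_def)
qed

lemma loc_int_mult_bounded_support:
  assumes "loc_int f" "g \<in> borel_measurable borel" "\<And>x. \<bar>g x\<bar> \<le> M" "\<And>x. norm x > R \<Longrightarrow> g x = 0"
  shows "integrable lborel (\<lambda>x. f x * g x)"
proof (rule Bochner_Integration.integrable_bound)
  show "integrable lborel (\<lambda>x. M * (indicator (cball 0 R) x * f x))"
    using assms(1) by (simp add: loc_int_def)
  have [measurable]: "f \<in> borel_measurable borel" "g \<in> borel_measurable borel" using assms by (auto simp: loc_int_def)
  show "(\<lambda>x. f x * g x) \<in> borel_measurable lborel" by measurable
  have "\<bar>f x * g x\<bar> \<le> \<bar>M * (indicator (cball 0 R) x * f x)\<bar>" for x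
    using assms(3)[of x] assms(4)[of x] mult_right_mono[of "\<bar>g x\<bar>" "\<bar>M\<bar>" "\<bar>f x\<bar>"]
    by (cases "norm x \<le> R") (auto simp: abs_mult mult_ac)
  then show "AE x in lborel. norm (f x * g x) \<le> norm (M * (indicator (cball 0 R) x * f x))" by simp
qed

lemma loc_int_mult_test:
  fixes g :: "plane \<Rightarrow> real"
  assumes "loc_int f" "test_function g"
  shows "integrable lborel (\<lambda>x. f x * g x)"
proof -
  obtain R where "\<And>x. norm x \<ge> R \<Longrightarrow> g x = 0" using test_function_cases[OF assms(2)] by metis
  moreover obtain M where "\<And>x. \<bar>g x\<bar> \<le> M" using test_function_bounded[OF assms(2)] by metis
  ultimately show ?thesis
    using assms by (intro loc_int_mult_bounded_support[of _ _ M R]) (auto simp: smooth_measurable test_function_smooth)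
qed

lemma loc_int_add: "loc_int f \<Longrightarrow> loc_int g \<Longrightarrow> loc_int (\<lambda>x. f x + g x)"
  unfolding loc_int_def by (auto simp: distrib_left)

lemma loc_int_cmult: "loc_int f \<Longrightarrow> loc_int (\<lambda>x. c * f x)"
  by (auto simp: loc_int_def mult.left_commute)

lemma loc_int_diff: "loc_int f \<Longrightarrow> loc_int g \<Longrightarrow> loc_int (\<lambda>x. f x - g x)"
  using loc_int_add[OF _ loc_int_cmult[of g "-1"], of f] by simp

lemma sq_int_indicator_cball: "sq_int (indicator (cball 0 R))"
proof -
  have "(\<lambda>x::plane. (indicator (cball 0 R) x :: real)\<^sup>2) = (\<lambda>x. indicator (cball 0 R) x * 1)"
    by (rule ext) (simp add: indicator_def)
  then show ?thesis using integrable_indicator_cball[of R 1] unfolding sq_int_def by (simp only:) measurable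
qed

lemma sq_int_loc_int: "sq_int f \<Longrightarrow> loc_int f"
  using sq_int_mult[OF sq_int_indicator_cball] by (simp add: loc_int_def sq_int_def)

lemma continuous_loc_int:
  fixes f :: "plane \<Rightarrow> real"
  assumes "continuous_on UNIV f" shows "loc_int f"
proof -
  have m [measurable]: "f \<in> borel_measurable borel" by (rule borel_measurable_continuous_onI[OF assms])
  have "integrable lborel (\<lambda>x. indicator (cball 0 R) x * f x)" for R
  proof -
    have "compact (f ` cball 0 R)" using assms continuous_on_subset by (intro compact_continuous_image) auto
    then obtain M where "\<And>x. x \<in> cball 0 R \<Longrightarrow> \<bar>f x\<bar> \<le> M" by (metis bounded_real compact_imp_bounded image_eqI)
    moreover have "(\<lambda>x. indicator (cball 0 R) x * f x) \<in> borel_measurable borel"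
      by (intro borel_measurable_times borel_measurable_indicator m) simp
    ultimately show ?thesis by (intro integrable_bounded_support[of _ R M]) auto
  qed
  then show ?thesis by (simp add: loc_int_def)
qed

lemma loc_int_const: "loc_int (\<lambda>_. c)"
  by (simp add: continuous_loc_int)

subsection \<open>Convolution with test functions\<close>

definition conv :: "(plane \<Rightarrow> real) \<Rightarrow> (plane \<Rightarrow> real) \<Rightarrow> plane \<Rightarrow> real" where
  "conv f \<eta> x = (\<integral>y. f y * \<eta> (x - y) \<partial>lborel)"

lemma has_derivative_quadratic_remainder:
  fixes f :: "plane \<Rightarrow> real"
  assumes "bounded_linear L" "\<And>h. norm h \<le> 1 \<Longrightarrow> \<bar>f (x + h) - f x - L h\<bar> \<le> C * (norm h)\<^sup>2"
  shows "(f has_derivative L) (at x)"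
  unfolding has_derivative_at
proof (intro conjI assms(1))
  have "((\<lambda>h::plane. C * norm h) \<longlongrightarrow> 0) (at 0)"
    by (rule tendsto_eq_intros tendsto_norm_zero tendsto_ident_at refl | simp)+
  moreover have "\<forall>\<^sub>F h in at 0. norm (norm (f (x + h) - f x - L h) / norm h) \<le> C * norm h"
  proof (rule eventually_mono[OF eventually_at_ball[of 1 "0::plane" UNIV]])
    fix h :: plane assume "h \<in> ball 0 1 \<and> h \<in> UNIV"
    then have "norm h \<le> 1" by simp
    from assms(2)[OF this] show "norm (norm (f (x + h) - f x - L h) / norm h) \<le> C * norm h"
      by (cases "h = 0") (simp_all add: divide_simps power2_eq_square mult_ac)
  qed simp
  ultimately show "((\<lambda>h. norm (f (x + h) - f x - L h) / norm h) \<longlongrightarrow> 0) (at 0)"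
    by (rule Lim_null_comparison[rotated])
qed

lemma integrable_conv:
  assumes "loc_int f" "test_function \<eta>" shows "integrable lborel (\<lambda>y. f y * \<eta> (x - y))"
  by (rule loc_int_mult_test[OF assms(1) test_function_reflect[OF assms(2)]])

lemma has_derivative_conv:
  assumes f: "loc_int f" and t: "test_function \<eta>"
  shows "(conv f \<eta> has_derivative (\<lambda>h. \<Sum>j\<in>UNIV. h $ j * conv f (partial_deriv j \<eta>) x)) (at x)"
proof -
  obtain R where R: "R > 0" "\<And>x. norm x \<ge> R \<Longrightarrow> \<eta> x = 0" "\<And>j x. norm x \<ge> R \<Longrightarrow> partial_deriv j \<eta> x = 0"
    using test_function_cases[OF t] by metis
  obtain M where M: "M > 0" "\<And>z h. \<bar>\<eta> (z + h) - \<eta> z - (\<Sum>j\<in>UNIV. h $ j * partial_deriv j \<eta> z)\<bar> \<le> M * (norm h)\<^sup>2"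
    using test_function_Taylor[OF t] by metis
  have fm [measurable]: "f \<in> borel_measurable borel" using f by (rule loc_int_measurable)
  \<comment> \<open>For \<open>norm h \<le> 1\<close> and \<open>y\<close> outside this ball both
    \<open>x - y\<close> and \<open>x + h - y\<close> lie outside the support of the test function,
    so the remainder vanishes there and only the integral of \<open>f\<close> over one fixed ball
    enters.\<close>
  define S where "S = norm x + R + 1"
  define B where "B = (\<integral>y. \<bar>indicator (cball 0 S) y * f y\<bar> \<partial>lborel)"
  show ?thesis
  proof (rule has_derivative_quadratic_remainder[where C="M * B"])
    show "bounded_linear (\<lambda>h. \<Sum>j\<in>UNIV. h $ j * conv f (partial_deriv j \<eta>) x)"
      by (intro bounded_linear_sum bounded_linear_mult_left bounded_linear_compose[OF bounded_linear_mult_left bounded_linear_vec_nth])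
    fix h :: plane assume h: "norm h \<le> 1"
    define r where "r y = \<eta> (x + h - y) - \<eta> (x - y) - (\<Sum>j\<in>UNIV. h $ j * partial_deriv j \<eta> (x - y))" for y
    note i = integrable_conv[OF f t] integrable_conv[OF f test_function_partial_deriv[OF t]]
    have fr: "(\<lambda>y. f y * r y) = (\<lambda>y. f y * \<eta> (x + h - y) - f y * \<eta> (x - y) - (\<Sum>j\<in>UNIV. h $ j * (f y * partial_deriv j \<eta> (x - y))))"
      by (rule ext) (simp add: r_def right_diff_distrib sum_distrib_left mult_ac)
    then have ifr: "integrable lborel (\<lambda>y. f y * r y)" using i by simp
    have eq: "conv f \<eta> (x + h) - conv f \<eta> x - (\<Sum>j\<in>UNIV. h $ j * conv f (partial_deriv j \<eta>) x) = (\<integral>y. f y * r y \<partial>lborel)"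
      unfolding fr using i by (simp add: conv_def)
    have "\<bar>f y * r y\<bar> \<le> M * (norm h)\<^sup>2 * \<bar>indicator (cball 0 S) y * f y\<bar>" for y
    proof (cases "norm y \<le> S")
      case True
      have "x + h - y = x - y + h" by simp
      then have "\<bar>r y\<bar> \<le> M * (norm h)\<^sup>2" unfolding r_def using M(2)[of "x - y" h] by metis
      then show ?thesis using True by (simp add: abs_mult mult.commute mult_left_mono)
    next
      case False
      then have "norm (x - y) \<ge> R + 1" using norm_triangle_ineq2[of y x] by (simp add: S_def norm_minus_commute)
      moreover have "norm (x + h - y) \<ge> R"
        using calculation norm_triangle_ineq4[of "x + h - y" h] h by simp
      ultimately have "r y = 0" using R by (simp add: r_def)
      then show ?thesis by (simp add: M(1) less_imp_le)
    qed
    moreover have "integrable lborel (\<lambda>y. indicator (cball 0 S) y * f y)" using f by (simp add: loc_int_def)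
    ultimately have "norm (\<integral>y. f y * r y \<partial>lborel) \<le> (\<integral>y. M * (norm h)\<^sup>2 * \<bar>indicator (cball 0 S) y * f y\<bar> \<partial>lborel)"
      by (intro Bochner_Integration.integral_norm_bound_integral[OF ifr]) auto
    then show "\<bar>conv f \<eta> (x + h) - conv f \<eta> x - (\<Sum>j\<in>UNIV. h $ j * conv f (partial_deriv j \<eta>) x)\<bar> \<le> M * B * (norm h)\<^sup>2"
      unfolding eq by (simp add: B_def mult_ac)
  qed
qed

lemma partial_deriv_conv:
  assumes "loc_int f" "test_function \<eta>"
  shows "partial_deriv j (conv f \<eta>) = conv f (partial_deriv j \<eta>)"
  by (rule ext, subst partial_deriv_eq[OF has_derivative_conv[OF assms]])
    (simp add: axis_def if_distrib[of "\<lambda>x. x * _"] cong: if_cong)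

lemma smooth_conv:
  assumes "loc_int f" "test_function \<eta>"
  shows "smooth (conv f \<eta>)"
proof -
  have d: "conv f \<zeta> differentiable_on UNIV" if "test_function \<zeta>" for \<zeta>
    using has_derivative_conv[OF assms(1) that] unfolding differentiable_on_def differentiable_def by blast
  have "smooth_ord n (conv f \<zeta>)" if "test_function \<zeta>" for n \<zeta>
    using that
  proof (induction n arbitrary: \<zeta>)
    case 0 then show ?case by (simp add: smooth_ord_0 d)
  next
    case (Suc n) then show ?case
      by (simp add: smooth_ord_Suc d partial_deriv_conv[OF assms(1)] test_function_partial_deriv)
  qed
  then show ?thesis using assms(2) by (simp add: smooth_iff_smooth_ord)
qed

lemma cball_borel [measurable]: "cball (c::plane) R \<in> sets borel"
  by simp

subsection \<open>Mollifiers\<close>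

text \<open>All scales are at most 1, so a mollification at \<open>x\<close> sees only the unit ball
  around \<open>x\<close>, on which \<open>log_weight\<close> varies by a bounded factor.\<close>

definition mollifier_scale :: "nat \<Rightarrow> real" where "mollifier_scale n = 1 / real (Suc n)"

text \<open>Inside the ball of radius \<open>s = mollifier_scale n\<close> this is
  \<open>exp (- 1 / (s^2 - |x|^2))\<close>; the squared norm keeps it smooth at the origin.\<close>

definition mollifier_pre :: "nat \<Rightarrow> plane \<Rightarrow> real" where
  "mollifier_pre n x = bump_D 0 ((mollifier_scale n)\<^sup>2 - (norm x)\<^sup>2)"

definition mollifier :: "nat \<Rightarrow> plane \<Rightarrow> real" where
  "mollifier n x = inverse (\<integral>y. mollifier_pre n y \<partial>lborel) * mollifier_pre n x"

lemma mollifier_scale_pos: "mollifier_scale n > 0" and mollifier_scale_le_1: "mollifier_scale n \<le> 1"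
  by (auto simp: mollifier_scale_def)

lemma mollifier_scale_tendsto: "mollifier_scale \<longlonglongrightarrow> 0"
  using LIMSEQ_inverse_real_of_nat by (simp add: mollifier_scale_def[abs_def] inverse_eq_divide)

lemma mollifier_pre_nonneg: "mollifier_pre n x \<ge> 0"
  by (simp add: mollifier_pre_def bump_D_0)

lemma mollifier_pre_zero: "norm x \<ge> mollifier_scale n \<Longrightarrow> mollifier_pre n x = 0"
  unfolding mollifier_pre_def using mollifier_scale_pos[of n]
  by (intro bump_D_nonpos) (simp add: power_mono)

lemma mollifier_pre_test: "test_function (mollifier_pre n)"
proof (rule test_functionI[of _ "mollifier_scale n"])
  have "smooth (\<lambda>x::plane. bump_D 0 ((mollifier_scale n)\<^sup>2 - (norm x)\<^sup>2))"
    by (intro smooth_bump_compose smooth_diff_fun smooth_const smooth_norm_sq)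
  then show "smooth (mollifier_pre n)" unfolding mollifier_pre_def[abs_def] .
qed (simp add: mollifier_pre_zero)

lemma mollifier_pre_integral_pos: "(\<integral>y. mollifier_pre n y \<partial>lborel) > 0"
proof (rule ccontr)
  assume "\<not> ?thesis"
  then have "(\<integral>y. mollifier_pre n y \<partial>lborel) = 0"
    using Bochner_Integration.integral_nonneg[of lborel "mollifier_pre n"] mollifier_pre_nonneg by (simp add: antisym not_less)
  then have "AE x in lborel. mollifier_pre n x = 0"
    using integral_nonneg_eq_0_iff_AE[OF test_function_integrable[OF mollifier_pre_test]] mollifier_pre_nonneg by simp
  then have "AE x in lborel. x \<notin> ball (0::plane) (mollifier_scale n)"
  proof (rule eventually_mono)
    fix x :: plane assume "mollifier_pre n x = 0"
    moreover have "mollifier_pre n x > 0" if "x \<in> ball 0 (mollifier_scale n)"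
      using that by (simp add: mollifier_pre_def bump_D_0 power_strict_mono)
    ultimately show "x \<notin> ball 0 (mollifier_scale n)" by fastforce
  qed
  then have "ball (0::plane) (mollifier_scale n) \<in> null_sets lborel"
    by (subst (asm) AE_iff_null_sets[symmetric]) auto
  then have "negligible (ball (0::plane) (mollifier_scale n))"
    using null_sets_completionI negligible_iff_null_sets by blast
  then show False using open_not_negligible[of "ball (0::plane) (mollifier_scale n)"] mollifier_scale_pos[of n] by simp
qed

lemma mollifier_test: "test_function (mollifier n)"
  unfolding mollifier_def[abs_def] by (intro test_function_mult_right mollifier_pre_test smooth_const)

lemma mollifier_nonneg: "mollifier n x \<ge> 0"
  using mollifier_pre_integral_pos[of n] mollifier_pre_nonneg[of n x] by (simp add: mollifier_def)

lemma mollifier_zero: "norm x \<ge> mollifier_scale n \<Longrightarrow> mollifier n x = 0"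
  by (simp add: mollifier_def mollifier_pre_zero)

lemma mollifier_measurable [measurable]: "mollifier n \<in> borel_measurable borel"
  by (intro smooth_measurable test_function_smooth mollifier_test)

lemma mollifier_integrable: "integrable lborel (mollifier n)"
  by (rule test_function_integrable[OF mollifier_test])

lemma mollifier_integral: "(\<integral>x. mollifier n x \<partial>lborel) = 1"
  using mollifier_pre_integral_pos[of n] test_function_integrable[OF mollifier_pre_test[of n]] by (simp add: mollifier_def)

lemma mollifier_nn_integral: "(\<integral>\<^sup>+x. mollifier n x \<partial>lborel) = 1"
  using mollifier_integral[of n] mollifier_integrable[of n] by (simp add: nn_integral_eq_integral mollifier_nonneg)

lemma conv_reflect:
  assumes [measurable]: "f \<in> borel_measurable borel" "\<eta> \<in> borel_measurable borel"
  shows "conv f \<eta> x = (\<integral>y. \<eta> y * f (x - y) \<partial>lborel)"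
  unfolding conv_def by (subst integral_reflect[of _ x, symmetric]) (auto simp: mult.commute)

lemma conv_mollifier_diff:
  assumes f: "loc_int f"
  shows "conv f (mollifier n) x - f x = (\<integral>y. mollifier n y * (f (x - y) - f x) \<partial>lborel)"
    "integrable lborel (\<lambda>y. mollifier n y * (f (x - y) - f x))"
proof -
  have [measurable]: "f \<in> borel_measurable borel" using f by (rule loc_int_measurable)
  have "integrable lborel (\<lambda>y. f y * mollifier n (x - y))" by (rule integrable_conv[OF f mollifier_test])
  then have "integrable (distr lborel borel (\<lambda>y. x - y)) (\<lambda>y. f y * mollifier n (x - y))"
    using lborel_affine[of "-1" x] by (simp add: density_1 one_ennreal_def[symmetric])
  then have i: "integrable lborel (\<lambda>y. mollifier n y * f (x - y))"
    by (subst (asm) integrable_distr_eq) (auto simp: mult.commute)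
  then show "integrable lborel (\<lambda>y. mollifier n y * (f (x - y) - f x))"
    using mollifier_integrable[of n] by (simp add: right_diff_distrib)
  show "conv f (mollifier n) x - f x = (\<integral>y. mollifier n y * (f (x - y) - f x) \<partial>lborel)"
    using i mollifier_integrable[of n] by (simp add: conv_reflect right_diff_distrib mollifier_integral)
qed

lemma mollifier_Jensen_abs:
  assumes "integrable lborel (\<lambda>y. mollifier n y * g y)"
  shows "ennreal \<bar>\<integral>y. mollifier n y * g y \<partial>lborel\<bar> \<le> (\<integral>\<^sup>+y. mollifier n y * ennreal \<bar>g y\<bar> \<partial>lborel)"
proof -
  have "ennreal \<bar>\<integral>y. mollifier n y * g y \<partial>lborel\<bar> \<le> ennreal (\<integral>y. \<bar>mollifier n y * g y\<bar> \<partial>lborel)"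
    by (intro ennreal_leI integral_abs_bound)
  also have "\<dots> = (\<integral>\<^sup>+y. \<bar>mollifier n y * g y\<bar> \<partial>lborel)"
    using assms by (subst nn_integral_eq_integral) auto
  finally show ?thesis by (simp add: abs_mult mollifier_nonneg ennreal_mult'')
qed

text \<open>Jensen's inequality for the probability density \<open>mollifier n\<close>: the variance
  of \<open>g\<close> about its mean \<open>m\<close> is nonnegative. An infinite right-hand side is
  the trivial case.\<close>

lemma mollifier_Jensen_sq:
  assumes i: "integrable lborel (\<lambda>y. mollifier n y * g y)" and [measurable]: "g \<in> borel_measurable borel"
  shows "ennreal ((\<integral>y. mollifier n y * g y \<partial>lborel)\<^sup>2) \<le> (\<integral>\<^sup>+y. mollifier n y * ennreal ((g y)\<^sup>2) \<partial>lborel)"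
proof (cases "(\<integral>\<^sup>+y. mollifier n y * ennreal ((g y)\<^sup>2) \<partial>lborel) = \<infinity>")
  case False
  have i2: "integrable lborel (\<lambda>y. mollifier n y * (g y)\<^sup>2)"
    using False by (intro integrableI_nonneg) (auto simp: mollifier_nonneg ennreal_mult'' less_top)
  define m where "m = (\<integral>y. mollifier n y * g y \<partial>lborel)"
  have "0 \<le> (\<integral>y. mollifier n y * (g y - m)\<^sup>2 \<partial>lborel)" by (simp add: mollifier_nonneg)
  also have "(\<lambda>y. mollifier n y * (g y - m)\<^sup>2) = (\<lambda>y. mollifier n y * (g y)\<^sup>2 - 2 * m * (mollifier n y * g y) + m\<^sup>2 * mollifier n y)"
    by (rule ext) (simp add: power2_eq_square algebra_simps)
  also have "(\<integral>y. mollifier n y * (g y)\<^sup>2 - 2 * m * (mollifier n y * g y) + m\<^sup>2 * mollifier n y \<partial>lborel)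
    = (\<integral>y. mollifier n y * (g y)\<^sup>2 \<partial>lborel) - 2 * m * m + m\<^sup>2"
    using i i2 mollifier_integrable[of n] by (simp add: m_def mollifier_integral)
  finally have "m\<^sup>2 \<le> (\<integral>y. mollifier n y * (g y)\<^sup>2 \<partial>lborel)" by (simp add: power2_eq_square)
  then have "ennreal (m\<^sup>2) \<le> (\<integral>\<^sup>+y. mollifier n y * (g y)\<^sup>2 \<partial>lborel)"
    by (subst nn_integral_eq_integral[OF i2]) (auto simp: mollifier_nonneg intro!: ennreal_leI)
  then show ?thesis by (simp add: m_def mollifier_nonneg ennreal_mult'')
qed simp

text \<open>Fubini turns the double integral into an average over \<open>y\<close> with total mass
  1, and the mollifier sees only shifts below its scale. So an estimate uniform over small shifts
  passes to the mollification.\<close>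

lemma mollifier_average_le:
  fixes k :: "plane \<Rightarrow> plane \<Rightarrow> real"
  assumes [measurable]: "case_prod k \<in> borel_measurable (lborel \<Otimes>\<^sub>M lborel)"
    and le: "\<And>y. norm y < mollifier_scale n \<Longrightarrow> (\<integral>\<^sup>+x. ennreal (k x y) \<partial>lborel) \<le> e"
  shows "(\<integral>\<^sup>+x. \<integral>\<^sup>+y. mollifier n y * ennreal (k x y) \<partial>lborel \<partial>lborel) \<le> e"
proof -
  have "(\<integral>\<^sup>+x. \<integral>\<^sup>+y. mollifier n y * ennreal (k x y) \<partial>lborel \<partial>lborel) = (\<integral>\<^sup>+y. \<integral>\<^sup>+x. mollifier n y * ennreal (k x y) \<partial>lborel \<partial>lborel)"
    by (rule lborel_pair.Fubini'[symmetric]) measurable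
  also have "\<dots> = (\<integral>\<^sup>+y. mollifier n y * (\<integral>\<^sup>+x. ennreal (k x y) \<partial>lborel) \<partial>lborel)"
    by (intro nn_integral_cong nn_integral_cmult) measurable
  also have "\<dots> \<le> (\<integral>\<^sup>+y. mollifier n y * e \<partial>lborel)"
  proof (intro nn_integral_mono)
    fix y
    show "mollifier n y * (\<integral>\<^sup>+x. ennreal (k x y) \<partial>lborel) \<le> mollifier n y * e"
      using le[of y] mollifier_zero[of n y] by (cases "norm y < mollifier_scale n") (auto intro: mult_left_mono)
  qed
  also have "\<dots> = e" by (simp add: nn_integral_multc mollifier_nn_integral)
  finally show ?thesis .
qed

subsection \<open>Continuity of translations\<close>

text \<open>In an open set a point eventually stays inside under small shifts, so the set of lost
  points \<open>F n\<close> shrinks to nothing pointwise. Gained points need not disappear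
  pointwise, at the boundary for instance, but they have the same measure as the lost ones because
  translation preserves measure.\<close>

lemma translation_L1_indicator_open:
  fixes U :: "plane set" and h :: "nat \<Rightarrow> plane"
  assumes U: "open U" "emeasure lborel U < \<infinity>" and h: "h \<longlonglongrightarrow> 0"
  shows "(\<lambda>n. \<integral>x. \<bar>indicator U (x + h n) - indicator U x\<bar> \<partial>lborel) \<longlonglongrightarrow> (0::real)"
proof -
  have [measurable]: "U \<in> sets borel" using U by simp
  define F where "F n x = max 0 (indicator U x - indicator U (x + h n) :: real)" for n x
  have iU: "integrable lborel (indicator U :: plane \<Rightarrow> real)" using U by auto
  then have iU': "integrable lborel (\<lambda>x. indicator U (x + h n) :: real)" for n by (rule integrable_translate)
  have "(\<lambda>n. \<integral>x. F n x \<partial>lborel) \<longlonglongrightarrow> (\<integral>x. 0 \<partial>LB)"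
  proof (rule integral_dominated_convergence[where w="indicator U"])
    show "AE x in lborel. (\<lambda>n. F n x) \<longlonglongrightarrow> 0"
    proof (rule AE_I2)
      fix x
      show "(\<lambda>n. F n x) \<longlonglongrightarrow> 0"
      proof (cases "x \<in> U")
        case True
        have "(\<lambda>n. x + h n) \<longlonglongrightarrow> x + 0" by (intro tendsto_add tendsto_const h)
        then have "\<forall>\<^sub>F n in sequentially. x + h n \<in> U" using topological_tendstoD[OF _ U(1)] True by force
        then have "\<forall>\<^sub>F n in sequentially. F n x = 0" by eventually_elim (simp add: F_def True)
        then show ?thesis by (rule tendsto_eventually)
      qed (simp add: F_def)
    qed
    show "AE x in lborel. norm (F n x) \<le> indicator U x" for n
      by (rule AE_I2) (simp add: F_def indicator_def)
  qed (use iU in \<open>auto simp: F_def\<close>)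
  then have "(\<lambda>n. 2 * (\<integral>x. F n x \<partial>lborel)) \<longlonglongrightarrow> 2 * 0" by (intro tendsto_mult tendsto_const) simp
  moreover have "2 * (\<integral>x. F n x \<partial>lborel) = (\<integral>x. \<bar>indicator U (x + h n) - indicator U x\<bar> \<partial>lborel)" for n
  proof -
    have eq: "F n = (\<lambda>x. (\<bar>indicator U (x + h n) - indicator U x\<bar> - (indicator U (x + h n) - indicator U x)) / 2)"
      by (rule ext) (simp add: F_def max_def)
    have "(\<integral>x. (indicator U (x + h n) - indicator U x :: real) \<partial>lborel) = 0"
      unfolding Bochner_Integration.integral_diff[OF iU' iU]
      using integral_translate[of "indicator U" "h n"] by simp
    moreover have "integrable lborel (\<lambda>x. indicator U (x + h n) - indicator U x :: real)"
      by (rule Bochner_Integration.integrable_diff[OF iU' iU])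
    ultimately show ?thesis unfolding eq by (simp only: integral_divide_zero Bochner_Integration.integral_diff integrable_abs) simp
  qed
  ultimately show ?thesis by simp
qed

text \<open>The usual three-term estimate. It is the density argument for two passages: from open to
  measurable sets, and from simple functions to their limits.\<close>

lemma translation_L1_approx:
  fixes f :: "plane \<Rightarrow> real"
  assumes f: "integrable lborel f" and h: "h \<longlonglongrightarrow> 0"
    and approx: "\<And>e. e > 0 \<Longrightarrow> \<exists>g. integrable lborel g \<and> (\<integral>x. \<bar>g x - f x\<bar> \<partial>lborel) \<le> e
      \<and> (\<lambda>n. \<integral>x. \<bar>g (x + h n) - g x\<bar> \<partial>lborel) \<longlonglongrightarrow> 0"
  shows "(\<lambda>n. \<integral>x. \<bar>f (x + h n) - f x\<bar> \<partial>lborel) \<longlonglongrightarrow> 0"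
proof (rule LIMSEQ_I)
  fix e :: real assume "e > 0"
  then obtain g where g: "integrable lborel g" "(\<integral>x. \<bar>g x - f x\<bar> \<partial>lborel) \<le> e / 4"
    "(\<lambda>n. \<integral>x. \<bar>g (x + h n) - g x\<bar> \<partial>lborel) \<longlonglongrightarrow> 0"
    using approx[of "e / 4"] by auto
  have [measurable]: "f \<in> borel_measurable borel" "g \<in> borel_measurable borel" using f g(1) by auto
  obtain N where N: "\<And>n. n \<ge> N \<Longrightarrow> \<bar>\<integral>x. \<bar>g (x + h n) - g x\<bar> \<partial>lborel\<bar> < e / 2"
    using LIMSEQ_D[OF g(3), of "e / 2"] \<open>e > 0\<close> by auto
  have "\<bar>\<integral>x. \<bar>f (x + h n) - f x\<bar> \<partial>lborel\<bar> < e" if "n \<ge> N" for n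
  proof -
    have i: "integrable lborel (\<lambda>x. f (x + h n))" "integrable lborel (\<lambda>x. g (x + h n))"
      using f g(1) by (auto intro: integrable_translate)
    have "(\<integral>x. \<bar>f (x + h n) - f x\<bar> \<partial>lborel)
      \<le> (\<integral>x. \<bar>g (x + h n) - f (x + h n)\<bar> + \<bar>g (x + h n) - g x\<bar> + \<bar>g x - f x\<bar> \<partial>lborel)"
      using i f g(1) by (intro integral_mono) auto
    also have "\<dots> = (\<integral>x. \<bar>g (x + h n) - f (x + h n)\<bar> \<partial>lborel) + (\<integral>x. \<bar>g (x + h n) - g x\<bar> \<partial>lborel) + (\<integral>x. \<bar>g x - f x\<bar> \<partial>lborel)"
      using i f g(1) by simp
    also have "(\<integral>x. \<bar>g (x + h n) - f (x + h n)\<bar> \<partial>lborel) = (\<integral>x. \<bar>g x - f x\<bar> \<partial>lborel)"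
      by (rule integral_translate) measurable
    finally have "(\<integral>x. \<bar>f (x + h n) - f x\<bar> \<partial>lborel) < e" using N[OF that] g(2) by linarith
    then show ?thesis by simp
  qed
  then show "\<exists>N. \<forall>n\<ge>N. norm ((\<integral>x. \<bar>f (x + h n) - f x\<bar> \<partial>lborel) - 0) < e" by auto
qed

lemma translation_L1:
  fixes f :: "plane \<Rightarrow> real"
  assumes "integrable lborel f" and h: "h \<longlonglongrightarrow> 0"
  shows "(\<lambda>n. \<integral>x. \<bar>f (x + h n) - f x\<bar> \<partial>lborel) \<longlonglongrightarrow> 0"
  using assms(1)
proof (induction rule: integrable_induct)
  case (base A c)
  have "(\<lambda>n. \<integral>x. \<bar>indicator A (x + h n) - indicator A x\<bar> \<partial>lborel) \<longlonglongrightarrow> (0::real)"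
  proof (rule translation_L1_approx[OF _ h])
    show "integrable lborel (indicator A :: plane \<Rightarrow> real)" using base by auto
    fix e :: real assume "e > 0"
    have [measurable]: "A \<in> sets borel" using base by simp
    \<comment> \<open>Outer regularity approximates the indicator of \<open>A\<close> in
      \<open>L^1\<close> by that of an open set of finite measure.\<close>
    obtain U where U: "open U" "A \<subseteq> U" "emeasure lborel (U - A) < e"
      using outer_regular_lborel[of A e] base \<open>e > 0\<close> by auto
    have [measurable]: "U \<in> sets borel" using U by simp
    have "emeasure lborel U = emeasure lborel A + emeasure lborel (U - A)"
      using U(2) by (subst plus_emeasure) (auto simp: Un_absorb1)
    also have "\<dots> < \<infinity>" using base(2) U(3) by (simp add: less_top[symmetric]) (metis ennreal_less_top less_trans less_top)
    finally have fin: "emeasure lborel U < \<infinity>" .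
    have "(\<lambda>x. \<bar>indicator U x - indicator A x\<bar>) = (indicator (U - A) :: plane \<Rightarrow> real)"
      using U(2) by (auto simp: fun_eq_iff indicator_def)
    then have "(\<integral>x. \<bar>indicator U x - indicator A x\<bar> \<partial>lborel) = measure lborel (U - A)" by simp
    also have "\<dots> \<le> e" using U(3) \<open>e > 0\<close>
      by (simp add: measure_def enn2real_leI less_imp_le)
    finally show "\<exists>g. integrable lborel g \<and> (\<integral>x. \<bar>g x - indicator A x\<bar> \<partial>lborel) \<le> e
      \<and> (\<lambda>n. \<integral>x. \<bar>g (x + h n) - g x\<bar> \<partial>lborel) \<longlonglongrightarrow> 0"
      using translation_L1_indicator_open[OF U(1) fin h] fin
      by (intro exI[of _ "indicator U"]) auto
  qed
  then have "(\<lambda>n. (\<integral>x. \<bar>indicator A (x + h n) - indicator A x\<bar> \<partial>lborel) * \<bar>c\<bar>) \<longlonglongrightarrow> 0 * \<bar>c\<bar>"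
    by (intro tendsto_mult tendsto_const)
  moreover have "\<bar>indicator A (x + h n) *\<^sub>R c - indicator A x *\<^sub>R c\<bar> = \<bar>indicator A (x + h n) - indicator A x\<bar> * \<bar>c\<bar>" for x n
    by (simp add: abs_mult[symmetric] left_diff_distrib)
  ultimately show ?case by simp
next
  case (add f g)
  have [measurable]: "f \<in> borel_measurable borel" "g \<in> borel_measurable borel" using add by auto
  have i: "integrable lborel (\<lambda>x. f (x + h n))" "integrable lborel (\<lambda>x. g (x + h n))" for n
    using add by (auto intro: integrable_translate)
  show ?case
  proof (rule tendsto_sandwich[OF _ _ tendsto_const])
    show "(\<lambda>n. (\<integral>x. \<bar>f (x + h n) - f x\<bar> \<partial>lborel) + (\<integral>x. \<bar>g (x + h n) - g x\<bar> \<partial>lborel)) \<longlonglongrightarrow> 0"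
      using tendsto_add[OF add(3,4)] by simp
    have "(\<integral>x. \<bar>f (x + h n) + g (x + h n) - (f x + g x)\<bar> \<partial>lborel)
      \<le> (\<integral>x. \<bar>f (x + h n) - f x\<bar> + \<bar>g (x + h n) - g x\<bar> \<partial>lborel)" for n
      using i add by (intro integral_mono) auto
    then show "\<forall>\<^sub>F n in sequentially. (\<integral>x. \<bar>f (x + h n) + g (x + h n) - (f x + g x)\<bar> \<partial>lborel)
      \<le> (\<integral>x. \<bar>f (x + h n) - f x\<bar> \<partial>lborel) + (\<integral>x. \<bar>g (x + h n) - g x\<bar> \<partial>lborel)"
      using i add by simp
  qed simp
next
  case (lim f s)
  show ?case
  proof (rule translation_L1_approx[OF lim(4) h])
    fix e :: real assume "e > 0"
    have [measurable]: "f \<in> borel_measurable borel" "s i \<in> borel_measurable borel" for i using lim(1,4) by auto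
    have "(\<lambda>i. \<integral>x. \<bar>s i x - f x\<bar> \<partial>lborel) \<longlonglongrightarrow> (\<integral>x. 0 \<partial>LB)"
    proof (rule integral_dominated_convergence[where w="\<lambda>x. 3 * \<bar>f x\<bar>"])
      have "(\<lambda>i. \<bar>s i x - f x\<bar>) \<longlonglongrightarrow> \<bar>f x - f x\<bar>" for x using lim(2)[of x] by (intro tendsto_intros) simp
      then show "AE x in lborel. (\<lambda>i. \<bar>s i x - f x\<bar>) \<longlonglongrightarrow> 0" by simp
      have "\<bar>s i x - f x\<bar> \<le> 3 * \<bar>f x\<bar>" for i x using lim(3)[of x i] by simp
      then show "AE x in lborel. norm \<bar>s i x - f x\<bar> \<le> 3 * \<bar>f x\<bar>" for i by simp
    qed (use lim(4) in auto)
    then obtain i where "\<bar>(\<integral>x. \<bar>s i x - f x\<bar> \<partial>lborel)\<bar> < e"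
      using LIMSEQ_D[of _ 0 e] \<open>e > 0\<close> by fastforce
    then show "\<exists>g. integrable lborel g \<and> (\<integral>x. \<bar>g x - f x\<bar> \<partial>lborel) \<le> e
      \<and> (\<lambda>n. \<integral>x. \<bar>g (x + h n) - g x\<bar> \<partial>lborel) \<longlonglongrightarrow> 0"
      using lim(1,5) by (intro exI[of _ "s i"]) auto
  qed
qed

lemma translation_L1_eps:
  fixes f :: "plane \<Rightarrow> real"
  assumes "integrable lborel f" "e > 0"
  obtains d where "d > 0" "\<And>h. norm h < d \<Longrightarrow> (\<integral>x. \<bar>f (x + h) - f x\<bar> \<partial>lborel) \<le> e"
proof -
  have "\<exists>d>0. \<forall>h. norm h < d \<longrightarrow> (\<integral>x. \<bar>f (x + h) - f x\<bar> \<partial>lborel) \<le> e"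
  proof (rule ccontr)
    assume "\<not> ?thesis"
    then have "\<And>d. d > 0 \<Longrightarrow> \<exists>h. norm h < d \<and> (\<integral>x. \<bar>f (x + h) - f x\<bar> \<partial>lborel) > e"
      by (auto simp: not_le)
    then have "\<forall>n. \<exists>h. norm h < inverse (real (Suc n)) \<and> (\<integral>x. \<bar>f (x + h) - f x\<bar> \<partial>lborel) > e"
      by simp
    from choice[OF this] obtain h where
      h: "\<And>n. norm (h n) < inverse (real (Suc n))" "\<And>n. (\<integral>x. \<bar>f (x + h n) - f x\<bar> \<partial>lborel) > e" by blast
    have "h \<longlonglongrightarrow> 0"
      by (rule Lim_null_comparison[OF _ LIMSEQ_inverse_real_of_nat]) (intro always_eventually allI less_imp_le h)
    from LIMSEQ_D[OF translation_L1[OF assms(1) this] assms(2)]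
    obtain n where "\<bar>\<integral>x. \<bar>f (x + h n) - f x\<bar> \<partial>lborel\<bar> < e" by auto
    with h(2)[of n] show False by linarith
  qed
  then show thesis using that by blast
qed

text \<open>Passing from \<open>f\<close> to \<open>f * \<bar>f\<bar>\<close> reduces the \<open>L^2\<close> continuity of translations to the \<open>L^1\<close> case.\<close>

lemma diff_sq_le: "((a::real) - b)\<^sup>2 \<le> 2 * \<bar>a * \<bar>a\<bar> - b * \<bar>b\<bar>\<bar>"
proof (cases "(a \<ge> 0) = (b \<ge> 0)")
  case True
  have "\<bar>a - b\<bar> * \<bar>a - b\<bar> \<le> \<bar>a - b\<bar> * \<bar>a + b\<bar>" using True by (intro mult_left_mono) auto
  also have "\<dots> = \<bar>a * \<bar>a\<bar> - b * \<bar>b\<bar>\<bar>"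
    using True unfolding abs_mult[symmetric] by (cases "a \<ge> 0") (auto simp: algebra_simps)
  finally have "(a - b)\<^sup>2 \<le> \<bar>a * \<bar>a\<bar> - b * \<bar>b\<bar>\<bar>" by (simp add: power2_eq_square abs_mult[symmetric])
  then show ?thesis by (rule order_trans) simp
next
  case False
  have "(a - b)\<^sup>2 \<le> 2 * (a\<^sup>2 + b\<^sup>2)" using zero_le_power2[of "a + b"] by (simp add: power2_eq_square algebra_simps)
  also have "a\<^sup>2 + b\<^sup>2 = \<bar>a * \<bar>a\<bar> - b * \<bar>b\<bar>\<bar>"
  proof (cases "a \<ge> 0")
    case True
    then have "a * \<bar>a\<bar> - b * \<bar>b\<bar> = a\<^sup>2 + b\<^sup>2" using False by (simp add: power2_eq_square)
    then show ?thesis by (metis abs_of_nonneg sum_power2_ge_zero)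
  next
    case neg: False
    then have "- (a * \<bar>a\<bar> - b * \<bar>b\<bar>) = a\<^sup>2 + b\<^sup>2" using False by (simp add: power2_eq_square)
    then show ?thesis by (metis abs_of_nonneg abs_minus_cancel sum_power2_ge_zero)
  qed
  finally show ?thesis .
qed

lemma translation_L2_eps:
  fixes f :: "plane \<Rightarrow> real"
  assumes f: "sq_int f" "e > 0"
  obtains d where "d > 0" "\<And>h. norm h < d \<Longrightarrow> (\<integral>\<^sup>+x. ennreal ((f (x + h) - f x)\<^sup>2) \<partial>lborel) \<le> ennreal e"
proof -
  have [measurable]: "f \<in> borel_measurable borel" using f by (simp add: sq_int_def)
  define g where "g x = f x * \<bar>f x\<bar>" for x
  have [measurable]: "g \<in> borel_measurable borel" unfolding g_def by measurable
  have g: "integrable lborel g"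
    by (rule Bochner_Integration.integrable_bound[of lborel "\<lambda>x. (f x)\<^sup>2"])
      (use f in \<open>auto simp: g_def sq_int_def abs_mult power2_eq_square\<close>)
  obtain d where d: "d > 0" "\<And>h. norm h < d \<Longrightarrow> (\<integral>x. \<bar>g (x + h) - g x\<bar> \<partial>lborel) \<le> e / 2"
    using translation_L1_eps[OF g, of "e / 2"] f(2) by auto
  show thesis
  proof (rule that[OF d(1)])
    fix h :: plane assume h: "norm h < d"
    have i: "integrable lborel (\<lambda>x. \<bar>g (x + h) - g x\<bar>)" using integrable_translate[OF g] g by auto
    have "(\<integral>\<^sup>+x. ennreal ((f (x + h) - f x)\<^sup>2) \<partial>lborel) \<le> (\<integral>\<^sup>+x. ennreal (2 * \<bar>g (x + h) - g x\<bar>) \<partial>lborel)"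
      unfolding g_def by (intro nn_integral_mono ennreal_leI diff_sq_le)
    also have "\<dots> = ennreal (\<integral>x. 2 * \<bar>g (x + h) - g x\<bar> \<partial>lborel)"
      using i by (intro nn_integral_eq_integral) auto
    also have "\<dots> \<le> ennreal e" using d(2)[OF h] by (intro ennreal_leI) simp
    finally show "(\<integral>\<^sup>+x. ennreal ((f (x + h) - f x)\<^sup>2) \<partial>lborel) \<le> ennreal e" .
  qed
qed

lemma conv_mollifier_L2:
  assumes f: "sq_int f"
  shows "sq_int (conv f (mollifier n))" "(\<lambda>n. \<integral>x. (conv f (mollifier n) x - f x)\<^sup>2 \<partial>lborel) \<longlonglongrightarrow> 0"
proof -
  have l: "loc_int f" using f by (rule sq_int_loc_int)
  have [measurable]: "f \<in> borel_measurable borel" using f by (simp add: sq_int_def)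
  have cm [measurable]: "conv f (mollifier n) \<in> borel_measurable borel" for n
    by (rule smooth_measurable[OF smooth_conv[OF l mollifier_test]])
  \<comment> \<open>Jensen and Fubini bound the distance between \<open>f\<close> and its
    mollification by the largest translation error below the scale. The bound is used twice: with a
    fixed \<open>c\<close> to get square integrability, with small \<open>c\<close> to get
    convergence.\<close>
  have key: "(\<integral>\<^sup>+x. ennreal ((conv f (mollifier n) x - f x)\<^sup>2) \<partial>lborel) \<le> c"
    if c: "\<And>y. norm y < mollifier_scale n \<Longrightarrow> (\<integral>\<^sup>+x. ennreal ((f (x - y) - f x)\<^sup>2) \<partial>lborel) \<le> c" for n c
  proof -
    have "(\<integral>\<^sup>+x. ennreal ((conv f (mollifier n) x - f x)\<^sup>2) \<partial>lborel)
      \<le> (\<integral>\<^sup>+x. \<integral>\<^sup>+y. mollifier n y * ennreal ((f (x - y) - f x)\<^sup>2) \<partial>lborel \<partial>lborel)"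
      unfolding conv_mollifier_diff(1)[OF l]
      by (intro nn_integral_mono mollifier_Jensen_sq conv_mollifier_diff(2)[OF l]) measurable
    also have "\<dots> \<le> c" by (rule mollifier_average_le) (use c in auto)
    finally show ?thesis .
  qed
  have i2: "integrable lborel (\<lambda>x. (f x)\<^sup>2)" using f by (simp add: sq_int_def)
  \<comment> \<open>The crude bound by four times the squared norm holds for all shifts, from
    \<open>(a - b)^2 \<le> 2 a^2 + 2 b^2\<close>.\<close>
  have fin: "(\<integral>\<^sup>+x. ennreal ((conv f (mollifier n) x - f x)\<^sup>2) \<partial>lborel) \<le> ennreal (4 * (\<integral>x. (f x)\<^sup>2 \<partial>lborel))" for n
  proof (rule key)
    fix y :: plane
    have i3: "integrable lborel (\<lambda>x. (f (x - y))\<^sup>2)" using integrable_translate[OF i2, of "-y"] by simp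
    have "(f (x - y) - f x)\<^sup>2 \<le> 2 * (f (x - y))\<^sup>2 + 2 * (f x)\<^sup>2" for x
      using zero_le_power2[of "f (x - y) + f x"] by (simp add: power2_eq_square algebra_simps)
    then have "(\<integral>\<^sup>+x. ennreal ((f (x - y) - f x)\<^sup>2) \<partial>lborel) \<le> (\<integral>\<^sup>+x. ennreal (2 * (f (x - y))\<^sup>2 + 2 * (f x)\<^sup>2) \<partial>lborel)"
      by (intro nn_integral_mono ennreal_leI)
    also have "\<dots> = ennreal (\<integral>x. 2 * (f (x - y))\<^sup>2 + 2 * (f x)\<^sup>2 \<partial>lborel)"
      using i2 i3 by (intro nn_integral_eq_integral) auto
    also have "(\<integral>x. 2 * (f (x - y))\<^sup>2 + 2 * (f x)\<^sup>2 \<partial>lborel) = 4 * (\<integral>x. (f x)\<^sup>2 \<partial>lborel)"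
      using i2 i3 integral_translate[of "\<lambda>x. (f x)\<^sup>2" "-y"] by simp
    finally show "(\<integral>\<^sup>+x. ennreal ((f (x - y) - f x)\<^sup>2) \<partial>lborel) \<le> ennreal (4 * (\<integral>x. (f x)\<^sup>2 \<partial>lborel))" .
  qed
  have d: "sq_int (\<lambda>x. conv f (mollifier n) x - f x)" for n
  proof -
    have "(\<integral>\<^sup>+x. ennreal ((conv f (mollifier n) x - f x)\<^sup>2) \<partial>lborel) < \<infinity>"
      using fin[of n] by (rule order_le_less_trans) simp
    then have "integrable lborel (\<lambda>x. (conv f (mollifier n) x - f x)\<^sup>2)" by (intro integrableI_nonneg) auto
    then show ?thesis by (simp add: sq_int_def)
  qed
  show "sq_int (conv f (mollifier n))" using sq_int_add[OF d f, of n] by simp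
  show "(\<lambda>n. \<integral>x. (conv f (mollifier n) x - f x)\<^sup>2 \<partial>lborel) \<longlonglongrightarrow> 0"
  proof (rule LIMSEQ_I)
    fix e :: real assume "e > 0"
    obtain r where r: "r > 0" "\<And>h. norm h < r \<Longrightarrow> (\<integral>\<^sup>+x. ennreal ((f (x + h) - f x)\<^sup>2) \<partial>lborel) \<le> ennreal (e / 2)"
      using translation_L2_eps[OF f, of "e / 2"] \<open>e > 0\<close> by auto
    obtain N where N: "\<And>n. n \<ge> N \<Longrightarrow> mollifier_scale n < r"
      using LIMSEQ_D[OF mollifier_scale_tendsto r(1)] mollifier_scale_pos by fastforce
    have "norm ((\<integral>x. (conv f (mollifier n) x - f x)\<^sup>2 \<partial>lborel) - 0) < e" if "n \<ge> N" for n
    proof -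
      have "(\<integral>\<^sup>+x. ennreal ((conv f (mollifier n) x - f x)\<^sup>2) \<partial>lborel) \<le> ennreal (e / 2)"
      proof (rule key)
        fix y :: plane assume "norm y < mollifier_scale n"
        then show "(\<integral>\<^sup>+x. ennreal ((f (x - y) - f x)\<^sup>2) \<partial>lborel) \<le> ennreal (e / 2)"
          using r(2)[of "-y"] N[OF that] by simp
      qed
      then have "(\<integral>x. (conv f (mollifier n) x - f x)\<^sup>2 \<partial>lborel) \<le> e / 2"
        using d[of n] \<open>e > 0\<close> by (subst (asm) nn_integral_eq_integral) (auto simp: sq_int_def)
      then show ?thesis using \<open>e > 0\<close> by simp
    qed
    then show "\<exists>N. \<forall>n\<ge>N. norm ((\<integral>x. (conv f (mollifier n) x - f x)\<^sup>2 \<partial>lborel) - 0) < e" by blast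
  qed
qed

lemma conv_mollifier_L1_loc:
  assumes f: "loc_int f"
  shows "(\<lambda>n. \<integral>x. \<bar>indicator (cball 0 R) x * (conv f (mollifier n) x - f x)\<bar> \<partial>lborel) \<longlonglongrightarrow> 0"
proof -
  have [measurable]: "f \<in> borel_measurable borel" using f by (rule loc_int_measurable)
  \<comment> \<open>The scale is at most 1, so on the ball of radius \<open>R\<close> the
    mollifications of \<open>f\<close> and of its truncation \<open>g\<close> coincide, and
    \<open>g\<close> is globally integrable.\<close>
  define g where "g x = indicator (cball 0 (R + 1)) x * f x" for x
  have [measurable]: "g \<in> borel_measurable borel" unfolding g_def by measurable
  have gi: "integrable lborel g" using f unfolding g_def loc_int_def by blast
  have gl: "loc_int g"
    using gi by (auto simp: loc_int_def intro!: integrable_mult_indicator[where 'b=real, simplified])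
  have cg [measurable]: "conv g (mollifier n) \<in> borel_measurable borel" for n
    by (rule smooth_measurable[OF smooth_conv[OF gl mollifier_test]])
  have cf [measurable]: "conv f (mollifier n) \<in> borel_measurable borel" for n
    by (rule smooth_measurable[OF smooth_conv[OF f mollifier_test]])
  have eq: "conv f (mollifier n) x - f x = conv g (mollifier n) x - g x" if "norm x \<le> R" for n x
  proof -
    have "f y * mollifier n (x - y) = g y * mollifier n (x - y)" for y
    proof (cases "norm y \<le> R + 1")
      case False
      then have "norm (x - y) \<ge> mollifier_scale n"
        using norm_triangle_ineq2[of y x] that mollifier_scale_le_1[of n] by (simp add: norm_minus_commute)
      then show ?thesis by (simp add: mollifier_zero)
    qed (simp add: g_def)
    then have "conv f (mollifier n) x = conv g (mollifier n) x" by (simp only: conv_def)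
    then show ?thesis using that by (simp add: g_def)
  qed
  show ?thesis
  proof (rule LIMSEQ_I)
    fix e :: real assume "e > 0"
    obtain r where r: "r > 0" "\<And>h. norm h < r \<Longrightarrow> (\<integral>x. \<bar>g (x + h) - g x\<bar> \<partial>lborel) \<le> e / 2"
      using translation_L1_eps[OF gi, of "e / 2"] \<open>e > 0\<close> by auto
    obtain N where N: "\<And>n. n \<ge> N \<Longrightarrow> mollifier_scale n < r"
      using LIMSEQ_D[OF mollifier_scale_tendsto r(1)] mollifier_scale_pos by fastforce
    have "norm ((\<integral>x. \<bar>indicator (cball 0 R) x * (conv f (mollifier n) x - f x)\<bar> \<partial>lborel) - 0) < e" if "n \<ge> N" for n
    proof -
      have "(\<integral>\<^sup>+x. ennreal \<bar>indicator (cball 0 R) x * (conv f (mollifier n) x - f x)\<bar> \<partial>lborel)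
        \<le> (\<integral>\<^sup>+x. ennreal \<bar>conv g (mollifier n) x - g x\<bar> \<partial>lborel)"
        by (intro nn_integral_mono ennreal_leI) (auto simp: indicator_def eq)
      also have "\<dots> \<le> (\<integral>\<^sup>+x. \<integral>\<^sup>+y. mollifier n y * ennreal \<bar>g (x - y) - g x\<bar> \<partial>lborel \<partial>lborel)"
        unfolding conv_mollifier_diff(1)[OF gl]
        by (intro nn_integral_mono mollifier_Jensen_abs conv_mollifier_diff(2)[OF gl])
      also have "\<dots> \<le> ennreal (e / 2)"
      proof (rule mollifier_average_le)
        fix y :: plane assume y: "norm y < mollifier_scale n"
        have "integrable lborel (\<lambda>x. g (x - y))" using integrable_translate[OF gi, of "-y"] by simp
        then have "(\<integral>\<^sup>+x. ennreal \<bar>g (x - y) - g x\<bar> \<partial>lborel) = ennreal (\<integral>x. \<bar>g (x - y) - g x\<bar> \<partial>lborel)"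
          using gi by (intro nn_integral_eq_integral) auto
        also have "\<dots> \<le> ennreal (e / 2)" using r(2)[of "-y"] y N[OF that] by (intro ennreal_leI) simp
        finally show "(\<integral>\<^sup>+x. ennreal \<bar>g (x - y) - g x\<bar> \<partial>lborel) \<le> ennreal (e / 2)" .
      qed measurable
      finally have le: "(\<integral>\<^sup>+x. ennreal \<bar>indicator (cball 0 R) x * (conv f (mollifier n) x - f x)\<bar> \<partial>lborel) \<le> ennreal (e / 2)" .
      have "(\<integral>x. \<bar>indicator (cball 0 R) x * (conv f (mollifier n) x - f x)\<bar> \<partial>lborel)
        = enn2real (\<integral>\<^sup>+x. ennreal \<bar>indicator (cball 0 R) x * (conv f (mollifier n) x - f x)\<bar> \<partial>lborel)"
        by (rule integral_eq_nn_integral) auto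
      also have "\<dots> \<le> e / 2" by (rule enn2real_leI[OF _ le]) (use \<open>e > 0\<close> in simp)
      finally have "(\<integral>x. \<bar>indicator (cball 0 R) x * (conv f (mollifier n) x - f x)\<bar> \<partial>lborel) \<le> e / 2" .
      then show ?thesis using \<open>e > 0\<close> by simp
    qed
    then show "\<exists>N. \<forall>n\<ge>N. norm ((\<integral>x. \<bar>indicator (cball 0 R) x * (conv f (mollifier n) x - f x)\<bar> \<partial>lborel) - 0) < e" by blast
  qed
qed

subsection \<open>Logarithmic weights and cutoffs\<close>

text \<open>
  \<open>log_weight x\<close> is comparable to \<open>1 / (<x> <log <x>>)\<close>. The factor \<open>exp 1\<close> gives \<open>cutoff N 0 = 1\<close>; the cutoff
  is not constant near the origin, but it tends to 1 pointwise as \<open>N\<close> grows.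
\<close>

definition bracket_sq :: "plane \<Rightarrow> real" where "bracket_sq x = 1 + (norm x)\<^sup>2"
definition log_bracket :: "plane \<Rightarrow> real" where "log_bracket x = 1 + ln (bracket_sq x)"
definition loglog :: "plane \<Rightarrow> real" where "loglog x = ln (log_bracket x)"
definition log_weight :: "plane \<Rightarrow> real" where "log_weight x = 1 / (sqrt (bracket_sq x) * log_bracket x)"
definition cutoff :: "real \<Rightarrow> plane \<Rightarrow> real" where "cutoff N x = exp 1 * bump_D 0 (1 - loglog x / N)"

lemma bracket_sq_ge_1: "bracket_sq x \<ge> 1" by (simp add: bracket_sq_def)
lemma bracket_sq_pos: "bracket_sq x > 0" using bracket_sq_ge_1[of x] by linarith
lemma log_bracket_ge_1: "log_bracket x \<ge> 1" using bracket_sq_ge_1[of x] by (simp add: log_bracket_def)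
lemma log_bracket_pos: "log_bracket x > 0" using log_bracket_ge_1[of x] by linarith
lemma loglog_nonneg: "loglog x \<ge> 0" using log_bracket_ge_1[of x] by (simp add: loglog_def)
lemma log_weight_pos: "log_weight x > 0" using bracket_sq_pos[of x] log_bracket_pos[of x] by (simp add: log_weight_def)
lemma log_weight_le_1: "log_weight x \<le> 1"
  using mult_mono[of 1 "sqrt (bracket_sq x)" 1 "log_bracket x"] bracket_sq_ge_1[of x] log_bracket_ge_1[of x] by (simp add: log_weight_def)
lemma log_weight_sq: "(log_weight x)\<^sup>2 = 1 / (bracket_sq x * (log_bracket x)\<^sup>2)"
  using bracket_sq_pos[of x] by (simp add: log_weight_def power_divide power_mult_distrib)
lemma log_weight_le_inverse_sqrt: "log_weight x \<le> 1 / sqrt (bracket_sq x)"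
proof -
  have "sqrt (bracket_sq x) * 1 \<le> sqrt (bracket_sq x) * log_bracket x" using log_bracket_ge_1[of x] bracket_sq_pos[of x] by (intro mult_left_mono) auto
  then show ?thesis unfolding log_weight_def using bracket_sq_pos[of x] by (intro divide_left_mono) (auto simp: log_bracket_pos)
qed

lemma smooth_bracket_sq: "smooth bracket_sq"
  unfolding bracket_sq_def[abs_def] by (intro smooth_add smooth_const smooth_norm_sq)
lemma smooth_log_bracket: "smooth log_bracket"
  unfolding log_bracket_def[abs_def] by (intro smooth_add smooth_const smooth_ln smooth_bracket_sq bracket_sq_pos)
lemma smooth_loglog: "smooth loglog"
  unfolding loglog_def[abs_def] by (intro smooth_ln smooth_log_bracket log_bracket_pos)
lemma cutoff_arg_eq: "(\<lambda>x. 1 - loglog x / N) = (\<lambda>x. 1 - 1 / N * loglog x)"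
  by simp

lemma smooth_cutoff_arg: "smooth (\<lambda>x. 1 - loglog x / N)"
  unfolding cutoff_arg_eq by (intro smooth_diff_fun smooth_const smooth_cmult smooth_loglog)

lemma smooth_cutoff: "smooth (cutoff N)"
  unfolding cutoff_def[abs_def] by (intro smooth_cmult smooth_bump_compose smooth_cutoff_arg)

lemma weight_measurable [measurable]:
  "bracket_sq \<in> borel_measurable borel" "log_bracket \<in> borel_measurable borel" "loglog \<in> borel_measurable borel" "log_weight \<in> borel_measurable borel" "cutoff N \<in> borel_measurable borel"
proof -
  show [measurable]: "bracket_sq \<in> borel_measurable borel" "log_bracket \<in> borel_measurable borel" "loglog \<in> borel_measurable borel" "cutoff N \<in> borel_measurable borel"
    by (intro smooth_measurable smooth_bracket_sq smooth_log_bracket smooth_loglog smooth_cutoff)+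
  show "log_weight \<in> borel_measurable borel" unfolding log_weight_def[abs_def] by measurable
qed

lemma partial_deriv_bracket_sq: "partial_deriv j bracket_sq = (\<lambda>x. 2 * x $ j)"
  unfolding bracket_sq_def[abs_def] using partial_deriv_add[OF smooth_const smooth_norm_sq, of j 1]
  by (simp add: partial_deriv_norm_sq)

lemma partial_deriv_log_bracket: "partial_deriv j log_bracket = (\<lambda>x. 2 * x $ j / bracket_sq x)"
  unfolding log_bracket_def[abs_def] using partial_deriv_add[OF smooth_const smooth_ln[OF bracket_sq_pos smooth_bracket_sq], of j 1]
  by (simp add: partial_deriv_ln[OF bracket_sq_pos smooth_bracket_sq] partial_deriv_bracket_sq)

lemma partial_deriv_loglog: "partial_deriv j loglog = (\<lambda>x. 2 * x $ j / (bracket_sq x * log_bracket x))"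
  unfolding loglog_def[abs_def] by (simp add: partial_deriv_ln[OF log_bracket_pos smooth_log_bracket] partial_deriv_log_bracket mult.commute)

lemma component_le_sqrt_bracket_sq: "\<bar>x $ j\<bar> \<le> sqrt (bracket_sq x)"
proof -
  have "\<bar>x $ j\<bar> \<le> sqrt ((norm x)\<^sup>2)" using component_le_norm_cart[of x j] by simp
  also have "\<dots> \<le> sqrt (bracket_sq x)" by (rule real_sqrt_le_mono) (simp add: bracket_sq_def)
  finally show ?thesis .
qed

text \<open>This estimate ties the cutoff to the weight: one factor
  \<open>sqrt (bracket_sq x)\<close> of the denominator absorbs the component of \<open>x\<close>,
  and what is left is \<open>log_weight\<close>.\<close>

lemma abs_partial_deriv_loglog: "\<bar>partial_deriv j loglog x\<bar> \<le> 2 * log_weight x"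
proof -
  have "\<bar>partial_deriv j loglog x\<bar> = 2 * \<bar>x $ j\<bar> / (bracket_sq x * log_bracket x)"
    using bracket_sq_pos[of x] log_bracket_pos[of x] by (simp add: partial_deriv_loglog abs_mult)
  also have "\<dots> \<le> 2 * sqrt (bracket_sq x) / (bracket_sq x * log_bracket x)"
    using bracket_sq_pos[of x] log_bracket_pos[of x] component_le_sqrt_bracket_sq[of x j] by (intro divide_right_mono) auto
  also have "\<dots> = 2 * log_weight x"
    using bracket_sq_pos[of x] log_bracket_pos[of x] real_sqrt_mult_self[of "bracket_sq x"] by (simp add: log_weight_def divide_simps mult_ac)
  finally show ?thesis .
qed

lemma partial_deriv_bracket_sq_log_bracket: "partial_deriv j (\<lambda>x. bracket_sq x * log_bracket x) x = 2 * x $ j * (log_bracket x + 1)"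
  using bracket_sq_pos[of x] unfolding partial_deriv_mult[OF smooth_bracket_sq smooth_log_bracket] partial_deriv_bracket_sq partial_deriv_log_bracket
  by (simp add: algebra_simps)

text \<open>Obtained by differentiating the identity \<open>partial_deriv j loglog x * (bracket_sq x
  * log_bracket x) = 2 * x $ j\<close>, in place of the quotient rule. The constant is
  \<open>10 = 2 + 8\<close>, one summand for each side of that identity.\<close>

lemma abs_partial_deriv2_loglog: "\<bar>partial_deriv i (partial_deriv j loglog) x\<bar> \<le> 10 * (log_weight x / sqrt (bracket_sq x))"
proof -
  let ?D = "partial_deriv i (partial_deriv j loglog) x"
  have sm: "smooth (partial_deriv j loglog)" by (rule smooth_partial_deriv[OF smooth_loglog])
  have "(\<lambda>x. partial_deriv j loglog x * (bracket_sq x * log_bracket x)) = (\<lambda>x. 2 * x $ j)"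
    using bracket_sq_pos log_bracket_pos by (auto simp: partial_deriv_loglog fun_eq_iff less_imp_neq[symmetric])
  then have "partial_deriv i (\<lambda>x. partial_deriv j loglog x * (bracket_sq x * log_bracket x)) x = 2 * (if j = i then 1 else 0)"
    by (simp add: partial_deriv_cmult smooth_component partial_deriv_component)
  then have e: "?D * (bracket_sq x * log_bracket x) = 2 * (if j = i then 1 else 0) - partial_deriv j loglog x * (2 * x $ i * (log_bracket x + 1))"
    by (simp add: partial_deriv_mult[OF sm smooth_mult[OF smooth_bracket_sq smooth_log_bracket]] partial_deriv_bracket_sq_log_bracket)
  have "\<bar>partial_deriv j loglog x * (2 * x $ i * (log_bracket x + 1))\<bar> \<le> (2 * log_weight x) * (2 * sqrt (bracket_sq x) * (2 * log_bracket x))"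
    unfolding abs_mult
    using abs_partial_deriv_loglog[of j x] component_le_sqrt_bracket_sq[of x i] log_bracket_ge_1[of x] bracket_sq_pos[of x] log_weight_pos[of x]
    by (intro mult_mono) auto
  also have "\<dots> = 8" using bracket_sq_pos[of x] log_bracket_pos[of x] by (simp add: log_weight_def)
  finally have "\<bar>partial_deriv j loglog x * (2 * x $ i * (log_bracket x + 1))\<bar> \<le> 8" .
  moreover have "\<bar>2 * (if j = i then 1 else 0) :: real\<bar> \<le> 2" by simp
  ultimately have "\<bar>?D * (bracket_sq x * log_bracket x)\<bar> \<le> 10" unfolding e by linarith
  then have "\<bar>?D\<bar> \<le> 10 / (bracket_sq x * log_bracket x)"
    using bracket_sq_pos[of x] log_bracket_pos[of x] by (simp add: abs_mult pos_le_divide_eq)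
  also have "\<dots> = 10 * (log_weight x / sqrt (bracket_sq x))"
    using bracket_sq_pos[of x] log_bracket_pos[of x] real_sqrt_mult_self[of "bracket_sq x"] by (simp add: log_weight_def divide_simps mult_ac)
  finally show ?thesis .
qed

lemma partial_deriv_cutoff_arg: "partial_deriv j (\<lambda>x. 1 - loglog x / N) = (\<lambda>x. - (partial_deriv j loglog x / N))"
  unfolding cutoff_arg_eq using smooth_loglog
  by (simp only: partial_deriv_diff[OF smooth_const smooth_cmult[OF smooth_loglog]] partial_deriv_cmult partial_deriv_const) simp

lemma partial_deriv_bump_arg:
  "partial_deriv j (\<lambda>x. bump_D k (1 - loglog x / N))
    = (\<lambda>x. bump_D (Suc k) (1 - loglog x / N) * - (partial_deriv j loglog x / N))"
proof
  fix x
  have "partial_deriv j (\<lambda>x. bump_D k (1 - loglog x / N)) x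
    = bump_D (Suc k) (1 - loglog x / N) * partial_deriv j (\<lambda>x. 1 - loglog x / N) x"
    by (rule partial_deriv_compose_at[OF smooth_diff_at[OF smooth_cutoff_arg] bump_D_deriv])
  then show "partial_deriv j (\<lambda>x. bump_D k (1 - loglog x / N)) x = bump_D (Suc k) (1 - loglog x / N) * - (partial_deriv j loglog x / N)"
    by (simp only: partial_deriv_cutoff_arg)
qed

lemma partial_deriv_cutoff:
  "partial_deriv j (cutoff N) = (\<lambda>x. - exp 1 / N * (bump_D 1 (1 - loglog x / N) * partial_deriv j loglog x))"
  unfolding cutoff_def[abs_def]
  by (simp only: partial_deriv_cmult[OF smooth_bump_compose[OF smooth_cutoff_arg]] partial_deriv_bump_arg) simp

lemma partial_deriv2_cutoff:
  "partial_deriv i (partial_deriv j (cutoff N)) = (\<lambda>x. - exp 1 / N *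
    (bump_D 2 (1 - loglog x / N) * - (partial_deriv i loglog x / N) * partial_deriv j loglog x
      + bump_D 1 (1 - loglog x / N) * partial_deriv i (partial_deriv j loglog) x))"
proof -
  have s: "smooth (\<lambda>x. bump_D 1 (1 - loglog x / N))" by (rule smooth_bump_compose[OF smooth_cutoff_arg])
  have s2: "smooth (partial_deriv j loglog)" by (rule smooth_partial_deriv[OF smooth_loglog])
  show ?thesis
    unfolding partial_deriv_cutoff
    by (simp only: partial_deriv_cmult[OF smooth_mult[OF s s2]] partial_deriv_mult[OF s s2] partial_deriv_bump_arg Suc_1)
qed

lemma cutoff_zero: "N \<ge> 1 \<Longrightarrow> loglog x \<ge> N \<Longrightarrow> cutoff N x = 0"
  by (simp add: cutoff_def bump_D_nonpos)

lemma cutoff_deriv_zero: "N \<ge> 1 \<Longrightarrow> loglog x \<ge> N \<Longrightarrow> partial_deriv j (cutoff N) x = 0"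
  by (simp add: partial_deriv_cutoff bump_D_nonpos)

lemma cutoff_nonneg: "cutoff N x \<ge> 0"
  by (simp add: cutoff_def bump_D_0)

lemma cutoff_le_1: "N \<ge> 1 \<Longrightarrow> cutoff N x \<le> 1"
proof (cases "1 - loglog x / N > 0")
  case True
  assume N: "N \<ge> 1"
  define t where "t = 1 - loglog x / N"
  have t: "t > 0" "t \<le> 1" using True loglog_nonneg[of x] N by (auto simp: t_def)
  then have "exp (1 + - (1 / t)) \<le> 1" by (subst exp_le_one_iff) simp
  then have "exp 1 * bump_D 0 t \<le> 1" using t unfolding exp_add bump_D_0 by simp
  then show ?thesis by (simp add: cutoff_def t_def)
qed (simp add: cutoff_def bump_D_0)

lemma cutoff_tendsto: "(\<lambda>n. cutoff (real (Suc n)) x) \<longlonglongrightarrow> 1"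
proof -
  have "(\<lambda>n. loglog x * inverse (real (Suc n))) \<longlonglongrightarrow> 0"
    using tendsto_mult[OF tendsto_const LIMSEQ_inverse_real_of_nat, of "loglog x"] by simp
  then have "(\<lambda>n. 1 - loglog x / real (Suc n)) \<longlonglongrightarrow> 1 - 0"
    by (intro tendsto_diff tendsto_const) (simp only: divide_inverse)
  then have "(\<lambda>n. bump_D 0 (1 - loglog x / real (Suc n))) \<longlonglongrightarrow> bump_D 0 1"
    by (intro isCont_tendsto_compose[OF DERIV_isCont[OF bump_D_deriv]]) simp
  then have "(\<lambda>n. cutoff (real (Suc n)) x) \<longlonglongrightarrow> exp 1 * bump_D 0 1" unfolding cutoff_def by (intro tendsto_mult tendsto_const)
  then show ?thesis by (simp add: bump_D_0 exp_minus)
qed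

lemma cutoff_test:
  assumes N: "N \<ge> 1" shows "test_function (cutoff N)"
proof (rule test_functionI[OF smooth_cutoff, of "exp (exp N)"])
  fix x :: plane
  let ?R = "exp (exp N)"
  assume x: "norm x > ?R"
  \<comment> \<open>Outside the unit ball \<open>bracket_sq x\<close> exceeds \<open>norm x\<close>,
    so the two logarithms in \<open>loglog\<close> bring \<open>exp (exp N)\<close> down to at least
    \<open>N\<close>.\<close>
  have "1 \<le> ?R" by simp
  then have "norm x * 1 \<le> norm x * norm x" using x by (intro mult_left_mono) linarith+
  then have "?R \<le> bracket_sq x" using x by (simp add: bracket_sq_def power2_eq_square)
  then have "exp N \<le> ln (bracket_sq x)" by (meson ln_ge_iff bracket_sq_pos)
  then have "exp N \<le> log_bracket x" by (simp add: log_bracket_def)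
  then have "N \<le> loglog x" unfolding loglog_def by (meson ln_ge_iff log_bracket_pos)
  then show "cutoff N x = 0" by (rule cutoff_zero[OF N])
qed

text \<open>The cutoff decreases along rays, since \<open>bump_D 1\<close> is nonnegative and
  \<open>loglog\<close> increases outwards. In the Hardy inequalities the derivative of the cutoff
  can therefore be dropped by sign alone.\<close>

lemma cutoff_radial: "N \<ge> 1 \<Longrightarrow> (\<Sum>j\<in>UNIV. x $ j * partial_deriv j (cutoff N) x) \<le> 0"
proof (rule sum_nonpos)
  fix j assume N: "N \<ge> 1"
  have "x $ j * partial_deriv j (cutoff N) x = - (exp 1 / N * bump_D 1 (1 - loglog x / N) * (2 * (x $ j)\<^sup>2 / (bracket_sq x * log_bracket x)))"
    by (simp add: partial_deriv_cutoff partial_deriv_loglog power2_eq_square)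
  also have "\<dots> \<le> 0"
    using bump_D_1_nonneg bracket_sq_pos[of x] log_bracket_pos[of x] N by simp
  finally show "x $ j * partial_deriv j (cutoff N) x \<le> 0" .
qed

lemma cutoff_bounds:
  obtains C where "C > 0" "\<And>N j x. N \<ge> 1 \<Longrightarrow> \<bar>partial_deriv j (cutoff N) x\<bar> \<le> C / N * log_weight x"
    "\<And>N i j x. N \<ge> 1 \<Longrightarrow> \<bar>partial_deriv i (partial_deriv j (cutoff N)) x\<bar> \<le> C / N * (log_weight x / sqrt (bracket_sq x))"
proof -
  obtain M1 where M1: "M1 > 0" "\<And>t. t \<le> 1 \<Longrightarrow> \<bar>bump_D 1 t\<bar> \<le> M1" using bump_D_bounded by blast
  obtain M2 where M2: "M2 > 0" "\<And>t. t \<le> 1 \<Longrightarrow> \<bar>bump_D 2 t\<bar> \<le> M2" using bump_D_bounded by blast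
  \<comment> \<open>\<open>4 * M2\<close> comes from the product of two first derivatives of
    \<open>loglog\<close>, each at most \<open>2 * log_weight\<close>; \<open>10 * M1\<close> comes
    from its second derivative.\<close>
  define C where "C = exp 1 * (4 * M2 + 10 * M1)"
  have arg: "1 - loglog x / N \<le> 1" if "N \<ge> 1" for x N using loglog_nonneg[of x] that by simp
  show thesis
  proof (rule that[of C])
    show "C > 0" using M1 M2 by (simp add: C_def)
    fix N :: real and i j x assume N: "N \<ge> 1"
    have "\<bar>partial_deriv j (cutoff N) x\<bar> = exp 1 / N * (\<bar>bump_D 1 (1 - loglog x / N)\<bar> * \<bar>partial_deriv j loglog x\<bar>)"
      using N by (simp add: partial_deriv_cutoff abs_mult)
    also have "\<dots> \<le> exp 1 / N * (M1 * (2 * log_weight x))"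
      using M1(2)[OF arg[OF N], of x] abs_partial_deriv_loglog[of j x] M1(1) N by (intro mult_left_mono mult_mono) (auto simp del: One_nat_def)
    also have "\<dots> = exp 1 * (2 * M1) / N * log_weight x" by simp
    also have "\<dots> \<le> C / N * log_weight x"
      unfolding C_def using M1 M2 log_weight_pos[of x] N by (intro mult_right_mono divide_right_mono mult_left_mono) auto
    finally show "\<bar>partial_deriv j (cutoff N) x\<bar> \<le> C / N * log_weight x" .
    \<comment> \<open>The product of two first derivatives is of size \<open>log_weight^2\<close>;
      it is brought to the form of the second-derivative bound, at the price of one logarithm. The
      second factor \<open>1 / N\<close> is given up as well.\<close>
    have w: "log_weight x * log_weight x \<le> log_weight x / sqrt (bracket_sq x)"
      using mult_left_mono[OF log_weight_le_inverse_sqrt less_imp_le[OF log_weight_pos], of x x] by simp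
    have "\<bar>bump_D 2 (1 - loglog x / N) * - (partial_deriv i loglog x / N) * partial_deriv j loglog x\<bar> \<le> M2 * (2 * log_weight x / 1) * (2 * log_weight x)"
      unfolding abs_mult abs_minus_cancel abs_divide
      using M2(2)[OF arg[OF N], of x] abs_partial_deriv_loglog[of j x] abs_partial_deriv_loglog[of i x] M2(1) log_weight_pos[of x]
      using N by (intro mult_mono frac_le) auto
    also have "\<dots> \<le> 4 * M2 * (log_weight x / sqrt (bracket_sq x))" using mult_left_mono[OF w, of "4 * M2"] M2(1) by simp
    finally have a: "\<bar>bump_D 2 (1 - loglog x / N) * - (partial_deriv i loglog x / N) * partial_deriv j loglog x\<bar> \<le> 4 * M2 * (log_weight x / sqrt (bracket_sq x))" .
    have b: "\<bar>bump_D 1 (1 - loglog x / N) * partial_deriv i (partial_deriv j loglog) x\<bar> \<le> M1 * (10 * (log_weight x / sqrt (bracket_sq x)))"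
      unfolding abs_mult using M1(2)[OF arg[OF N], of x] abs_partial_deriv2_loglog[of i j x] M1(1) by (intro mult_mono) (auto simp del: One_nat_def)
    have "\<bar>partial_deriv i (partial_deriv j (cutoff N)) x\<bar> \<le> exp 1 / N * (4 * M2 * (log_weight x / sqrt (bracket_sq x)) + M1 * (10 * (log_weight x / sqrt (bracket_sq x))))"
      unfolding partial_deriv2_cutoff abs_mult[of "- exp 1 / N"]
      using order_trans[OF abs_triangle_ineq add_mono[OF a b]] N by (intro mult_mono) auto
    also have "\<dots> = C / N * (log_weight x / sqrt (bracket_sq x))" by (simp add: C_def algebra_simps add_divide_distrib)
    finally show "\<bar>partial_deriv i (partial_deriv j (cutoff N)) x\<bar> \<le> C / N * (log_weight x / sqrt (bracket_sq x))" .
  qed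
qed

subsection \<open>Hardy inequalities with logarithmic weights\<close>

text \<open>The inequality between arithmetic and geometric mean, compared after squaring so that no
  roots of the weights appear. The half of \<open>W * a^2\<close> is what the Hardy argument absorbs
  on its left-hand side.\<close>

lemma weighted_Young:
  fixes a W w P r :: real
  assumes "r\<^sup>2 \<le> W * w" "0 \<le> W" "0 \<le> w"
  shows "2 * \<bar>a\<bar> * (\<bar>r\<bar> * \<bar>P\<bar>) \<le> W * a\<^sup>2 / 2 + 2 * (w * P\<^sup>2)"
proof (rule power2_le_imp_le)
  have "(2 * \<bar>a\<bar> * (\<bar>r\<bar> * \<bar>P\<bar>))\<^sup>2 = 4 * (a\<^sup>2 * P\<^sup>2) * r\<^sup>2" by (simp add: power_mult_distrib)
  also have "\<dots> \<le> 4 * (a\<^sup>2 * P\<^sup>2) * (W * w)" using assms by (intro mult_left_mono) auto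
  also have "\<dots> \<le> (W * a\<^sup>2 / 2 + 2 * (w * P\<^sup>2))\<^sup>2"
    using zero_le_power2[of "W * a\<^sup>2 / 2 - 2 * (w * P\<^sup>2)"] by (simp add: power2_eq_square field_simps)
  finally show "(2 * \<bar>a\<bar> * (\<bar>r\<bar> * \<bar>P\<bar>))\<^sup>2 \<le> (W * a\<^sup>2 / 2 + 2 * (w * P\<^sup>2))\<^sup>2" .
qed (use assms in auto)

text \<open>The multiplier is the radial field \<open>V x = - G x *\<^sub>R x\<close>: it points inwards, so the
  derivative of the radially decreasing cutoff contributes with the favourable sign.\<close>

lemma radial_Hardy:
  fixes f G W w :: "plane \<Rightarrow> real"
  assumes f: "smooth f" and G: "smooth G" "\<And>x. G x \<ge> 0"
    and [measurable]: "W \<in> borel_measurable borel" "w \<in> borel_measurable borel"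
    and W0: "\<And>x. W x \<ge> 0" and w0: "\<And>x. w x \<ge> 0" and M: "M \<ge> 0"
    and div: "\<And>x. W x \<le> - (\<Sum>j\<in>UNIV. G x + x $ j * partial_deriv j G x) + M * indicator (cball 0 R) x"
    and GW: "\<And>x. (norm x * G x)\<^sup>2 \<le> W x * w x"
    and fin: "\<And>j. integrable lborel (\<lambda>x. w x * (partial_deriv j f x)\<^sup>2)"
  shows "integrable lborel (\<lambda>x. W x * (f x)\<^sup>2)"
    "(\<integral>x. W x * (f x)\<^sup>2 \<partial>lborel) \<le> 8 * (\<Sum>j\<in>UNIV. \<integral>x. w x * (partial_deriv j f x)\<^sup>2 \<partial>lborel)
      + 2 * M * (\<integral>x. indicator (cball 0 R) x * (f x)\<^sup>2 \<partial>lborel)"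
proof -
  have [measurable]: "f \<in> borel_measurable borel" by (rule smooth_measurable[OF f])
  \<comment> \<open>The components of \<open>cutoff N * f^2 * V\<close>. It is compactly supported,
    so its divergence has integral zero, and this identity is the whole inequality.\<close>
  define E where "E j N x = cutoff N x * ((f x * f x) * (- (x $ j * G x)))" for j N x
  define P where "P x = (\<Sum>j\<in>UNIV. w x * (partial_deriv j f x)\<^sup>2)" for x
  define Q where "Q x = indicator (cball 0 R) x * (f x)\<^sup>2" for x
  have sm: "smooth (\<lambda>x. (f x * f x) * (- (x $ j * G x)))" for j
    by (intro smooth_mult f smooth_minus smooth_component G)
  have Et: "test_function (E j N)" if "N \<ge> 1" for j N
    unfolding E_def using test_function_mult_left[OF cutoff_test[OF that] sm] .
  have iP: "integrable lborel P" unfolding P_def using fin by simp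
  have iQ: "integrable lborel Q"
    using continuous_loc_int[of "\<lambda>x. (f x)\<^sup>2"] smooth_continuous[OF f]
    unfolding Q_def loc_int_def by (auto intro!: continuous_intros)
  define rhs where "rhs N x = (\<Sum>j\<in>UNIV. partial_deriv j (E j N) x) + 4 * P x + M * Q x" for N x
  have irhs: "integrable lborel (rhs N)" "(\<integral>x. rhs N x \<partial>lborel) = 4 * (\<integral>x. P x \<partial>lborel) + M * (\<integral>x. Q x \<partial>lborel)"
    if "N \<ge> 1" for N
  proof -
    have "integrable lborel (partial_deriv j (E j N))" for j
      by (rule test_function_integrable[OF test_function_partial_deriv[OF Et[OF that]]])
    moreover have "(\<integral>x. partial_deriv j (E j N) x \<partial>lborel) = 0" for j
      by (rule integral_partial_deriv_test[OF Et[OF that]])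
    ultimately show "integrable lborel (rhs N)" "(\<integral>x. rhs N x \<partial>lborel) = 4 * (\<integral>x. P x \<partial>lborel) + M * (\<integral>x. Q x \<partial>lborel)"
      using iP iQ by (simp_all add: rhs_def[abs_def])
  qed
  \<comment> \<open>The divergence splits into three parts: the derivative of the cutoff,
    nonnegative by \<open>cutoff_radial\<close>; the divergence of \<open>V\<close>, at least
    \<open>W\<close> up to the ball term; and the cross term with \<open>grad f\<close>, which
    Young's inequality absorbs at the cost of half of \<open>W * f^2\<close>. The cutoff stays in
    front because \<open>W * f^2\<close> is not yet known to be integrable.\<close>
  have key: "cutoff N x * (W x * (f x)\<^sup>2) / 2 \<le> rhs N x" if N: "N \<ge> 1" for N x
  proof -
    let ?c = "cutoff N x" and ?d = "\<lambda>j. partial_deriv j f x"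
    have c: "0 \<le> ?c" "?c \<le> 1" using cutoff_nonneg cutoff_le_1[OF N] by auto
    have dE: "partial_deriv j (E j N) x = - (f x)\<^sup>2 * G x * (x $ j * partial_deriv j (cutoff N) x)
       - 2 * ?c * f x * (G x * (x $ j * ?d j)) - ?c * (f x)\<^sup>2 * (G x + x $ j * partial_deriv j G x)" for j
    proof -
      have s1: "smooth (\<lambda>x. x $ j * G x)" by (intro smooth_mult smooth_component G)
      show ?thesis
        unfolding E_def[abs_def] partial_deriv_mult[OF smooth_cutoff sm] partial_deriv_mult[OF smooth_mult[OF f f] smooth_minus[OF s1]]
          partial_deriv_minus[OF s1] partial_deriv_mult[OF f f] partial_deriv_mult[OF smooth_component G(1)] partial_deriv_component
        by (simp add: power2_eq_square algebra_simps)
    qed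
    have sE: "(\<Sum>j\<in>UNIV. partial_deriv j (E j N) x) = - (f x)\<^sup>2 * G x * (\<Sum>j\<in>UNIV. x $ j * partial_deriv j (cutoff N) x)
       - 2 * ?c * f x * (G x * (\<Sum>j\<in>UNIV. x $ j * ?d j)) - ?c * (f x)\<^sup>2 * (\<Sum>j\<in>UNIV. G x + x $ j * partial_deriv j G x)"
      unfolding dE by (simp add: sum_subtractf sum_distrib_left)
    have 1: "0 \<le> - (f x)\<^sup>2 * G x * (\<Sum>j\<in>UNIV. x $ j * partial_deriv j (cutoff N) x)"
      using mult_nonneg_nonpos[OF mult_nonneg_nonneg[OF zero_le_power2[of "f x"] G(2)[of x]] cutoff_radial[OF N, of x]] by simp
    have 2: "?c * (W x * (f x)\<^sup>2) \<le> - ?c * (f x)\<^sup>2 * (\<Sum>j\<in>UNIV. G x + x $ j * partial_deriv j G x) + M * Q x"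
    proof -
      have "?c * (f x)\<^sup>2 * W x \<le> ?c * (f x)\<^sup>2 * (- (\<Sum>j\<in>UNIV. G x + x $ j * partial_deriv j G x) + M * indicator (cball 0 R) x)"
        using c by (intro mult_left_mono div) auto
      moreover have "?c * (M * Q x) \<le> M * Q x" using c M by (intro mult_left_le_one_le) (auto simp: Q_def)
      ultimately show ?thesis by (simp add: Q_def algebra_simps)
    qed
    have 3: "\<bar>2 * ?c * f x * (G x * (\<Sum>j\<in>UNIV. x $ j * ?d j))\<bar> \<le> ?c * (W x * (f x)\<^sup>2) / 2 + 4 * P x"
    proof -
      have d: "\<bar>\<Sum>j\<in>UNIV. x $ j * ?d j\<bar> \<le> norm x * norm (\<chi> j. ?d j)"
        using Cauchy_Schwarz_ineq2[of x "\<chi> j. ?d j"] by (simp add: inner_vec_def)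
      have n: "(norm (\<chi> j. ?d j))\<^sup>2 = (\<Sum>j\<in>UNIV. (?d j)\<^sup>2)"
        unfolding norm_sq_plane by (simp add: power2_eq_square)
      have "\<bar>2 * ?c * f x * (G x * (\<Sum>j\<in>UNIV. x $ j * ?d j))\<bar> = ?c * (2 * \<bar>f x\<bar> * (G x * \<bar>\<Sum>j\<in>UNIV. x $ j * ?d j\<bar>))"
        using c G(2) by (simp add: abs_mult)
      also have "\<dots> \<le> ?c * (2 * \<bar>f x\<bar> * (G x * (norm x * norm (\<chi> j. ?d j))))"
        using c G(2) d by (intro mult_left_mono) auto
      also have "\<dots> = ?c * (2 * \<bar>f x\<bar> * (\<bar>norm x * G x\<bar> * \<bar>norm (\<chi> j. ?d j)\<bar>))"
        using G(2) by (simp add: abs_mult mult_ac)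
      also have "\<dots> \<le> ?c * (W x * (f x)\<^sup>2 / 2 + 2 * (w x * (norm (\<chi> j. ?d j))\<^sup>2))"
        using c by (intro mult_left_mono weighted_Young GW W0 w0)
      also have "\<dots> = ?c * (W x * (f x)\<^sup>2) / 2 + ?c * (2 * P x)"
        unfolding n by (simp add: P_def sum_distrib_left algebra_simps)
      also have "?c * (2 * P x) \<le> 1 * (2 * P x)" using c w0 by (intro mult_right_mono) (auto simp: P_def sum_nonneg)
      finally have "\<bar>2 * ?c * f x * (G x * (\<Sum>j\<in>UNIV. x $ j * ?d j))\<bar> \<le> ?c * (W x * (f x)\<^sup>2) / 2 + 2 * P x" by simp
      moreover have "P x \<ge> 0" using w0 by (simp add: P_def sum_nonneg)
      ultimately show ?thesis by linarith
    qed
    show ?thesis unfolding rhs_def sE using 1 2 3 by linarith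
  qed
  define B where "B = 8 * (\<integral>x. P x \<partial>lborel) + 2 * M * (\<integral>x. Q x \<partial>lborel)"
  have le: "(\<integral>\<^sup>+x. ennreal (cutoff N x * (W x * (f x)\<^sup>2)) \<partial>lborel) \<le> ennreal B" if N: "N \<ge> 1" for N
  proof -
    have k: "0 \<le> cutoff N x * (W x * (f x)\<^sup>2)" for x using cutoff_nonneg W0 by simp
    have k2: "cutoff N x * (W x * (f x)\<^sup>2) \<le> 2 * rhs N x" for x using key[OF N, of x] by simp
    have "(\<integral>\<^sup>+x. ennreal (cutoff N x * (W x * (f x)\<^sup>2)) \<partial>lborel) \<le> (\<integral>\<^sup>+x. ennreal (2 * rhs N x) \<partial>lborel)"
      by (intro nn_integral_mono ennreal_leI k2)
    also have "\<dots> = ennreal (\<integral>x. 2 * rhs N x \<partial>lborel)"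
      using irhs(1)[OF N] order_trans[OF k k2] by (intro nn_integral_eq_integral) auto
    also have "(\<integral>x. 2 * rhs N x \<partial>lborel) = B" using irhs(2)[OF N] by (simp add: B_def)
    finally show ?thesis .
  qed
  \<comment> \<open>The bound \<open>B\<close> does not depend on \<open>N\<close>, so Fatou's lemma
    removes the cutoff and yields integrability together with the estimate.\<close>
  have "(\<integral>\<^sup>+x. ennreal (W x * (f x)\<^sup>2) \<partial>lborel) = (\<integral>\<^sup>+x. liminf (\<lambda>n. ennreal (cutoff (real (Suc n)) x * (W x * (f x)\<^sup>2))) \<partial>lborel)"
  proof (rule nn_integral_cong)
    fix x
    have "(\<lambda>n. ennreal (cutoff (real (Suc n)) x * (W x * (f x)\<^sup>2))) \<longlonglongrightarrow> ennreal (1 * (W x * (f x)\<^sup>2))"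
      by (intro tendsto_ennrealI tendsto_mult tendsto_const cutoff_tendsto)
    from lim_imp_Liminf[OF _ this] show "ennreal (W x * (f x)\<^sup>2) = liminf (\<lambda>n. ennreal (cutoff (real (Suc n)) x * (W x * (f x)\<^sup>2)))"
      by simp
  qed
  also have "\<dots> \<le> liminf (\<lambda>n. \<integral>\<^sup>+x. ennreal (cutoff (real (Suc n)) x * (W x * (f x)\<^sup>2)) \<partial>lborel)"
    by (rule nn_integral_liminf) measurable
  also have "\<dots> \<le> liminf (\<lambda>n::nat. ennreal B)"
    by (intro Liminf_mono always_eventually allI le) simp
  finally have fin: "(\<integral>\<^sup>+x. ennreal (W x * (f x)\<^sup>2) \<partial>lborel) \<le> ennreal B" by (simp add: Liminf_const)
  show i: "integrable lborel (\<lambda>x. W x * (f x)\<^sup>2)"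
    using order_le_less_trans[OF fin] W0 by (intro integrableI_nonneg) auto
  have B0: "B \<ge> 0"
    unfolding B_def using M w0 by (intro add_nonneg_nonneg mult_nonneg_nonneg Bochner_Integration.integral_nonneg) (auto simp: P_def Q_def sum_nonneg)
  have "ennreal (\<integral>x. W x * (f x)\<^sup>2 \<partial>lborel) \<le> ennreal B"
    using fin i W0 by (subst (asm) nn_integral_eq_integral) auto
  then have "(\<integral>x. W x * (f x)\<^sup>2 \<partial>lborel) \<le> B" using B0 by simp
  also have "(\<integral>x. P x \<partial>lborel) = (\<Sum>j\<in>UNIV. \<integral>x. w x * (partial_deriv j f x)\<^sup>2 \<partial>lborel)"
    unfolding P_def using fin assms(11) by (intro Bochner_Integration.integral_sum) auto
  then have "B = 8 * (\<Sum>j\<in>UNIV. \<integral>x. w x * (partial_deriv j f x)\<^sup>2 \<partial>lborel) + 2 * M * (\<integral>x. indicator (cball 0 R) x * (f x)\<^sup>2 \<partial>lborel)"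
    by (simp add: B_def Q_def)
  finally show "(\<integral>x. W x * (f x)\<^sup>2 \<partial>lborel) \<le> 8 * (\<Sum>j\<in>UNIV. \<integral>x. w x * (partial_deriv j f x)\<^sup>2 \<partial>lborel)
      + 2 * M * (\<integral>x. indicator (cball 0 R) x * (f x)\<^sup>2 \<partial>lborel)" .
qed

text \<open>A smooth substitute for \<open>1 / (r^2 log r)\<close>. In the plane the field
  \<open>- x / (r^2 log r)\<close> has divergence \<open>1 / (r^2 (log r)^2)\<close>: the part
  without logarithm is divergence-free, which is why the plane Hardy inequality must carry a
  logarithm.\<close>

definition hardy_kernel :: "plane \<Rightarrow> real" where "hardy_kernel x = 1 / (bracket_sq x * log_bracket x)"

lemma hardy_kernel_pos: "hardy_kernel x > 0" using bracket_sq_pos[of x] log_bracket_pos[of x] by (simp add: hardy_kernel_def)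

lemma smooth_hardy_kernel: "smooth hardy_kernel"
  unfolding hardy_kernel_def[abs_def] using bracket_sq_pos log_bracket_pos by (intro smooth_inverse smooth_mult smooth_bracket_sq smooth_log_bracket) simp

text \<open>Again by differentiating an identity, here that the kernel times its reciprocal is
  1.\<close>

lemma partial_deriv_hardy_kernel: "partial_deriv j hardy_kernel x = - (hardy_kernel x)\<^sup>2 * (2 * x $ j * (log_bracket x + 1))"
proof -
  have "(\<lambda>x. hardy_kernel x * (bracket_sq x * log_bracket x)) = (\<lambda>x. 1)"
    using bracket_sq_pos log_bracket_pos by (auto simp: hardy_kernel_def fun_eq_iff less_imp_neq[symmetric])
  then have "partial_deriv j (\<lambda>x. hardy_kernel x * (bracket_sq x * log_bracket x)) x = 0" by simp
  then have "partial_deriv j hardy_kernel x * (bracket_sq x * log_bracket x) + hardy_kernel x * (2 * x $ j * (log_bracket x + 1)) = 0"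
    by (simp add: partial_deriv_mult[OF smooth_hardy_kernel smooth_mult[OF smooth_bracket_sq smooth_log_bracket]] partial_deriv_bracket_sq_log_bracket)
  then have D: "partial_deriv j hardy_kernel x * (bracket_sq x * log_bracket x) = - (hardy_kernel x * (2 * x $ j * (log_bracket x + 1)))"
    by (rule eq_neg_iff_add_eq_0[THEN iffD2])
  have "bracket_sq x * log_bracket x * hardy_kernel x = 1" using bracket_sq_pos[of x] log_bracket_pos[of x] by (simp add: hardy_kernel_def)
  then have "partial_deriv j hardy_kernel x = partial_deriv j hardy_kernel x * (bracket_sq x * log_bracket x) * hardy_kernel x"
    by (simp only: mult.assoc mult_1_right)
  then show ?thesis unfolding D by (simp add: power2_eq_square mult_ac)
qed

lemma sum_component_sq: "(\<Sum>j\<in>UNIV. x $ j * x $ j) = bracket_sq x - 1"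
  by (simp add: bracket_sq_def norm_sq_plane)

text \<open>The leading term \<open>2 * bracket_sq x\<close> produces twice
  \<open>(log_weight x)^2\<close>. The logarithmic corrections are of lower order and matter only in
  a ball.\<close>

lemma divergence_hardy_kernel:
  "- (\<Sum>j\<in>UNIV. hardy_kernel x + x $ j * partial_deriv j hardy_kernel x) = (hardy_kernel x)\<^sup>2 * (2 * bracket_sq x - 2 * log_bracket x - 2)"
proof -
  have "(\<Sum>j\<in>UNIV. x $ j * partial_deriv j hardy_kernel x) = - (hardy_kernel x)\<^sup>2 * 2 * (log_bracket x + 1) * (\<Sum>j\<in>UNIV. x $ j * x $ j)"
    unfolding partial_deriv_hardy_kernel sum_distrib_left by (intro sum.cong refl) (simp add: mult_ac)
  then have "- (\<Sum>j\<in>UNIV. hardy_kernel x + x $ j * partial_deriv j hardy_kernel x) = - 2 * hardy_kernel x + (hardy_kernel x)\<^sup>2 * 2 * (log_bracket x + 1) * (bracket_sq x - 1)"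
    by (simp add: sum.distrib sum_component_sq)
  also have "\<dots> = - 2 * ((hardy_kernel x)\<^sup>2 * (bracket_sq x * log_bracket x)) + (hardy_kernel x)\<^sup>2 * 2 * (log_bracket x + 1) * (bracket_sq x - 1)"
    using bracket_sq_pos[of x] log_bracket_pos[of x] by (simp add: hardy_kernel_def power2_eq_square)
  finally show ?thesis by (simp add: algebra_simps)
qed

lemma log_weight_sq_hardy_kernel: "(log_weight x)\<^sup>2 = (hardy_kernel x)\<^sup>2 * bracket_sq x"
  using bracket_sq_pos[of x] unfolding log_weight_sq hardy_kernel_def by (simp add: power2_eq_square)

lemma hardy_kernel_sq_log_bracket: "(hardy_kernel x)\<^sup>2 * log_bracket x \<le> 1"
proof -
  have "(hardy_kernel x)\<^sup>2 * log_bracket x = 1 / (bracket_sq x * bracket_sq x * log_bracket x)" using log_bracket_pos[of x] by (simp add: hardy_kernel_def power2_eq_square)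
  also have "\<dots> \<le> 1"
    using mult_mono[OF mult_mono[OF bracket_sq_ge_1 bracket_sq_ge_1] log_bracket_ge_1, of x x x] bracket_sq_pos[of x] by simp
  finally show ?thesis .
qed

lemma bracket_sq_outside: "norm x > real k \<Longrightarrow> bracket_sq x > 1 + (real k)\<^sup>2"
  by (simp add: bracket_sq_def power_strict_mono)

lemma log_Hardy:
  fixes f :: "plane \<Rightarrow> real"
  assumes f: "smooth f" and fin: "\<And>j. sq_int (partial_deriv j f)"
  shows "sq_int (\<lambda>x. log_weight x * f x)"
    "(\<integral>x. (log_weight x * f x)\<^sup>2 \<partial>lborel) \<le> 8 * (\<Sum>j\<in>UNIV. \<integral>x. (partial_deriv j f x)\<^sup>2 \<partial>lborel)
      + 8 * (\<integral>x. indicator (cball 0 4) x * (f x)\<^sup>2 \<partial>lborel)"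
proof -
  have "(log_weight x)\<^sup>2 \<le> (hardy_kernel x)\<^sup>2 * (2 * bracket_sq x - 2 * log_bracket x - 2) + 4 * indicator (cball 0 4) x" for x
  proof (cases "norm x \<le> 4")
    case True
    have "(hardy_kernel x)\<^sup>2 * (2 * bracket_sq x - 2 * log_bracket x - 2) - (log_weight x)\<^sup>2 = (hardy_kernel x)\<^sup>2 * (bracket_sq x - 2 * log_bracket x - 2)"
      by (simp add: log_weight_sq_hardy_kernel algebra_simps)
    \<comment> \<open>Near the origin the divergence may have the wrong sign. Its defect is at most
      \<open>4 * (hardy_kernel x)^2 * log_bracket x\<close>, hence at most 4, which is the constant
      \<open>M\<close> of the ball term.\<close>
    moreover have "(hardy_kernel x)\<^sup>2 * (- (4 * log_bracket x)) \<le> (hardy_kernel x)\<^sup>2 * (bracket_sq x - 2 * log_bracket x - 2)"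
      using bracket_sq_ge_1[of x] log_bracket_ge_1[of x] by (intro mult_left_mono) auto
    ultimately show ?thesis using hardy_kernel_sq_log_bracket[of x] True by (simp add: mult.left_commute)
  next
    case False
    then have q: "bracket_sq x > 17" using bracket_sq_outside[of 4 x] by simp
    have s: "sqrt (bracket_sq x) \<ge> 4" using q by (intro real_le_rsqrt) simp
    \<comment> \<open>With \<open>s = sqrt (bracket_sq x)\<close> and
      \<open>ln s \<le> s - 1\<close> the corrections are at most \<open>4 * s\<close>, which is
      below \<open>s^2\<close> as soon as \<open>s \<ge> 4\<close>. This fixes the radius 4.\<close>
    have "ln (bracket_sq x) = 2 * ln (sqrt (bracket_sq x))" using bracket_sq_pos[of x] by (simp add: ln_sqrt)
    also have "\<dots> \<le> 2 * (sqrt (bracket_sq x) - 1)" using ln_le_minus_one[of "sqrt (bracket_sq x)"] bracket_sq_pos[of x] by simp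
    finally have "2 * log_bracket x + 2 \<le> 4 * sqrt (bracket_sq x)" by (simp add: log_bracket_def)
    also have "\<dots> \<le> sqrt (bracket_sq x) * sqrt (bracket_sq x)" using s less_imp_le[OF bracket_sq_pos[of x]] by (intro mult_right_mono) auto
    also have "\<dots> = bracket_sq x" using less_imp_le[OF bracket_sq_pos[of x]] by simp
    finally have "bracket_sq x \<le> 2 * bracket_sq x - 2 * log_bracket x - 2" by simp
    then show ?thesis unfolding log_weight_sq_hardy_kernel using False by (simp add: mult_left_mono)
  qed
  then have div: "(log_weight x)\<^sup>2 \<le> - (\<Sum>j\<in>UNIV. hardy_kernel x + x $ j * partial_deriv j hardy_kernel x) + 4 * indicator (cball 0 4) x" for x
    unfolding divergence_hardy_kernel .
  have GW: "(norm x * hardy_kernel x)\<^sup>2 \<le> (log_weight x)\<^sup>2 * 1" for x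
    unfolding log_weight_sq_hardy_kernel by (simp add: power_mult_distrib bracket_sq_def algebra_simps)
  have fin': "integrable lborel (\<lambda>x. 1 * (partial_deriv j f x)\<^sup>2)" for j using fin by (simp add: sq_int_def)
  have [measurable]: "f \<in> borel_measurable borel" by (rule smooth_measurable[OF f])
  note H = radial_Hardy[OF f smooth_hardy_kernel less_imp_le[OF hardy_kernel_pos] _ _ _ _ _ div GW fin']
  show "sq_int (\<lambda>x. log_weight x * f x)" unfolding sq_int_def power_mult_distrib by (intro conjI H(1)) auto
  show "(\<integral>x. (log_weight x * f x)\<^sup>2 \<partial>lborel) \<le> 8 * (\<Sum>j\<in>UNIV. \<integral>x. (partial_deriv j f x)\<^sup>2 \<partial>lborel)
      + 8 * (\<integral>x. indicator (cball 0 4) x * (f x)\<^sup>2 \<partial>lborel)"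
    unfolding power_mult_distrib using H(2) by simp
qed

text \<open>The logarithmic Hardy inequality for the constant function 1, whose gradient
  vanishes.\<close>

lemma sq_int_log_weight: "sq_int log_weight"
  using log_Hardy(1)[OF smooth_const, of 1] sq_int_zero by simp

text \<open>The multiplier is now built on \<open>hardy_kernel^2\<close>. One power further out the
  plane is no longer critical: \<open>- x / (r^4 (log r)^2)\<close> has divergence at least
  \<open>2 / (r^4 (log r)^2)\<close> for large \<open>r\<close>, so no further logarithm is lost. It
  serves for stream functions, whose gradient is only in weighted \<open>L^2\<close>.\<close>

lemma second_log_Hardy:
  fixes f :: "plane \<Rightarrow> real"
  assumes f: "smooth f" and fin: "\<And>j. sq_int (\<lambda>x. log_weight x * partial_deriv j f x)"
  shows "sq_int (\<lambda>x. log_weight x / sqrt (bracket_sq x) * f x)"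
proof -
  have sG: "smooth (\<lambda>x. hardy_kernel x * hardy_kernel x)" by (intro smooth_mult smooth_hardy_kernel)
  have [measurable]: "f \<in> borel_measurable borel" "hardy_kernel \<in> borel_measurable borel" by (auto intro: smooth_measurable f smooth_hardy_kernel)
  have eq: "- (\<Sum>j\<in>UNIV. hardy_kernel x * hardy_kernel x + x $ j * partial_deriv j (\<lambda>x. hardy_kernel x * hardy_kernel x) x)
    = (hardy_kernel x)\<^sup>2 * (- 2 + 4 * (hardy_kernel x * (log_bracket x + 1) * (bracket_sq x - 1)))" for x
  proof -
    have "x $ j * partial_deriv j (\<lambda>x. hardy_kernel x * hardy_kernel x) x = (hardy_kernel x)\<^sup>2 * (- 4 * (hardy_kernel x * (log_bracket x + 1))) * (x $ j * x $ j)" for j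
      unfolding partial_deriv_mult[OF smooth_hardy_kernel smooth_hardy_kernel] partial_deriv_hardy_kernel by (simp add: power2_eq_square algebra_simps)
    then have "(\<Sum>j\<in>UNIV. x $ j * partial_deriv j (\<lambda>x. hardy_kernel x * hardy_kernel x) x) = (hardy_kernel x)\<^sup>2 * (- 4 * (hardy_kernel x * (log_bracket x + 1))) * (bracket_sq x - 1)"
      by (simp only: sum_distrib_left[symmetric] sum_component_sq)
    then show ?thesis by (simp add: sum.distrib power2_eq_square algebra_simps)
  qed
  have div: "(hardy_kernel x)\<^sup>2 \<le> - (\<Sum>j\<in>UNIV. hardy_kernel x * hardy_kernel x + x $ j * partial_deriv j (\<lambda>x. hardy_kernel x * hardy_kernel x) x) + 3 * indicator (cball 0 2) x" for x
  proof -
    have "(hardy_kernel x)\<^sup>2 * 1 \<le> (hardy_kernel x)\<^sup>2 * log_bracket x" by (intro mult_left_mono log_bracket_ge_1) simp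
    then have g: "hardy_kernel x \<ge> 0" "(hardy_kernel x)\<^sup>2 \<le> 1"
      using hardy_kernel_pos[of x] hardy_kernel_sq_log_bracket[of x] by linarith+
    show ?thesis
    proof (cases "norm x \<le> 2")
      case True
      have "hardy_kernel x * (log_bracket x + 1) * (bracket_sq x - 1) \<ge> 0" using g log_bracket_pos[of x] bracket_sq_ge_1[of x] by simp
      then have "(hardy_kernel x)\<^sup>2 * (- 2) \<le> (hardy_kernel x)\<^sup>2 * (- 2 + 4 * (hardy_kernel x * (log_bracket x + 1) * (bracket_sq x - 1)))"
        by (intro mult_left_mono) auto
      then show ?thesis unfolding eq using True g(2) by simp
    next
      case False
      then have q: "bracket_sq x > 5" using bracket_sq_outside[of 2 x] by simp
      \<comment> \<open>A ratio of \<open>3 / 4\<close> is what makes the bracket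
        \<open>- 2 + 4 * (3 / 4) = 1\<close> reproduce the weight.\<close>
      have "3 / 4 \<le> (bracket_sq x - 1) / bracket_sq x" using q by (simp add: field_simps)
      also have "\<dots> = hardy_kernel x * log_bracket x * (bracket_sq x - 1)" using log_bracket_pos[of x] by (simp add: hardy_kernel_def)
      also have "\<dots> \<le> hardy_kernel x * (log_bracket x + 1) * (bracket_sq x - 1)" using g q by (intro mult_right_mono mult_left_mono) auto
      finally have "(hardy_kernel x)\<^sup>2 * 1 \<le> (hardy_kernel x)\<^sup>2 * (- 2 + 4 * (hardy_kernel x * (log_bracket x + 1) * (bracket_sq x - 1)))"
        by (intro mult_left_mono) auto
      then show ?thesis unfolding eq using False by simp
    qed
  qed
  have GW: "(norm x * (hardy_kernel x * hardy_kernel x))\<^sup>2 \<le> (hardy_kernel x)\<^sup>2 * (log_weight x)\<^sup>2" for x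
    unfolding log_weight_sq_hardy_kernel by (simp add: power_mult_distrib bracket_sq_def algebra_simps)
  have fin': "integrable lborel (\<lambda>x. (log_weight x)\<^sup>2 * (partial_deriv j f x)\<^sup>2)" for j
    using fin by (simp add: sq_int_def power_mult_distrib)
  have "integrable lborel (\<lambda>x. (hardy_kernel x)\<^sup>2 * (f x)\<^sup>2)"
    by (rule radial_Hardy(1)[OF f sG _ _ _ _ _ _ div GW fin']) auto
  moreover have "(log_weight x / sqrt (bracket_sq x) * f x)\<^sup>2 = (hardy_kernel x)\<^sup>2 * (f x)\<^sup>2" for x
    using bracket_sq_pos[of x] by (simp add: power_mult_distrib power_divide log_weight_sq_hardy_kernel)
  ultimately show ?thesis by (simp add: sq_int_def)
qed

lemma continuous_ball_integrable:
  fixes f :: "plane \<Rightarrow> real"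
  shows "continuous_on UNIV f \<Longrightarrow> integrable lborel (\<lambda>x. indicator (cball 0 R) x * f x)"
  using continuous_loc_int[of f] by (simp add: loc_int_def)

lemma loc_int_indicator:
  assumes "loc_int f" "A \<in> sets borel" "A \<subseteq> cball 0 S"
  shows "integrable lborel (\<lambda>x. indicator A x * f x)"
proof -
  have "integrable lborel (\<lambda>x. indicator (cball 0 S) x * f x)" using assms(1) by (simp add: loc_int_def)
  then have "integrable lborel (\<lambda>x. indicator A x *\<^sub>R (indicator (cball 0 S) x * f x))"
    by (rule integrable_mult_indicator[rotated]) (simp add: assms(2))
  moreover have "(\<lambda>x. indicator A x *\<^sub>R (indicator (cball 0 S) x * f x)) = (\<lambda>x. indicator A x * f x)"
    using assms(3) by (auto simp: indicator_def fun_eq_iff)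
  ultimately show ?thesis by (simp only:)
qed

subsection \<open>Convergence in the mean\<close>

definition L2_tendsto :: "(nat \<Rightarrow> plane \<Rightarrow> real) \<Rightarrow> (plane \<Rightarrow> real) \<Rightarrow> bool" where
  "L2_tendsto F f \<longleftrightarrow> (\<forall>n. sq_int (F n)) \<and> sq_int f \<and> (\<lambda>n. \<integral>x. (F n x - f x)\<^sup>2 \<partial>lborel) \<longlonglongrightarrow> 0"

lemma abs_integral_mult_le:
  assumes "sq_int f" "sq_int g"
  shows "\<bar>\<integral>x. f x * g x \<partial>lborel\<bar> \<le> sqrt (\<integral>x. (f x)\<^sup>2 \<partial>lborel) * sqrt (\<integral>x. (g x)\<^sup>2 \<partial>lborel)"
  using real_sqrt_le_mono[OF Cauchy_Schwarz_sq_int[OF assms]] by (simp add: real_sqrt_mult)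

lemma L2_tendsto_const: "sq_int f \<Longrightarrow> L2_tendsto (\<lambda>_. f) f"
  by (simp add: L2_tendsto_def)

lemma L2_tendsto_inner:
  assumes F: "L2_tendsto F f" and H: "L2_tendsto H h"
  shows "(\<lambda>n. \<integral>x. F n x * H n x \<partial>lborel) \<longlonglongrightarrow> (\<integral>x. f x * h x \<partial>lborel)"
proof -
  note s = F[unfolded L2_tendsto_def] H[unfolded L2_tendsto_def]
  have d: "sq_int (\<lambda>x. F n x - f x)" "sq_int (\<lambda>x. H n x - h x)" for n using s by (auto intro: sq_int_diff)
  define a where "a n = sqrt (\<integral>x. (F n x - f x)\<^sup>2 \<partial>lborel)" for n
  define b where "b n = sqrt (\<integral>x. (H n x - h x)\<^sup>2 \<partial>lborel)" for n
  have a: "a \<longlonglongrightarrow> 0" unfolding a_def using tendsto_real_sqrt[of "\<lambda>n. \<integral>x. (F n x - f x)\<^sup>2 \<partial>lborel" 0] s by simp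
  have b: "b \<longlonglongrightarrow> 0" unfolding b_def using tendsto_real_sqrt[of "\<lambda>n. \<integral>x. (H n x - h x)\<^sup>2 \<partial>lborel" 0] s by simp
  let ?f = "sqrt (\<integral>x. (f x)\<^sup>2 \<partial>lborel)" and ?h = "sqrt (\<integral>x. (h x)\<^sup>2 \<partial>lborel)"
  have bd: "norm ((\<integral>x. F n x * H n x \<partial>lborel) - (\<integral>x. f x * h x \<partial>lborel)) \<le> a n * b n + a n * ?h + ?f * b n" for n
  proof -
    have i: "integrable lborel (\<lambda>x. (F n x - f x) * (H n x - h x))" "integrable lborel (\<lambda>x. (F n x - f x) * h x)"
      "integrable lborel (\<lambda>x. f x * (H n x - h x))" "integrable lborel (\<lambda>x. F n x * H n x)" "integrable lborel (\<lambda>x. f x * h x)"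
      using s d by (auto intro: sq_int_mult)
    have "(\<integral>x. F n x * H n x \<partial>lborel) - (\<integral>x. f x * h x \<partial>lborel) = (\<integral>x. F n x * H n x - f x * h x \<partial>lborel)"
      using i by simp
    also have "(\<lambda>x. F n x * H n x - f x * h x) = (\<lambda>x. (F n x - f x) * (H n x - h x) + (F n x - f x) * h x + f x * (H n x - h x))"
      by (rule ext) (simp add: algebra_simps)
    also have "(\<integral>x. (F n x - f x) * (H n x - h x) + (F n x - f x) * h x + f x * (H n x - h x) \<partial>lborel)
      = (\<integral>x. (F n x - f x) * (H n x - h x) \<partial>lborel) + (\<integral>x. (F n x - f x) * h x \<partial>lborel) + (\<integral>x. f x * (H n x - h x) \<partial>lborel)"
      using i by simp
    finally show ?thesis
      using abs_integral_mult_le[OF d(1)[of n] d(2)[of n]] abs_integral_mult_le[OF d(1)[of n], of h]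
        abs_integral_mult_le[OF _ d(2)[of n], of f] s
      unfolding a_def b_def real_norm_def by linarith
  qed
  have "(\<lambda>n. a n * b n + a n * ?h + ?f * b n) \<longlonglongrightarrow> 0 * 0 + 0 * ?h + ?f * 0"
    by (rule tendsto_add[OF tendsto_add[OF tendsto_mult[OF a b] tendsto_mult[OF a tendsto_const]] tendsto_mult[OF tendsto_const b]])
  then have "(\<lambda>n. a n * b n + a n * ?h + ?f * b n) \<longlonglongrightarrow> 0" by simp
  then have "(\<lambda>n. (\<integral>x. F n x * H n x \<partial>lborel) - (\<integral>x. f x * h x \<partial>lborel)) \<longlonglongrightarrow> 0"
    by (rule Lim_null_comparison[OF always_eventually, OF allI, OF bd])
  then show ?thesis by (rule LIM_zero_cancel)
qed

lemma L2_tendsto_dominated: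
  assumes g: "sq_int g" and [measurable]: "\<And>n. F n \<in> borel_measurable borel" "f \<in> borel_measurable borel"
    and le: "\<And>n. AE x in lborel. \<bar>F n x\<bar> \<le> g x" and lim: "AE x in lborel. (\<lambda>n. F n x) \<longlonglongrightarrow> f x"
  shows "L2_tendsto F f"
proof -
  have [measurable]: "g \<in> borel_measurable borel" using g by (simp add: sq_int_def)
  have F: "sq_int (F n)" for n
  proof (rule sq_int_dominated[OF g, where C=1])
    show "AE x in lborel. \<bar>F n x\<bar> \<le> 1 * \<bar>g x\<bar>" using le[of n] by eventually_elim simp
  qed simp
  have all: "AE x in lborel. \<forall>n. \<bar>F n x\<bar> \<le> g x" using le by (simp add: AE_all_countable)
  have fle: "AE x in lborel. \<bar>f x\<bar> \<le> g x"
    using all lim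
  proof eventually_elim
    case (elim x)
    then show ?case by (intro LIMSEQ_le_const2[OF tendsto_rabs]) auto
  qed
  have f: "sq_int f"
  proof (rule sq_int_dominated[OF g, where C=1])
    show "AE x in lborel. \<bar>f x\<bar> \<le> 1 * \<bar>g x\<bar>" using fle by eventually_elim simp
  qed simp
  have "(\<lambda>n. \<integral>x. (F n x - f x)\<^sup>2 \<partial>lborel) \<longlonglongrightarrow> (\<integral>x. 0 \<partial>LB)"
  proof (rule integral_dominated_convergence[where w="\<lambda>x. 4 * (g x)\<^sup>2"])
    show "AE x in lborel. (\<lambda>n. (F n x - f x)\<^sup>2) \<longlonglongrightarrow> 0"
      using lim
    proof eventually_elim
      case (elim x)
      have "(\<lambda>n. (F n x - f x)\<^sup>2) \<longlonglongrightarrow> (f x - f x)\<^sup>2" by (intro tendsto_intros elim)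
      then show ?case by simp
    qed
    show "AE x in lborel. norm ((F n x - f x)\<^sup>2) \<le> 4 * (g x)\<^sup>2" for n
      using all fle
    proof eventually_elim
      case (elim x)
      then have "\<bar>F n x\<bar> \<le> g x" by blast
      then have "\<bar>F n x - f x\<bar> \<le> 2 * g x" using abs_triangle_ineq4[of "F n x" "f x"] elim(2) by linarith
      then have "\<bar>F n x - f x\<bar>\<^sup>2 \<le> (2 * g x)\<^sup>2" by (intro power_mono) auto
      then show ?case by (simp add: power_mult_distrib)
    qed
  qed (use g in \<open>auto simp: sq_int_def\<close>)
  then show ?thesis using F f by (simp add: L2_tendsto_def)
qed

lemma L2_tendsto_conv_mollifier: "sq_int f \<Longrightarrow> L2_tendsto (\<lambda>n. conv f (mollifier n)) f"
  by (simp add: L2_tendsto_def conv_mollifier_L2)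

lemma L2_tendsto_subseq: "L2_tendsto F f \<Longrightarrow> strict_mono r \<Longrightarrow> L2_tendsto (\<lambda>n. F (r n)) f"
  unfolding L2_tendsto_def using LIMSEQ_subseq_LIMSEQ[of "\<lambda>n. \<integral>x. (F n x - f x)\<^sup>2 \<partial>lborel" 0 r] by (simp add: o_def)

subsection \<open>Translation and Poincare estimates\<close>

definition dirichlet :: "(2 \<Rightarrow> plane \<Rightarrow> real) \<Rightarrow> real" where
  "dirichlet g = (\<Sum>j\<in>UNIV. \<integral>x. (g j x)\<^sup>2 \<partial>lborel)"

lemma dirichlet_nonneg: "dirichlet g \<ge> 0"
  by (simp add: dirichlet_def sum_nonneg)

text \<open>The fundamental theorem of calculus along the segment from \<open>x\<close> to
  \<open>x + h\<close>, followed by Cauchy-Schwarz in \<open>t\<close>. Stated with nonnegative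
  integrals so that it can be integrated in \<open>x\<close> before any integrability is
  known.\<close>

lemma increment_sq_le:
  fixes f :: "plane \<Rightarrow> real"
  assumes f: "smooth f"
  shows "ennreal ((f (x + h) - f x)\<^sup>2)
    \<le> (\<integral>\<^sup>+t. indicator {0..1} t * ennreal ((norm h)\<^sup>2 * (\<Sum>j\<in>UNIV. (partial_deriv j f (x + t *\<^sub>R h))\<^sup>2)) \<partial>lborel)"
proof -
  define g where "g t = (\<Sum>j\<in>UNIV. h $ j * partial_deriv j f (x + t *\<^sub>R h))" for t :: real
  have gc: "isCont g t" for t
    unfolding g_def by (intro continuous_intros isCont_o2[OF _ smooth_isCont[OF smooth_partial_deriv[OF f]]])
  have [measurable]: "g \<in> borel_measurable borel"
    by (intro borel_measurable_continuous_onI continuous_at_imp_continuous_on ballI gc)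
  have I: "(\<integral>t. g t * indicator {0..1} t \<partial>lborel) = f (x + h) - f x" and Ii: "integrable lborel (\<lambda>t. g t * indicator {0..1} t)"
    using integral_FTC_Icc_real[of 0 1 "\<lambda>t. f (x + t *\<^sub>R h)" g] smooth_ray_derivative[OF f, of x h] gc
      borel_integrable_atLeastAtMost[of 0 1 g]
    by (auto simp: g_def mult.commute)
  have "ennreal ((f (x + h) - f x)\<^sup>2) = (ennreal \<bar>f (x + h) - f x\<bar>)\<^sup>2"
    by (simp add: ennreal_power)
  also have "\<dots> \<le> (\<integral>\<^sup>+t. ennreal \<bar>g t\<bar> * indicator {0..1} t * indicator {0..1} t \<partial>lborel)\<^sup>2"
  proof (intro power_mono)
    have "ennreal \<bar>f (x + h) - f x\<bar> \<le> (\<integral>\<^sup>+t. ennreal (norm (g t * indicator {0..1} t)) \<partial>lborel)"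
      unfolding I[symmetric] using integral_norm_bound_ennreal[OF Ii] by simp
    also have "\<dots> = (\<integral>\<^sup>+t. ennreal \<bar>g t\<bar> * indicator {0..1} t * indicator {0..1} t \<partial>lborel)"
      by (intro nn_integral_cong) (simp add: indicator_def)
    finally show "ennreal \<bar>f (x + h) - f x\<bar> \<le> (\<integral>\<^sup>+t. ennreal \<bar>g t\<bar> * indicator {0..1} t * indicator {0..1} t \<partial>lborel)" .
  qed simp
  also have "\<dots> \<le> (\<integral>\<^sup>+t. (ennreal \<bar>g t\<bar> * indicator {0..1} t)\<^sup>2 \<partial>lborel) * (\<integral>\<^sup>+t. (indicator {0..1::real} t)\<^sup>2 \<partial>lborel)"
    by (rule Cauchy_Schwarz_nn_integral) measurable
  also have "(\<integral>\<^sup>+t. (indicator {0..1::real} t :: ennreal)\<^sup>2 \<partial>lborel) = (\<integral>\<^sup>+t. indicator {0..1::real} t \<partial>lborel)"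
    by (intro nn_integral_cong) (simp add: indicator_def)
  also have "\<dots> = 1" by simp
  also have "(\<integral>\<^sup>+t. (ennreal \<bar>g t\<bar> * indicator {0..1} t)\<^sup>2 \<partial>lborel) * 1
    \<le> (\<integral>\<^sup>+t. indicator {0..1} t * ennreal ((norm h)\<^sup>2 * (\<Sum>j\<in>UNIV. (partial_deriv j f (x + t *\<^sub>R h))\<^sup>2)) \<partial>lborel)"
    unfolding mult_1_right
  proof (rule nn_integral_mono)
    fix t :: real
    have "\<bar>g t\<bar> \<le> norm h * norm (\<chi> j. partial_deriv j f (x + t *\<^sub>R h))"
      unfolding g_def using Cauchy_Schwarz_ineq2[of h "\<chi> j. partial_deriv j f (x + t *\<^sub>R h)"] by (simp add: inner_vec_def)
    then have "\<bar>g t\<bar>\<^sup>2 \<le> (norm h * norm (\<chi> j. partial_deriv j f (x + t *\<^sub>R h)))\<^sup>2" by (intro power_mono) auto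
    also have "\<dots> = (norm h)\<^sup>2 * (\<Sum>j\<in>UNIV. (partial_deriv j f (x + t *\<^sub>R h))\<^sup>2)"
      unfolding power_mult_distrib norm_sq_plane[of "\<chi> j. partial_deriv j f (x + t *\<^sub>R h)"] by (simp add: power2_eq_square)
    finally show "(ennreal \<bar>g t\<bar> * indicator {0..1} t)\<^sup>2
      \<le> indicator {0..1} t * ennreal ((norm h)\<^sup>2 * (\<Sum>j\<in>UNIV. (partial_deriv j f (x + t *\<^sub>R h))\<^sup>2))"
      by (auto simp: indicator_def ennreal_power intro!: ennreal_leI)
  qed
  finally show ?thesis .
qed

text \<open>After exchanging the integrals, translation invariance makes the inner integral
  independent of \<open>t\<close>. The function \<open>f\<close> itself need not be square
  integrable; only its increment is.\<close>

lemma translation_bound: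
  fixes f :: "plane \<Rightarrow> real"
  assumes f: "smooth f" and fin: "\<And>j. sq_int (partial_deriv j f)"
  shows "(\<integral>\<^sup>+x. ennreal ((f (x + h) - f x)\<^sup>2) \<partial>lborel) \<le> ennreal ((norm h)\<^sup>2 * dirichlet (\<lambda>j. partial_deriv j f))"
proof -
  define k where "k x = (norm h)\<^sup>2 * (\<Sum>j\<in>UNIV. (partial_deriv j f x)\<^sup>2)" for x
  have pm [measurable]: "partial_deriv j f \<in> borel_measurable borel" for j
    by (rule smooth_measurable[OF smooth_partial_deriv[OF f]])
  have [measurable]: "k \<in> borel_measurable borel" unfolding k_def by measurable
  have ik: "integrable lborel k" unfolding k_def using fin by (simp add: sq_int_def)
  have K: "(\<integral>\<^sup>+x. ennreal (k x) \<partial>lborel) = ennreal ((norm h)\<^sup>2 * dirichlet (\<lambda>j. partial_deriv j f))"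
  proof (subst nn_integral_eq_integral[OF ik])
    show "AE x in lborel. 0 \<le> k x" by (simp add: k_def sum_nonneg)
    show "ennreal (integral\<^sup>L lborel k) = ennreal ((norm h)\<^sup>2 * dirichlet (\<lambda>j. partial_deriv j f))"
      unfolding k_def[abs_def] dirichlet_def using fin by (simp add: sq_int_def)
  qed
  have "(\<integral>\<^sup>+x. ennreal ((f (x + h) - f x)\<^sup>2) \<partial>lborel)
    \<le> (\<integral>\<^sup>+x. \<integral>\<^sup>+t. indicator {0..1} t * ennreal (k (x + t *\<^sub>R h)) \<partial>lborel \<partial>lborel)"
    unfolding k_def by (intro nn_integral_mono increment_sq_le f)
  also have "\<dots> = (\<integral>\<^sup>+t. \<integral>\<^sup>+x. indicator {0..1} t * ennreal (k (x + t *\<^sub>R h)) \<partial>lborel \<partial>lborel)"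
    by (rule lborel_pair.Fubini'[symmetric]) measurable
  also have "\<dots> = (\<integral>\<^sup>+t. indicator {0..1::real} t * ennreal ((norm h)\<^sup>2 * dirichlet (\<lambda>j. partial_deriv j f)) \<partial>lborel)"
  proof (intro nn_integral_cong)
    fix t :: real
    have "(\<integral>\<^sup>+x. indicator {0..1} t * ennreal (k (x + t *\<^sub>R h)) \<partial>lborel) = indicator {0..1} t * (\<integral>\<^sup>+x. ennreal (k (x + t *\<^sub>R h)) \<partial>lborel)"
      by (rule nn_integral_cmult) measurable
    also have "(\<integral>\<^sup>+x. ennreal (k (x + t *\<^sub>R h)) \<partial>lborel) = (\<integral>\<^sup>+x. ennreal (k x) \<partial>lborel)"
      by (rule nn_integral_translate) measurable
    finally show "(\<integral>\<^sup>+x. indicator {0..1} t * ennreal (k (x + t *\<^sub>R h)) \<partial>lborel)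
      = indicator {0..1} t * ennreal ((norm h)\<^sup>2 * dirichlet (\<lambda>j. partial_deriv j f))" unfolding K .
  qed
  also have "\<dots> = ennreal ((norm h)\<^sup>2 * dirichlet (\<lambda>j. partial_deriv j f))"
    by (subst nn_integral_multc) auto
  finally show ?thesis .
qed

definition average :: "plane set \<Rightarrow> (plane \<Rightarrow> real) \<Rightarrow> real" where
  "average A f = (\<integral>x. indicator A x * f x \<partial>lborel) / measure lborel A"

text \<open>The deviation from the average is bounded by the mean over \<open>y\<close> in
  \<open>A\<close> of the increments \<open>f x - f y\<close>, and these are controlled by
  \<open>translation_bound\<close> for shifts up to \<open>2 * S\<close>. The argument uses only the
  positive measure of \<open>A\<close>, which suits an arbitrary \<open>\<omega>\<close>.\<close>

lemma Poincare:
  fixes A :: "plane set"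
  assumes A [measurable]: "A \<in> sets borel" and sub: "A \<subseteq> cball 0 S" and pos: "measure lborel A > 0"
    and f: "smooth f" and fin: "\<And>j. sq_int (partial_deriv j f)"
  shows "(\<integral>x. indicator (cball 0 S) x * (f x - average A f)\<^sup>2 \<partial>lborel)
    \<le> measure LB (cball 0 (2 * S)) * (2 * S)\<^sup>2 / measure lborel A * dirichlet (\<lambda>j. partial_deriv j f)"
proof -
  define D where "D = dirichlet (\<lambda>j. partial_deriv j f)"
  define \<mu> where "\<mu> = measure lborel A"
  have D0: "D \<ge> 0" by (simp add: D_def dirichlet_nonneg)
  have fm [measurable]: "f \<in> borel_measurable borel" by (rule smooth_measurable[OF f])
  have finA: "emeasure lborel A < \<infinity>"
    using emeasure_mono[OF sub, of lborel] emeasure_lborel_cball_finite[of "0::plane" S] by (auto intro: le_less_trans)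
  have iA: "integrable lborel (\<lambda>y. indicator A y * g y)" if "continuous_on UNIV g" for g :: "plane \<Rightarrow> real"
    by (rule loc_int_indicator[OF continuous_loc_int[OF that] A sub])
  have fc: "continuous_on UNIV f" by (rule smooth_continuous[OF f])
  \<comment> \<open>Cauchy-Schwarz against the indicator of \<open>A\<close>: the squared mean of
    \<open>f x - f y\<close> over \<open>A\<close> is at most the mean of its square.\<close>
  have pt: "\<mu> * (f x - average A f)\<^sup>2 \<le> (\<integral>y. indicator A y * (f x - f y)\<^sup>2 \<partial>lborel)" for x
  proof -
    define g where "g y = indicator A y * (f x - f y)" for y
    have g2: "(g y)\<^sup>2 = indicator A y * (f x - f y)\<^sup>2" for y by (simp add: g_def indicator_def)
    have [measurable]: "g \<in> borel_measurable borel" unfolding g_def by measurable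
    have sg: "sq_int g" unfolding sq_int_def g2 by (intro conjI iA continuous_intros fc) simp
    have sA: "sq_int (indicator A)"
    proof -
      have "(\<lambda>y::plane. (indicator A y :: real)\<^sup>2) = (\<lambda>y. indicator A y * 1)" by (rule ext) (simp add: indicator_def)
      then show ?thesis unfolding sq_int_def by (simp only: iA continuous_on_const) measurable
    qed
    have "(\<integral>y. g y * indicator A y \<partial>lborel) = (\<integral>y. indicator A y * f x - indicator A y * f y \<partial>lborel)"
      by (intro Bochner_Integration.integral_cong) (auto simp: g_def indicator_def)
    also have "\<dots> = \<mu> * f x - \<mu> * average A f"
      using iA[of "\<lambda>_. f x"] iA[OF fc] pos by (simp add: \<mu>_def average_def)
    finally have "(\<integral>y. g y * indicator A y \<partial>lborel) = \<mu> * (f x - average A f)" by (simp add: right_diff_distrib)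
    moreover have "(\<integral>y. (indicator A y)\<^sup>2 \<partial>lborel) = \<mu>"
    proof -
      have "(\<integral>y. (indicator A y)\<^sup>2 \<partial>lborel) = (\<integral>y. (indicator A y :: real) \<partial>lborel)"
        by (intro Bochner_Integration.integral_cong) (auto simp: indicator_def)
      then show ?thesis by (simp add: \<mu>_def)
    qed
    ultimately have "(\<mu> * (f x - average A f))\<^sup>2 \<le> (\<integral>y. (g y)\<^sup>2 \<partial>lborel) * \<mu>"
      using Cauchy_Schwarz_sq_int[OF sg sA] by metis
    then have "\<mu> * (\<mu> * (f x - average A f)\<^sup>2) \<le> \<mu> * (\<integral>y. (g y)\<^sup>2 \<partial>lborel)"
      by (simp add: power2_eq_square mult_ac)
    then show ?thesis using pos unfolding g2 \<mu>_def by simp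
  qed
  have pt': "ennreal \<mu> * ennreal (indicator (cball 0 S) x * (f x - average A f)\<^sup>2)
    \<le> (\<integral>\<^sup>+y. ennreal (indicator (cball 0 S) x * indicator A y * (f x - f y)\<^sup>2) \<partial>lborel)" for x
  proof -
    have "ennreal \<mu> * ennreal (indicator (cball 0 S) x * (f x - average A f)\<^sup>2) = ennreal (indicator (cball 0 S) x * (\<mu> * (f x - average A f)\<^sup>2))"
      by (simp add: ennreal_mult[symmetric] \<mu>_def mult_ac)
    also have "\<dots> \<le> ennreal (indicator (cball 0 S) x * (\<integral>y. indicator A y * (f x - f y)\<^sup>2 \<partial>lborel))"
      by (intro ennreal_leI mult_left_mono pt) simp
    also have "\<dots> = ennreal (\<integral>y. indicator (cball 0 S) x * indicator A y * (f x - f y)\<^sup>2 \<partial>lborel)"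
      by (simp add: mult.assoc)
    also have "\<dots> = (\<integral>\<^sup>+y. ennreal (indicator (cball 0 S) x * indicator A y * (f x - f y)\<^sup>2) \<partial>lborel)"
    proof (rule nn_integral_eq_integral[symmetric])
      have "integrable lborel (\<lambda>y. indicator (cball 0 S) x * (indicator A y * (f x - f y)\<^sup>2))"
        by (intro integrable_mult_right iA continuous_intros fc)
      then show "integrable lborel (\<lambda>y. indicator (cball 0 S) x * indicator A y * (f x - f y)\<^sup>2)" by (simp add: mult.assoc)
    qed simp
    finally show ?thesis .
  qed
  have "ennreal \<mu> * (\<integral>\<^sup>+x. ennreal (indicator (cball 0 S) x * (f x - average A f)\<^sup>2) \<partial>lborel)
    = (\<integral>\<^sup>+x. ennreal \<mu> * ennreal (indicator (cball 0 S) x * (f x - average A f)\<^sup>2) \<partial>lborel)"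
    by (rule nn_integral_cmult[symmetric]) measurable
  also have "\<dots> \<le> (\<integral>\<^sup>+x. \<integral>\<^sup>+y. ennreal (indicator (cball 0 S) x * indicator A y * (f x - f y)\<^sup>2) \<partial>lborel \<partial>lborel)"
    by (intro nn_integral_mono pt')
  also have "\<dots> = (\<integral>\<^sup>+y. \<integral>\<^sup>+x. ennreal (indicator (cball 0 S) x * indicator A y * (f x - f y)\<^sup>2) \<partial>lborel \<partial>lborel)"
    by (rule lborel_pair.Fubini'[symmetric]) measurable
  \<comment> \<open>Substituting \<open>x = h + y\<close> makes the shift the integration variable;
    both points lie in the ball of radius \<open>S\<close>, so
    \<open>norm h \<le> 2 * S\<close>.\<close>
  also have "\<dots> = (\<integral>\<^sup>+y. \<integral>\<^sup>+h. ennreal (indicator (cball 0 S) (h + y) * indicator A y * (f (h + y) - f y)\<^sup>2) \<partial>lborel \<partial>lborel)"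
    by (intro nn_integral_cong nn_integral_translate[symmetric]) measurable
  also have "\<dots> \<le> (\<integral>\<^sup>+y. \<integral>\<^sup>+h. indicator (cball 0 (2 * S)) h * ennreal ((f (y + h) - f y)\<^sup>2) \<partial>lborel \<partial>lborel)"
  proof (intro nn_integral_mono)
    fix y h :: plane
    show "ennreal (indicator (cball 0 S) (h + y) * indicator A y * (f (h + y) - f y)\<^sup>2)
      \<le> indicator (cball 0 (2 * S)) h * ennreal ((f (y + h) - f y)\<^sup>2)"
    proof (cases "h + y \<in> cball 0 S \<and> y \<in> A")
      case True
      then have "norm h \<le> 2 * S" using norm_triangle_ineq4[of "h + y" y] sub by auto
      then show ?thesis using True by (simp add: add.commute)
    qed (auto simp: indicator_def)
  qed
  also have "\<dots> = (\<integral>\<^sup>+h. \<integral>\<^sup>+y. indicator (cball 0 (2 * S)) h * ennreal ((f (y + h) - f y)\<^sup>2) \<partial>lborel \<partial>lborel)"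
    by (rule lborel_pair.Fubini'[symmetric]) measurable
  also have "\<dots> \<le> (\<integral>\<^sup>+h. ennreal ((2 * S)\<^sup>2 * D) * indicator (cball 0 (2 * S)) (h::plane) \<partial>lborel)"
  proof (rule nn_integral_mono)
    fix h :: plane
    have "(\<integral>\<^sup>+y. indicator (cball 0 (2 * S)) h * ennreal ((f (y + h) - f y)\<^sup>2) \<partial>lborel)
      = indicator (cball 0 (2 * S)) h * (\<integral>\<^sup>+y. ennreal ((f (y + h) - f y)\<^sup>2) \<partial>lborel)"
      by (rule nn_integral_cmult) measurable
    also have "\<dots> \<le> indicator (cball 0 (2 * S)) h * ennreal ((norm h)\<^sup>2 * D)"
      unfolding D_def by (intro mult_left_mono translation_bound f fin) simp
    also have "\<dots> \<le> ennreal ((2 * S)\<^sup>2 * D) * indicator (cball 0 (2 * S)) h"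
    proof (cases "norm h \<le> 2 * S")
      case True
      then have "(norm h)\<^sup>2 * D \<le> (2 * S)\<^sup>2 * D" using D0 by (intro mult_right_mono power_mono) auto
      then show ?thesis using True by (simp add: ennreal_leI del: power_mult_distrib)
    qed simp
    finally show "(\<integral>\<^sup>+y. indicator (cball 0 (2 * S)) h * ennreal ((f (y + h) - f y)\<^sup>2) \<partial>lborel)
      \<le> ennreal ((2 * S)\<^sup>2 * D) * indicator (cball 0 (2 * S)) h" .
  qed
  also have "\<dots> = ennreal ((2 * S)\<^sup>2 * D) * ennreal (measure LB (cball 0 (2 * S)))"
    using emeasure_lborel_cball_finite[of "0::plane" "2 * S"]
    by (simp add: nn_integral_cmult_indicator emeasure_eq_ennreal_measure less_top)
  also have "\<dots> = ennreal ((2 * S)\<^sup>2 * D * measure LB (cball 0 (2 * S)))"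
    using D0 by (simp add: ennreal_mult)
  finally have e: "ennreal \<mu> * (\<integral>\<^sup>+x. ennreal (indicator (cball 0 S) x * (f x - average A f)\<^sup>2) \<partial>lborel)
    \<le> ennreal ((2 * S)\<^sup>2 * D * measure LB (cball 0 (2 * S)))" .
  have "integrable lborel (\<lambda>x. indicator (cball 0 S) x * (f x - average A f)\<^sup>2)"
    by (intro continuous_ball_integrable continuous_intros fc)
  then have "(\<integral>\<^sup>+x. ennreal (indicator (cball 0 S) x * (f x - average A f)\<^sup>2) \<partial>lborel)
    = ennreal (\<integral>x. indicator (cball 0 S) x * (f x - average A f)\<^sup>2 \<partial>lborel)"
    by (rule nn_integral_eq_integral) simp
  with e have "ennreal (\<mu> * (\<integral>x. indicator (cball 0 S) x * (f x - average A f)\<^sup>2 \<partial>lborel)) \<le> ennreal ((2 * S)\<^sup>2 * D * measure LB (cball 0 (2 * S)))"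
    using pos by (simp add: ennreal_mult \<mu>_def)
  then have "\<mu> * (\<integral>x. indicator (cball 0 S) x * (f x - average A f)\<^sup>2 \<partial>lborel) \<le> (2 * S)\<^sup>2 * D * measure LB (cball 0 (2 * S))"
    using D0 by (simp add: ennreal_le_iff)
  then show ?thesis using pos unfolding \<mu>_def[symmetric] D_def[symmetric] by (simp add: field_simps)
qed

text \<open>\<open>log_Hardy\<close> is applied to \<open>f\<close> minus its average. The ball term
  it leaves is removed by the Poincare estimate, so only the gradient remains on the right.\<close>

lemma log_Hardy_average:
  fixes A :: "plane set"
  assumes A: "A \<in> sets borel" "bounded A" "measure lborel A > 0"
  shows "\<exists>C>0. \<forall>f. smooth f \<longrightarrow> (\<forall>j. sq_int (partial_deriv j f)) \<longrightarrow>
    sq_int (\<lambda>x. log_weight x * (f x - average A f)) \<and> (\<integral>x. (log_weight x * (f x - average A f))\<^sup>2 \<partial>lborel) \<le> C * dirichlet (\<lambda>j. partial_deriv j f)"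
proof -
  obtain S0 where "\<forall>x\<in>A. norm x \<le> S0" using A(2) bounded_iff by blast
  then have S0: "A \<subseteq> cball 0 S0" by auto
  \<comment> \<open>The ball must contain both \<open>A\<close> and the ball of radius 4 from
    \<open>log_Hardy\<close>.\<close>
  define S where "S = max S0 4"
  have S: "A \<subseteq> cball 0 S" "S \<ge> 4" using S0 by (auto simp: S_def)
  define C where "C = 8 + 8 * (measure LB (cball 0 (2 * S)) * (2 * S)\<^sup>2 / measure lborel A)"
  show ?thesis
  proof (intro exI[of _ C] conjI allI impI)
    show "C > 0" using A(3) by (simp add: C_def add_pos_nonneg)
    fix f :: "plane \<Rightarrow> real" assume f: "smooth f" and fin': "\<forall>j. sq_int (partial_deriv j f)"
    have fin: "sq_int (partial_deriv j f)" for j using fin' by blast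
    define g where "g x = f x - average A f" for x
    have g: "smooth g" unfolding g_def[abs_def] by (intro smooth_diff_fun f smooth_const)
    have pg: "partial_deriv j g = partial_deriv j f" for j
      unfolding g_def[abs_def] by (simp add: partial_deriv_diff[OF f smooth_const])
    have fing: "sq_int (partial_deriv j g)" for j unfolding pg by (rule fin)
    note H = log_Hardy[OF g fing]
    have i: "integrable lborel (\<lambda>x. indicator (cball 0 R) x * (g x)\<^sup>2)" for R
      by (intro continuous_ball_integrable continuous_intros smooth_continuous[OF g])
    have "(\<integral>x. indicator (cball 0 4) x * (g x)\<^sup>2 \<partial>lborel) \<le> (\<integral>x. indicator (cball 0 S) x * (g x)\<^sup>2 \<partial>lborel)"
      using S(2) by (intro integral_mono i mult_right_mono) (auto simp: indicator_def)
    also have "\<dots> \<le> measure LB (cball 0 (2 * S)) * (2 * S)\<^sup>2 / measure lborel A * dirichlet (\<lambda>j. partial_deriv j f)"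
      unfolding g_def by (rule Poincare[OF A(1) S(1) A(3) f fin])
    finally have "(\<integral>x. (log_weight x * g x)\<^sup>2 \<partial>lborel) \<le> C * dirichlet (\<lambda>j. partial_deriv j f)"
      using H(2) unfolding pg dirichlet_def[symmetric] C_def by (simp add: distrib_right)
    then show "(\<integral>x. (log_weight x * (f x - average A f))\<^sup>2 \<partial>lborel) \<le> C * dirichlet (\<lambda>j. partial_deriv j f)"
      unfolding g_def .
    show "sq_int (\<lambda>x. log_weight x * (f x - average A f))" using H(1) unfolding g_def .
  qed
qed

subsection \<open>Weak gradients\<close>

definition weak_gradient :: "(plane \<Rightarrow> real) \<Rightarrow> (2 \<Rightarrow> plane \<Rightarrow> real) \<Rightarrow> bool" where
  "weak_gradient f g \<longleftrightarrow> loc_int f \<and> (\<forall>j. loc_int (g j)) \<and> (\<forall>\<eta> j. test_function \<eta> \<longrightarrow>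
     (\<integral>x. f x * partial_deriv j \<eta> x \<partial>lborel) = - (\<integral>x. g j x * \<eta> x \<partial>lborel))"

lemma weak_gradient_conv:
  assumes w: "weak_gradient f g" and t: "test_function \<eta>"
  shows "partial_deriv j (conv f \<eta>) = conv (g j) \<eta>"
proof
  fix x
  have l: "loc_int f" using w by (simp add: weak_gradient_def)
  have sm: "smooth \<eta>" by (rule test_function_smooth[OF t])
  have "partial_deriv j (conv f \<eta>) x = (\<integral>y. f y * partial_deriv j \<eta> (x - y) \<partial>lborel)"
    by (simp add: partial_deriv_conv[OF l t] conv_def)
  also have "\<dots> = - (\<integral>y. f y * partial_deriv j (\<lambda>y. \<eta> (x - y)) y \<partial>lborel)"
    by (simp add: partial_deriv_reflect(2)[OF smooth_diff[OF sm]])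
  also have "\<dots> = conv (g j) \<eta> x"
    using w test_function_reflect[OF t, of x] by (simp add: weak_gradient_def conv_def)
  finally show "partial_deriv j (conv f \<eta>) x = conv (g j) \<eta> x" .
qed

lemma weak_gradient_diff:
  assumes "weak_gradient f g" "weak_gradient f' g'" shows "weak_gradient (\<lambda>x. f x - f' x) (\<lambda>j x. g j x - g' j x)"
proof -
  have i: "integrable lborel (\<lambda>x. h x * \<eta> x)" if "loc_int h" "test_function \<eta>" for h \<eta>
    using that by (rule loc_int_mult_test)
  note i' = i[OF _ test_function_partial_deriv]
  show ?thesis
    unfolding weak_gradient_def
  proof (intro conjI allI impI)
    show "loc_int (\<lambda>x. f x - f' x)" "loc_int (\<lambda>x. g j x - g' j x)" for j
      using assms by (auto simp: weak_gradient_def loc_int_diff)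
    fix \<eta> :: "plane \<Rightarrow> real" and j assume t: "test_function \<eta>"
    have l: "loc_int f" "loc_int f'" "loc_int (g j)" "loc_int (g' j)" using assms by (auto simp: weak_gradient_def)
    have "(\<integral>x. f x * partial_deriv j \<eta> x \<partial>lborel) = - (\<integral>x. g j x * \<eta> x \<partial>lborel)"
      "(\<integral>x. f' x * partial_deriv j \<eta> x \<partial>lborel) = - (\<integral>x. g' j x * \<eta> x \<partial>lborel)"
      using assms t by (auto simp: weak_gradient_def)
    then show "(\<integral>x. (f x - f' x) * partial_deriv j \<eta> x \<partial>lborel) = - (\<integral>x. (g j x - g' j x) * \<eta> x \<partial>lborel)"
      using i[OF l(3) t] i[OF l(4) t] i'[OF l(1) t] i'[OF l(2) t] by (simp add: left_diff_distrib)
  qed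
qed

lemma weak_gradient_const: "weak_gradient (\<lambda>_. c) (\<lambda>_ _. 0)"
  unfolding weak_gradient_def using integral_by_parts_test[OF _ smooth_const[of c]] by (simp add: loc_int_const)

lemma L2_tendsto_weak_gradient_conv:
  assumes "weak_gradient f g" "sq_int (g j)"
  shows "L2_tendsto (\<lambda>n. partial_deriv j (conv f (mollifier n))) (g j)"
  unfolding weak_gradient_conv[OF assms(1) mollifier_test] by (rule L2_tendsto_conv_mollifier[OF assms(2)])

lemma AE_subseq_L1:
  fixes u :: "nat \<Rightarrow> plane \<Rightarrow> real"
  assumes "\<And>n. integrable lborel (u n)" "(\<lambda>n. \<integral>x. \<bar>u n x\<bar> \<partial>lborel) \<longlonglongrightarrow> 0"
  obtains r where "strict_mono r" "AE x in lborel. (\<lambda>n. u (r n) x) \<longlonglongrightarrow> 0"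
proof -
  have "(\<lambda>n. \<integral>x. norm (u n x) \<partial>lborel) \<longlonglongrightarrow> 0" using assms(2) by (simp only: real_norm_def)
  from tendsto_L1_AE_subseq[OF assms(1) this] obtain r where "strict_mono r" "AE x in lborel. (\<lambda>n. u (r n) x) \<longlonglongrightarrow> 0"
    by metis
  then show thesis by (rule that)
qed

text \<open>Mollification carries the inequality from smooth to weakly differentiable functions with
  the same constant. Gradients converge in \<open>L^2\<close>, but the functions themselves only in
  \<open>L^1\<close> on bounded sets; this is enough for the averages over \<open>A\<close> and,
  along subsequences, for Fatou's lemma.\<close>

lemma log_Hardy_weak:
  fixes A :: "plane set"
  assumes A: "A \<in> sets borel" "bounded A" "measure lborel A > 0"
  shows "\<exists>C>0. \<forall>f g. weak_gradient f g \<longrightarrow> (\<forall>j. sq_int (g j)) \<longrightarrow>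
    sq_int (\<lambda>x. log_weight x * (f x - average A f)) \<and> (\<integral>x. (log_weight x * (f x - average A f))\<^sup>2 \<partial>lborel) \<le> C * dirichlet g"
proof -
  obtain C where C: "C > 0" "\<And>f. smooth f \<Longrightarrow> (\<And>j. sq_int (partial_deriv j f)) \<Longrightarrow>
    sq_int (\<lambda>x. log_weight x * (f x - average A f)) \<and> (\<integral>x. (log_weight x * (f x - average A f))\<^sup>2 \<partial>lborel) \<le> C * dirichlet (\<lambda>j. partial_deriv j f)"
    using log_Hardy_average[OF A] by blast
  have [measurable]: "A \<in> sets borel" by fact
  obtain S where "\<forall>x\<in>A. norm x \<le> S" using A(2) bounded_iff by blast
  then have S: "A \<subseteq> cball 0 S" by auto
  have "sq_int (\<lambda>x. log_weight x * (f x - average A f)) \<and> (\<integral>x. (log_weight x * (f x - average A f))\<^sup>2 \<partial>lborel) \<le> C * dirichlet g"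
    if w: "weak_gradient f g" and gi: "\<And>j. sq_int (g j)" for f g
  proof -
    have l: "loc_int f" using w by (simp add: weak_gradient_def)
    have [measurable]: "f \<in> borel_measurable borel" by (rule loc_int_measurable[OF l])
    define F where "F n = conv f (mollifier n)" for n
    have Fs: "smooth (F n)" for n unfolding F_def by (rule smooth_conv[OF l mollifier_test])
    have [measurable]: "F n \<in> borel_measurable borel" for n by (rule smooth_measurable[OF Fs])
    have Fg: "L2_tendsto (\<lambda>n. partial_deriv j (F n)) (g j)" for j unfolding F_def by (rule L2_tendsto_weak_gradient_conv[OF w gi])
    then have Fi: "sq_int (partial_deriv j (F n))" for j n by (simp add: L2_tendsto_def)
    have D: "(\<lambda>n. dirichlet (\<lambda>j. partial_deriv j (F n))) \<longlonglongrightarrow> dirichlet g"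
      unfolding dirichlet_def power2_eq_square by (intro tendsto_sum L2_tendsto_inner Fg)
    have iR: "integrable lborel (\<lambda>x. indicator (cball 0 R) x * (F n x - f x))" for n R
      using loc_int_diff[OF continuous_loc_int[OF smooth_continuous[OF Fs]] l] by (simp add: loc_int_def)
    have L1: "(\<lambda>n. \<integral>x. \<bar>indicator (cball 0 R) x * (F n x - f x)\<bar> \<partial>lborel) \<longlonglongrightarrow> 0" for R
      unfolding F_def by (rule conv_mollifier_L1_loc[OF l])
    note iA = loc_int_indicator[OF _ A(1) S]
    have m: "(\<lambda>n. average A (F n)) \<longlonglongrightarrow> average A f"
    proof -
      have "norm ((\<integral>x. indicator A x * F n x \<partial>lborel) - (\<integral>x. indicator A x * f x \<partial>lborel))
        \<le> (\<integral>x. \<bar>indicator (cball 0 S) x * (F n x - f x)\<bar> \<partial>lborel)" for n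
      proof -
        note ii = iA[OF continuous_loc_int[OF smooth_continuous[OF Fs]], of n] iA[OF l]
        have "(\<integral>x. indicator A x * F n x \<partial>lborel) - (\<integral>x. indicator A x * f x \<partial>lborel) = (\<integral>x. indicator A x * F n x - indicator A x * f x \<partial>lborel)"
          using ii by simp
        also have "norm \<dots> \<le> (\<integral>x. \<bar>indicator (cball 0 S) x * (F n x - f x)\<bar> \<partial>lborel)"
        proof (rule Bochner_Integration.integral_norm_bound_integral)
          show "norm (indicator A x * F n x - indicator A x * f x) \<le> \<bar>indicator (cball 0 S) x * (F n x - f x)\<bar>" for x
            using S by (auto simp: indicator_def)
        qed (use ii iR[of S n] in auto)
        finally show ?thesis .
      qed
      then have "(\<lambda>n. (\<integral>x. indicator A x * F n x \<partial>lborel) - (\<integral>x. indicator A x * f x \<partial>lborel)) \<longlonglongrightarrow> 0"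
        by (intro Lim_null_comparison[OF always_eventually L1[of S]]) auto
      then have "(\<lambda>n. \<integral>x. indicator A x * F n x \<partial>lborel) \<longlonglongrightarrow> (\<integral>x. indicator A x * f x \<partial>lborel)"
        by (rule LIM_zero_cancel)
      then show ?thesis unfolding average_def by (intro tendsto_divide tendsto_const) (use A(3) in auto)
    qed
    \<comment> \<open>The subsequence converging almost everywhere depends on the ball, the bound
      does not. A second use of Fatou's lemma over growing balls therefore gives the global
      estimate.\<close>
    have ball: "(\<integral>\<^sup>+x. indicator (cball 0 R) x * ennreal ((log_weight x * (f x - average A f))\<^sup>2) \<partial>lborel) \<le> ennreal (C * dirichlet g)" for R
    proof -
      obtain r where r: "strict_mono r" "AE x in lborel. (\<lambda>n. indicator (cball 0 R) x * (F (r n) x - f x)) \<longlonglongrightarrow> 0"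
        by (rule AE_subseq_L1[OF iR L1])
      have "(\<integral>\<^sup>+x. indicator (cball 0 R) x * ennreal ((log_weight x * (f x - average A f))\<^sup>2) \<partial>lborel)
        \<le> (\<integral>\<^sup>+x. liminf (\<lambda>n. ennreal ((log_weight x * (F (r n) x - average A (F (r n))))\<^sup>2)) \<partial>lborel)"
      proof (rule nn_integral_mono_AE)
        show "AE x in lborel. indicator (cball 0 R) x * ennreal ((log_weight x * (f x - average A f))\<^sup>2)
          \<le> liminf (\<lambda>n. ennreal ((log_weight x * (F (r n) x - average A (F (r n))))\<^sup>2))"
          using r(2)
        proof eventually_elim
          case (elim x)
          show ?case
          proof (cases "x \<in> cball 0 R")
            case True
            have "(\<lambda>n. F (r n) x - f x) \<longlonglongrightarrow> 0" using elim True by simp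
            then have "(\<lambda>n. F (r n) x) \<longlonglongrightarrow> f x" by (rule LIM_zero_cancel)
            moreover have "(\<lambda>n. average A (F (r n))) \<longlonglongrightarrow> average A f" using LIMSEQ_subseq_LIMSEQ[OF m r(1)] by (simp add: o_def)
            ultimately have "(\<lambda>n. ennreal ((log_weight x * (F (r n) x - average A (F (r n))))\<^sup>2)) \<longlonglongrightarrow> ennreal ((log_weight x * (f x - average A f))\<^sup>2)"
              by (intro tendsto_ennrealI tendsto_intros)
            from lim_imp_Liminf[OF _ this] show ?thesis using True by simp
          qed simp
        qed
      qed
      also have "\<dots> \<le> liminf (\<lambda>n. \<integral>\<^sup>+x. ennreal ((log_weight x * (F (r n) x - average A (F (r n))))\<^sup>2) \<partial>lborel)"
        by (rule nn_integral_liminf) measurable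
      also have "\<dots> \<le> liminf (\<lambda>n. ennreal (C * dirichlet (\<lambda>j. partial_deriv j (F (r n)))))"
      proof (intro Liminf_mono always_eventually allI)
        fix n
        have "integrable lborel (\<lambda>x. (log_weight x * (F (r n) x - average A (F (r n))))\<^sup>2)"
          using C(2)[OF Fs Fi, of "r n"] by (simp add: sq_int_def)
        then have "(\<integral>\<^sup>+x. ennreal ((log_weight x * (F (r n) x - average A (F (r n))))\<^sup>2) \<partial>lborel)
          = ennreal (\<integral>x. (log_weight x * (F (r n) x - average A (F (r n))))\<^sup>2 \<partial>lborel)" by (rule nn_integral_eq_integral) simp
        also have "\<dots> \<le> ennreal (C * dirichlet (\<lambda>j. partial_deriv j (F (r n))))"
          using C(2)[OF Fs Fi, of "r n"] by (intro ennreal_leI) simp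
        finally show "(\<integral>\<^sup>+x. ennreal ((log_weight x * (F (r n) x - average A (F (r n))))\<^sup>2) \<partial>lborel) \<le> ennreal (C * dirichlet (\<lambda>j. partial_deriv j (F (r n))))" .
      qed
      also have "\<dots> = ennreal (C * dirichlet g)"
      proof (rule lim_imp_Liminf)
        show "(\<lambda>n. ennreal (C * dirichlet (\<lambda>j. partial_deriv j (F (r n))))) \<longlonglongrightarrow> ennreal (C * dirichlet g)"
          using LIMSEQ_subseq_LIMSEQ[OF D r(1)] by (intro tendsto_ennrealI tendsto_mult tendsto_const) (simp add: o_def)
      qed simp
      finally show ?thesis .
    qed
    have "(\<integral>\<^sup>+x. ennreal ((log_weight x * (f x - average A f))\<^sup>2) \<partial>lborel)
      = (\<integral>\<^sup>+x. liminf (\<lambda>n. indicator (cball 0 (real n)) x * ennreal ((log_weight x * (f x - average A f))\<^sup>2)) \<partial>lborel)"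
    proof (rule nn_integral_cong)
      fix x :: plane
      obtain N where N: "norm x \<le> real N" using real_arch_simple by blast
      have "\<forall>\<^sub>F n in sequentially. indicator (cball 0 (real n)) x * ennreal ((log_weight x * (f x - average A f))\<^sup>2) = ennreal ((log_weight x * (f x - average A f))\<^sup>2)"
        using N by (intro eventually_sequentiallyI[of N]) simp
      then have "(\<lambda>n. indicator (cball 0 (real n)) x * ennreal ((log_weight x * (f x - average A f))\<^sup>2)) \<longlonglongrightarrow> ennreal ((log_weight x * (f x - average A f))\<^sup>2)"
        by (rule tendsto_eventually)
      from lim_imp_Liminf[OF _ this] show "ennreal ((log_weight x * (f x - average A f))\<^sup>2)
        = liminf (\<lambda>n. indicator (cball 0 (real n)) x * ennreal ((log_weight x * (f x - average A f))\<^sup>2))" by simp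
    qed
    also have "\<dots> \<le> liminf (\<lambda>n. \<integral>\<^sup>+x. indicator (cball 0 (real n)) x * ennreal ((log_weight x * (f x - average A f))\<^sup>2) \<partial>lborel)"
      by (rule nn_integral_liminf) measurable
    also have "\<dots> \<le> liminf (\<lambda>n::nat. ennreal (C * dirichlet g))"
      by (intro Liminf_mono always_eventually allI ball)
    finally have fin: "(\<integral>\<^sup>+x. ennreal ((log_weight x * (f x - average A f))\<^sup>2) \<partial>lborel) \<le> ennreal (C * dirichlet g)"
      by (simp add: Liminf_const)
    have i: "integrable lborel (\<lambda>x. (log_weight x * (f x - average A f))\<^sup>2)"
      using order_le_less_trans[OF fin] by (intro integrableI_nonneg) auto
    have "(\<integral>x. (log_weight x * (f x - average A f))\<^sup>2 \<partial>lborel) \<le> C * dirichlet g"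
      using fin C(1) dirichlet_nonneg[of g] by (subst (asm) nn_integral_eq_integral[OF i]) (auto simp: ennreal_le_iff)
    then show "sq_int (\<lambda>x. log_weight x * (f x - average A f)) \<and> (\<integral>x. (log_weight x * (f x - average A f))\<^sup>2 \<partial>lborel) \<le> C * dirichlet g"
      using i by (simp add: sq_int_def)
  qed
  then show ?thesis using C(1) by blast
qed

text \<open>The average over the unit ball may be added back, because the weight is itself square
  integrable.\<close>

lemma sq_int_log_weight_mult_weak_gradient:
  assumes "weak_gradient f g" "\<And>j. sq_int (g j)"
  shows "sq_int (\<lambda>x. log_weight x * f x)"
proof -
  have "measure LB (cball 0 1) > 0" using content_cball_pos[of 1 "0::plane"] by simp
  then obtain C where "sq_int (\<lambda>x. log_weight x * (f x - average (cball 0 1) f))"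
    using log_Hardy_weak[OF cball_borel bounded_cball] assms by blast
  from sq_int_add[OF this sq_int_cmult[OF sq_int_log_weight, of "average (cball 0 1) f"]]
  show ?thesis by (simp add: algebra_simps)
qed

subsection \<open>Symmetry of second derivatives and potentials\<close>

lemma axis_ray_derivative:
  fixes f :: "plane \<Rightarrow> real"
  assumes "smooth f"
  shows "((\<lambda>t. f (z + t *\<^sub>R axis j 1)) has_real_derivative partial_deriv j f (z + t *\<^sub>R axis j 1)) (at t)"
  using smooth_ray_derivative[OF assms, of z "axis j 1" t UNIV]
  by (simp add: axis_def if_distrib[of "\<lambda>x. x * _"] cong: if_cong)

text \<open>Two uses of the mean value theorem: for the difference in direction \<open>j\<close> as
  a function of the step in direction \<open>i\<close>, then for the derivative in direction
  \<open>i\<close> along \<open>j\<close>.\<close>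

lemma second_difference:
  fixes f :: "plane \<Rightarrow> real"
  assumes f: "smooth f" and r: "r > 0"
  shows "\<exists>p. norm (p - x) \<le> 2 * r \<and>
    f (x + r *\<^sub>R axis i 1 + r *\<^sub>R axis j 1) - f (x + r *\<^sub>R axis i 1) - f (x + r *\<^sub>R axis j 1) + f x
      = r\<^sup>2 * partial_deriv j (partial_deriv i f) p"
proof -
  let ?i = "axis i 1 :: plane" and ?j = "axis j 1 :: plane"
  define g where "g s = f (x + r *\<^sub>R ?j + s *\<^sub>R ?i) - f (x + s *\<^sub>R ?i)" for s
  have "(g has_real_derivative partial_deriv i f (x + r *\<^sub>R ?j + s *\<^sub>R ?i) - partial_deriv i f (x + s *\<^sub>R ?i)) (at s)" for s
    unfolding g_def by (intro DERIV_diff axis_ray_derivative f)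
  from MVT2[OF r this] obtain s where s: "0 < s" "s < r"
    "g r - g 0 = (r - 0) * (partial_deriv i f (x + r *\<^sub>R ?j + s *\<^sub>R ?i) - partial_deriv i f (x + s *\<^sub>R ?i))" by blast
  from MVT2[OF r axis_ray_derivative[OF smooth_partial_deriv[OF f], of i "x + s *\<^sub>R ?i" j]]
  obtain t where t: "0 < t" "t < r"
    "partial_deriv i f (x + s *\<^sub>R ?i + r *\<^sub>R ?j) - partial_deriv i f (x + s *\<^sub>R ?i + 0 *\<^sub>R ?j)
      = (r - 0) * partial_deriv j (partial_deriv i f) (x + s *\<^sub>R ?i + t *\<^sub>R ?j)" by blast
  show ?thesis
  proof (intro exI conjI)
    show "norm (x + s *\<^sub>R ?i + t *\<^sub>R ?j - x) \<le> 2 * r"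
      using norm_triangle_ineq[of "s *\<^sub>R ?i" "t *\<^sub>R ?j"] s t by simp
    have "g r - g 0 = r\<^sup>2 * partial_deriv j (partial_deriv i f) (x + s *\<^sub>R ?i + t *\<^sub>R ?j)"
      using s(3) t(3) by (simp add: power2_eq_square algebra_simps)
    then show "f (x + r *\<^sub>R ?i + r *\<^sub>R ?j) - f (x + r *\<^sub>R ?i) - f (x + r *\<^sub>R ?j) + f x
      = r\<^sup>2 * partial_deriv j (partial_deriv i f) (x + s *\<^sub>R ?i + t *\<^sub>R ?j)"
      by (simp add: g_def algebra_simps)
  qed
qed

text \<open>The second difference is symmetric in the two directions, so both mixed derivatives take
  a common value at points \<open>p\<close> and \<open>q\<close> within \<open>2 * r\<close> of
  \<open>x\<close>; continuity gives equality in the limit.\<close>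

lemma partial_deriv_commute:
  fixes f :: "plane \<Rightarrow> real"
  assumes f: "smooth f"
  shows "partial_deriv i (partial_deriv j f) = partial_deriv j (partial_deriv i f)"
proof
  fix x
  let ?r = "\<lambda>n. inverse (real (Suc n))"
  have r: "?r n > 0" for n by simp
  have "\<forall>n. \<exists>p q. norm (p - x) \<le> 2 * ?r n \<and> norm (q - x) \<le> 2 * ?r n \<and>
    partial_deriv j (partial_deriv i f) p = partial_deriv i (partial_deriv j f) q"
  proof
    fix n
    obtain p where p: "norm (p - x) \<le> 2 * ?r n"
      "f (x + ?r n *\<^sub>R axis i 1 + ?r n *\<^sub>R axis j 1) - f (x + ?r n *\<^sub>R axis i 1) - f (x + ?r n *\<^sub>R axis j 1) + f x
      = (?r n)\<^sup>2 * partial_deriv j (partial_deriv i f) p" using second_difference[OF f r] by blast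
    obtain q where q: "norm (q - x) \<le> 2 * ?r n"
      "f (x + ?r n *\<^sub>R axis j 1 + ?r n *\<^sub>R axis i 1) - f (x + ?r n *\<^sub>R axis j 1) - f (x + ?r n *\<^sub>R axis i 1) + f x
      = (?r n)\<^sup>2 * partial_deriv i (partial_deriv j f) q" using second_difference[OF f r] by blast
    have "f (x + ?r n *\<^sub>R axis j 1 + ?r n *\<^sub>R axis i 1) = f (x + ?r n *\<^sub>R axis i 1 + ?r n *\<^sub>R axis j 1)"
      by (simp add: add.assoc add.commute[of "_ *\<^sub>R axis j 1"])
    then have "(?r n)\<^sup>2 * partial_deriv j (partial_deriv i f) p = (?r n)\<^sup>2 * partial_deriv i (partial_deriv j f) q"
      using p(2) q(2) by linarith
    then have "partial_deriv j (partial_deriv i f) p = partial_deriv i (partial_deriv j f) q"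
      using r[of n] by (metis mult_left_cancel less_irrefl zero_less_power)
    with p(1) q(1) show "\<exists>p q. norm (p - x) \<le> 2 * ?r n \<and> norm (q - x) \<le> 2 * ?r n \<and>
      partial_deriv j (partial_deriv i f) p = partial_deriv i (partial_deriv j f) q" by blast
  qed
  then obtain p q where pq: "\<And>n. norm (p n - x) \<le> 2 * ?r n" "\<And>n. norm (q n - x) \<le> 2 * ?r n"
    "\<And>n. partial_deriv j (partial_deriv i f) (p n) = partial_deriv i (partial_deriv j f) (q n)" by metis
  have z: "(\<lambda>n. 2 * ?r n) \<longlonglongrightarrow> 0" using tendsto_mult[OF tendsto_const LIMSEQ_inverse_real_of_nat, of 2] by simp
  have "\<forall>\<^sub>F n in sequentially. norm (p n - x) \<le> 2 * ?r n" by (intro always_eventually allI pq(1))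
  then have p: "p \<longlonglongrightarrow> x" by (rule LIM_zero_cancel[OF Lim_null_comparison[OF _ z]])
  have "\<forall>\<^sub>F n in sequentially. norm (q n - x) \<le> 2 * ?r n" by (intro always_eventually allI pq(2))
  then have q: "q \<longlonglongrightarrow> x" by (rule LIM_zero_cancel[OF Lim_null_comparison[OF _ z]])
  have "(\<lambda>n. partial_deriv j (partial_deriv i f) (p n)) \<longlonglongrightarrow> partial_deriv j (partial_deriv i f) x"
    by (rule isCont_tendsto_compose[OF smooth_isCont[OF smooth_partial_deriv[OF smooth_partial_deriv[OF f]]] p])
  moreover have "(\<lambda>n. partial_deriv i (partial_deriv j f) (q n)) \<longlonglongrightarrow> partial_deriv i (partial_deriv j f) x"
    by (rule isCont_tendsto_compose[OF smooth_isCont[OF smooth_partial_deriv[OF smooth_partial_deriv[OF f]]] q])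
  ultimately show "partial_deriv i (partial_deriv j f) x = partial_deriv j (partial_deriv i f) x"
    unfolding pq(3) by (rule LIMSEQ_unique[rotated])
qed

text \<open>The Poincare lemma on the plane, which is star-shaped about 0: the potential is the
  integral of \<open>x . b(t x)\<close> over \<open>t\<close> from 0 to 1, differentiated under the
  integral sign.\<close>

lemma closed_field_potential:
  fixes b :: "2 \<Rightarrow> plane \<Rightarrow> real"
  assumes b: "\<And>j. smooth (b j)" and closed: "\<And>j k. partial_deriv k (b j) = partial_deriv j (b k)"
  obtains \<psi> where "smooth \<psi>" "\<psi> 0 = 0" "\<And>j. partial_deriv j \<psi> = b j"
proof -
  \<comment> \<open>The Leibniz rule wants the derivative as a bounded linear function;
    \<open>K j\<close> is the \<open>j\<close>-th coordinate functional in that type.\<close>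
  define K where "K j = Blinfun (\<lambda>h::plane. h $ j)" for j
  have K: "blinfun_apply (K j) = (\<lambda>h. h $ j)" for j
    unfolding K_def by (rule bounded_linear_Blinfun_apply[OF bounded_linear_vec_nth])
  \<comment> \<open>This is the \<open>t\<close>-derivative of
    \<open>t * b k (t *\<^sub>R x)\<close>, so its integral over the unit interval is
    \<open>b k x\<close>. Closedness of the field brings the derivative of the integrand into this
    form.\<close>
  define c where "c k x t = b k (t *\<^sub>R x) + t * (\<Sum>j\<in>UNIV. x $ j * partial_deriv j (b k) (t *\<^sub>R x))" for k x and t :: real
  define f where "f x t = (\<Sum>j\<in>UNIV. x $ j * b j (t *\<^sub>R x))" for x and t :: real
  define \<psi> where "\<psi> x = integral (cbox 0 1) (f x)" for x
  have cb: "continuous_on S (\<lambda>p. g (h p))" if "smooth g" "continuous_on S h"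
    for g :: "plane \<Rightarrow> real" and h :: "'c::topological_space \<Rightarrow> plane" and S
    using continuous_on_compose2[OF smooth_continuous[OF that(1)] that(2)] by auto
  have dt: "((\<lambda>t. b k (t *\<^sub>R x)) has_real_derivative (\<Sum>j\<in>UNIV. x $ j * partial_deriv j (b k) (t *\<^sub>R x))) (at t within S)" for k x t S
    using smooth_ray_derivative[OF b[of k], where z=0 and h=x and t=t and S=S] by simp
  have ci: "((\<lambda>t. c k x t) has_integral b k x) (cbox 0 1)" for k x
  proof -
    have "((\<lambda>t. c k x t) has_integral (1 * b k (1 *\<^sub>R x) - 0 * b k (0 *\<^sub>R x))) {0..1}"
    proof (rule fundamental_theorem_of_calculus)
      fix t :: real
      have "((\<lambda>t. t * b k (t *\<^sub>R x)) has_real_derivative c k x t) (at t within {0..1})"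
        using DERIV_mult[OF DERIV_ident dt[of k x t "{0..1}"]] by (simp add: c_def add.commute mult.commute)
      then show "((\<lambda>t. t * b k (t *\<^sub>R x)) has_vector_derivative c k x t) (at t within {0..1})"
        by (simp add: has_real_derivative_iff_has_vector_derivative)
    qed simp
    then show ?thesis by simp
  qed
  have der: "(\<psi> has_derivative (\<lambda>h. \<Sum>k\<in>UNIV. h $ k * b k x)) (at x)" for x
  proof -
    define fx where "fx x t = (\<Sum>k\<in>UNIV. c k x t *\<^sub>R K k)" for x t
    have "((\<lambda>x. integral (cbox 0 1) (f x)) has_derivative blinfun_apply (integral (cbox 0 1) (fx x))) (at x within UNIV)"
    proof (rule leibniz_rule)
      fix x :: plane and t :: real
      have db: "((\<lambda>x. b j (t *\<^sub>R x)) has_derivative (\<lambda>h. \<Sum>k\<in>UNIV. (t *\<^sub>R h) $ k *\<^sub>R partial_deriv k (b j) (t *\<^sub>R x))) (at x)" for j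
        by (rule has_derivative_compose[of "\<lambda>x. t *\<^sub>R x" "\<lambda>h. t *\<^sub>R h" _ _ "b j", OF _ has_derivative_partials[OF smooth_diff_at[OF b]]])
          (auto intro!: derivative_eq_intros)
      have "((\<lambda>x. f x t) has_derivative (\<lambda>h. \<Sum>j\<in>UNIV. x $ j * (\<Sum>k\<in>UNIV. (t *\<^sub>R h) $ k *\<^sub>R partial_deriv k (b j) (t *\<^sub>R x)) + h $ j * b j (t *\<^sub>R x))) (at x)"
        unfolding f_def
        by (intro has_derivative_sum has_derivative_mult db bounded_linear.has_derivative[OF bounded_linear_vec_nth has_derivative_ident])
      also have "(\<lambda>h. \<Sum>j\<in>UNIV. x $ j * (\<Sum>k\<in>UNIV. (t *\<^sub>R h) $ k *\<^sub>R partial_deriv k (b j) (t *\<^sub>R x)) + h $ j * b j (t *\<^sub>R x)) = blinfun_apply (fx x t)"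
      proof
        fix h :: plane
        have "(\<Sum>j\<in>UNIV. x $ j * (\<Sum>k\<in>UNIV. (t *\<^sub>R h) $ k *\<^sub>R partial_deriv k (b j) (t *\<^sub>R x)))
          = (\<Sum>j\<in>UNIV. \<Sum>k\<in>UNIV. h $ k * (t * (x $ j * partial_deriv j (b k) (t *\<^sub>R x))))"
          unfolding sum_distrib_left by (intro sum.cong refl) (simp add: closed mult_ac)
        also have "\<dots> = (\<Sum>k\<in>UNIV. h $ k * (t * (\<Sum>j\<in>UNIV. x $ j * partial_deriv j (b k) (t *\<^sub>R x))))"
          by (subst sum.swap) (simp add: sum_distrib_left)
        finally show "(\<Sum>j\<in>UNIV. x $ j * (\<Sum>k\<in>UNIV. (t *\<^sub>R h) $ k *\<^sub>R partial_deriv k (b j) (t *\<^sub>R x)) + h $ j * b j (t *\<^sub>R x)) = blinfun_apply (fx x t) h"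
          unfolding sum.distrib by (simp add: fx_def blinfun.sum_left blinfun.scaleR_left K c_def distrib_left distrib_right sum.distrib mult_ac)
      qed
      finally show "((\<lambda>x. f x t) has_derivative blinfun_apply (fx x t)) (at x within UNIV)" .
    next
      fix x :: plane
      show "f x integrable_on cbox 0 1"
        unfolding f_def by (intro integrable_continuous continuous_intros cb b)
    next
      show "continuous_on (UNIV \<times> cbox 0 1) (\<lambda>(x, t). fx x t)"
        unfolding fx_def c_def split_def by (intro continuous_intros cb b smooth_partial_deriv)
    qed auto
    moreover have "integral (cbox 0 1) (fx x) = (\<Sum>k\<in>UNIV. b k x *\<^sub>R K k)"
      unfolding fx_def by (intro integral_unique has_integral_sum has_integral_scaleR_left ci) simp
    moreover have "blinfun_apply (\<Sum>k\<in>UNIV. b k x *\<^sub>R K k) = (\<lambda>h. \<Sum>k\<in>UNIV. h $ k * b k x)"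
      by (rule ext) (simp add: blinfun.sum_left blinfun.scaleR_left K mult.commute)
    ultimately show ?thesis
      unfolding \<psi>_def[abs_def] by (simp only:)
  qed
  have pd: "partial_deriv j \<psi> = b j" for j
    by (rule ext, subst partial_deriv_eq[OF der])
      (simp add: axis_def if_distrib[of "\<lambda>x. x * _"] cong: if_cong)
  show thesis
  proof (rule that)
    show "smooth \<psi>"
      by (rule smooth_partialsI) (use der in \<open>auto simp: pd b differentiable_on_def differentiable_def\<close>)
    show "\<psi> 0 = 0" by (simp add: \<psi>_def f_def[abs_def])
    show "partial_deriv j \<psi> = b j" for j by (rule pd)
  qed
qed

subsection \<open>Stream functions and solenoidal cutoffs\<close>

definition perp_grad :: "2 \<Rightarrow> (plane \<Rightarrow> real) \<Rightarrow> plane \<Rightarrow> real" where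
  "perp_grad i f x = (if i = 1 then - partial_deriv 2 f x else partial_deriv 1 f x)"

lemma perp_grad_1: "perp_grad 1 f = (\<lambda>x. - partial_deriv 2 f x)" and perp_grad_2: "perp_grad 2 f = partial_deriv 1 f"
  by (auto simp: perp_grad_def)

text \<open>Each component of the rotated gradient is a single partial derivative up to sign, so
  linear facts and absolute bounds transfer without a case split.\<close>

lemma perp_grad_cases: obtains k c where "\<bar>c\<bar> = 1" "\<And>f. perp_grad i f = (\<lambda>x. c * partial_deriv k f x)"
proof (cases "i = 1")
  case True then show thesis using that[of "-1" 2] by (simp add: perp_grad_1)
next
  case False
  then have "i = 2" using exhaust_2 by blast
  then show thesis using that[of 1 1] by (simp add: perp_grad_2)
qed

lemma smooth_perp_grad: "smooth f \<Longrightarrow> smooth (perp_grad i f)"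
  by (rule perp_grad_cases[of i]) (simp add: smooth_cmult smooth_partial_deriv)

lemma test_function_perp_grad: "test_function f \<Longrightarrow> test_function (perp_grad i f)"
  by (rule perp_grad_cases[of i]) (simp add: test_function_mult_right test_function_partial_deriv)

lemma divergence_perp_grad:
  assumes "smooth f" shows "(\<Sum>i\<in>UNIV. partial_deriv i (perp_grad i f) x) = 0"
  using partial_deriv_commute[OF assms, of 1 2] assms
  by (simp add: sum_2 perp_grad_1 perp_grad_2 partial_deriv_minus smooth_partial_deriv)

definition perp_grad_field :: "(plane \<Rightarrow> real) \<Rightarrow> plane \<Rightarrow> plane" where
  "perp_grad_field f x = (\<chi> i. perp_grad i f x)"

lemma test_function_vec:
  fixes f :: "2 \<Rightarrow> plane \<Rightarrow> real"
  assumes "\<And>i. test_function (f i)" shows "test_function (\<lambda>x. \<chi> i. f i x)"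
proof -
  have "\<exists>R. \<forall>x. norm x > R \<longrightarrow> f i x = 0" for i using assms by (simp add: test_function_iff)
  then obtain R where R: "\<And>i x. norm x > R i \<Longrightarrow> f i x = 0" by metis
  show ?thesis
  proof (rule test_functionI[of _ "max (R 1) (R 2)"])
    show "smooth (\<lambda>x. \<chi> i. f i x)" by (intro smooth_vec test_function_smooth assms)
    show "(\<chi> i. f i x) = 0" if "norm x > max (R 1) (R 2)" for x
      using that R[of 1 x] R[of 2 x] by (simp add: vec_eq_iff forall_2)
  qed
qed

lemma sol_test_perp_grad_field:
  assumes t: "test_function f"
  shows "sol_test_field (perp_grad_field f)" "grad (perp_grad_field f) x $ i $ j = partial_deriv j (perp_grad i f) x"
proof -
  have sm: "smooth f" using t by (rule test_function_smooth)
  show g: "grad (perp_grad_field f) x $ i $ j = partial_deriv j (perp_grad i f) x" for x i j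
    unfolding perp_grad_field_def[abs_def] by (rule grad_vec[OF smooth_perp_grad[OF sm]])
  have "trace (grad (perp_grad_field f) x) = 0" for x
    unfolding trace_def g using divergence_perp_grad[OF sm] by simp
  moreover have "test_function (perp_grad_field f)"
    unfolding perp_grad_field_def[abs_def] by (intro test_function_vec test_function_perp_grad t)
  ultimately show "sol_test_field (perp_grad_field f)" by (simp add: sol_test_field_def)
qed

text \<open>Rotating a divergence-free field by a right angle gives a closed one. The normalisation
  at 0 starts the growth estimate along rays.\<close>

lemma stream_function:
  fixes a :: "2 \<Rightarrow> plane \<Rightarrow> real"
  assumes a: "\<And>i. smooth (a i)" and div: "\<And>x. (\<Sum>i\<in>UNIV. partial_deriv i (a i) x) = 0"
  obtains \<psi> where "smooth \<psi>" "\<psi> 0 = 0" "\<And>i. perp_grad i \<psi> = a i"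
proof -
  define b where "b j = (if j = 1 then a 2 else (\<lambda>x. - a 1 x))" for j :: 2
  have b12: "b 1 = a 2" "b 2 = (\<lambda>x. - a 1 x)" by (auto simp: b_def)
  have sb: "smooth (b j)" for j by (simp add: b_def a smooth_minus)
  have "partial_deriv 2 (a 2) x = - partial_deriv 1 (a 1) x" for x using div[of x] by (simp add: sum_2 eq_neg_iff_add_eq_0 add.commute)
  then have "partial_deriv 2 (b 1) = partial_deriv 1 (b 2)" by (simp add: b12 partial_deriv_minus a fun_eq_iff)
  then have cl: "partial_deriv k (b j) = partial_deriv j (b k)" for j k
    using exhaust_2[of j] exhaust_2[of k] by auto
  obtain \<psi> where \<psi>: "smooth \<psi>" "\<psi> 0 = 0" "\<And>j. partial_deriv j \<psi> = b j"
    using closed_field_potential[OF sb cl] by metis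
  have "perp_grad i \<psi> = a i" for i
    using exhaust_2[of i] \<psi>(3) by (auto simp: perp_grad_1 perp_grad_2 b12)
  with \<psi> that show thesis by blast
qed

text \<open>Integration along the ray from the origin, by comparison with an explicit function whose
  derivative dominates that of \<open>f\<close>.\<close>

lemma log_log_growth:
  fixes f :: "plane \<Rightarrow> real"
  assumes f: "smooth f" "f 0 = 0" and le: "\<And>j x. \<bar>partial_deriv j f x\<bar> \<le> K * log_weight x"
  shows "\<bar>f x\<bar> \<le> 2 * K * (2 + loglog x)"
proof -
  let ?r = "norm x"
  have K: "K \<ge> 0" using le[of 1 0] log_weight_pos[of 0] abs_ge_zero[of "partial_deriv 1 f 0"] by (smt (verit) mult_less_0_iff)
  define Q where "Q t = 1 + (t * ?r)\<^sup>2" for t :: real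
  \<comment> \<open>The double logarithm is \<open>loglog\<close> along the ray, but its derivative
    vanishes at \<open>t = 0\<close>; the arctangent supplies the missing growth there and stays
    below 2.\<close>
  define B where "B t = arctan (t * ?r) + ln (1 + ln (Q t))" for t :: real
  define B' where "B' t = ?r / Q t + 2 * (t * ?r) * ?r / (Q t * (1 + ln (Q t)))" for t :: real
  define d where "d t = (\<Sum>j\<in>UNIV. x $ j * partial_deriv j f (t *\<^sub>R x))" for t
  have Q1: "Q t \<ge> 1" for t by (simp add: Q_def)
  have lQ: "1 + ln (Q t) \<ge> 1" for t using Q1[of t] by simp
  have dB: "(B has_real_derivative B' t) (at t)" for t
  proof -
    have dQ: "(Q has_real_derivative 2 * (t * ?r) * ?r) (at t)" unfolding Q_def[abs_def] by (auto intro!: derivative_eq_intros)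
    have "Q t > 0" "1 + ln (Q t) > 0" using Q1[of t] lQ[of t] by linarith+
    then have 1: "((\<lambda>t. ln (1 + ln (Q t))) has_real_derivative 2 * (t * ?r) * ?r / (Q t * (1 + ln (Q t)))) (at t)"
      by (auto intro!: derivative_eq_intros dQ simp: divide_simps)
    have "((\<lambda>t. arctan (t * ?r)) has_real_derivative ?r / Q t) (at t)"
      by (auto intro!: derivative_eq_intros simp: Q_def divide_simps)
    from DERIV_add[OF this 1] show ?thesis unfolding B_def[abs_def] B'_def .
  qed
  have df: "((\<lambda>t. f (t *\<^sub>R x)) has_real_derivative d t) (at t)" for t
    unfolding d_def using smooth_ray_derivative[OF f(1), where z=0 and h=x and t=t and S=UNIV] by simp
  have dle: "\<bar>d t\<bar> \<le> 2 * K * B' t" if "0 \<le> t" "t \<le> 1" for t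
  proof -
    have q: "bracket_sq (t *\<^sub>R x) = Q t" by (simp add: bracket_sq_def Q_def power_mult_distrib)
    have l: "log_bracket (t *\<^sub>R x) = 1 + ln (Q t)" by (simp add: log_bracket_def q)
    have pos: "Q t > 0" "1 + ln (Q t) > 0" using Q1[of t] lQ[of t] by linarith+
    \<comment> \<open>The aim is \<open>sqrt (Q t) \<le> (1 + ln (Q t)) + 2 * (t * ?r)\<close>:
      after division by \<open>Q t * (1 + ln (Q t))\<close> and multiplication by \<open>?r\<close>
      the two summands are the two terms of \<open>B' t\<close>.\<close>
    have "sqrt (Q t) \<le> 1 + t * ?r"
      using that unfolding Q_def by (intro real_le_lsqrt) (auto simp: power2_eq_square algebra_simps)
    also have "\<dots> \<le> (1 + ln (Q t)) + 2 * (t * ?r)" using lQ[of t] that by simp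
    finally have s: "sqrt (Q t) \<le> (1 + ln (Q t)) + 2 * (t * ?r)" .
    have "log_weight (t *\<^sub>R x) = sqrt (Q t) / (Q t * (1 + ln (Q t)))"
      using pos real_sqrt_mult_self[of "Q t"] by (simp add: log_weight_def q l divide_simps mult_ac)
    also have "\<dots> \<le> ((1 + ln (Q t)) + 2 * (t * ?r)) / (Q t * (1 + ln (Q t)))"
      using s pos by (intro divide_right_mono) auto
    finally have w: "?r * log_weight (t *\<^sub>R x) \<le> ?r * (((1 + ln (Q t)) + 2 * (t * ?r)) / (Q t * (1 + ln (Q t))))"
      by (rule mult_left_mono) simp
    also have "\<dots> = B' t"
    proof -
      have "\<rho> * ((b + 2 * s) / (a * b)) = \<rho> / a + 2 * s * \<rho> / (a * b)" if "a > 0" "b > 0" for a b s \<rho> :: real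
        using that by (simp add: field_simps)
      from this[OF pos] show ?thesis unfolding B'_def .
    qed
    finally have w': "?r * log_weight (t *\<^sub>R x) \<le> B' t" .
    have "\<bar>d t\<bar> \<le> 2 * (K * log_weight (t *\<^sub>R x)) * ?r" unfolding d_def by (rule abs_component_sum_le[OF le])
    also have "\<dots> = 2 * K * (?r * log_weight (t *\<^sub>R x))" by simp
    also have "\<dots> \<le> 2 * K * B' t" using w' K by (intro mult_left_mono) auto
    finally show ?thesis .
  qed
  \<comment> \<open>The sign \<open>s\<close> treats \<open>f\<close> and \<open>- f\<close>
    together, which gives the bound on the absolute value.\<close>
  have mono: "2 * K * B 0 + s * f (0 *\<^sub>R x) \<le> 2 * K * B 1 + s * f (1 *\<^sub>R x)" if s: "\<bar>s\<bar> = 1" for s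
  proof (rule DERIV_nonneg_imp_nondecreasing[of 0 1 "\<lambda>t. 2 * K * B t + s * f (t *\<^sub>R x)"])
    fix t :: real assume t: "0 \<le> t" "t \<le> 1"
    have "((\<lambda>t. 2 * K * B t + s * f (t *\<^sub>R x)) has_real_derivative 2 * K * B' t + s * d t) (at t)"
      by (intro DERIV_add DERIV_cmult dB df)
    moreover have "\<bar>s * d t\<bar> \<le> 2 * K * B' t" using dle[OF t] s by (simp add: abs_mult)
    then have "0 \<le> 2 * K * B' t + s * d t" by linarith
    ultimately show "\<exists>y. ((\<lambda>t. 2 * K * B t + s * f (t *\<^sub>R x)) has_real_derivative y) (at t) \<and> 0 \<le> y" by blast
  qed simp
  have "B 0 = 0" by (simp add: B_def Q_def)
  then have "\<bar>f x\<bar> \<le> 2 * K * B 1" using mono[of 1] mono[of "-1"] f(2) by simp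
  also have "B 1 = arctan ?r + loglog x" by (simp add: B_def Q_def loglog_def log_bracket_def bracket_sq_def)
  also have "2 * K * (arctan ?r + loglog x) \<le> 2 * K * (2 + loglog x)"
    using arctan_ubound[of ?r] pi_less_4 K by (intro mult_left_mono) auto
  finally show ?thesis .
qed

text \<open>
  In the remainder of \<open>grad (perp_grad (cutoff N * \<psi>))\<close> every term carries a derivative of the cutoff, of size
  \<open>log_weight / N\<close>, or two of them, of size \<open>log_weight / (N * sqrt bracket_sq)\<close>.
\<close>

lemma cutoff_fields:
  fixes a :: "2 \<Rightarrow> plane \<Rightarrow> real"
  assumes a: "\<And>i. smooth (a i)" and div: "\<And>x. (\<Sum>i\<in>UNIV. partial_deriv i (a i) x) = 0"
    and g: "\<And>i j. sq_int (partial_deriv j (a i))" and w: "\<And>i. sq_int (\<lambda>x. log_weight x * a i x)"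
  obtains \<phi> where "\<And>n. sol_test_field (\<phi> n)"
    "\<And>i j. L2_tendsto (\<lambda>n x. grad (\<phi> n) x $ i $ j) (partial_deriv j (a i))"
    "\<And>i x. (\<lambda>n. \<phi> n x $ i) \<longlonglongrightarrow> a i x"
    "\<And>K. (\<And>i x. \<bar>a i x\<bar> \<le> K * log_weight x) \<Longrightarrow> \<exists>K'. \<forall>n i x. \<bar>\<phi> n x $ i\<bar> \<le> K' * log_weight x"
proof -
  obtain \<psi> where \<psi>: "smooth \<psi>" "\<psi> 0 = 0" "\<And>i. perp_grad i \<psi> = a i" by (rule stream_function[OF a div]) blast
  obtain C where C: "C > 0" "\<And>N j x. N \<ge> 1 \<Longrightarrow> \<bar>partial_deriv j (cutoff N) x\<bar> \<le> C / N * log_weight x"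
    "\<And>N i j x. N \<ge> 1 \<Longrightarrow> \<bar>partial_deriv i (partial_deriv j (cutoff N)) x\<bar> \<le> C / N * (log_weight x / sqrt (bracket_sq x))"
    using cutoff_bounds by metis
  define N where "N n = real (Suc n)" for n
  have N: "N n \<ge> 1" for n by (simp add: N_def)
  define \<eta> where "\<eta> n = (\<lambda>x. cutoff (N n) x * \<psi> x)" for n
  have \<eta>: "test_function (\<eta> n)" for n unfolding \<eta>_def by (rule test_function_mult_left[OF cutoff_test[OF N] \<psi>(1)])
  define \<phi> where "\<phi> n = perp_grad_field (\<eta> n)" for n
  \<comment> \<open>Up to sign the partial derivatives of the stream function are the components of
    \<open>a\<close>, so every bound on \<open>a\<close> is one on
    \<open>grad \<psi>\<close>.\<close>
  have pd\<psi>: "\<exists>i. \<forall>x. \<bar>partial_deriv k \<psi> x\<bar> = \<bar>a i x\<bar>" for k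
  proof (cases "k = 1")
    case True then show ?thesis using \<psi>(3)[of 2] by (auto simp: perp_grad_2 intro!: exI[of _ 2])
  next
    case False
    then have "k = 2" using exhaust_2 by blast
    moreover have "\<bar>partial_deriv 2 \<psi> x\<bar> = \<bar>a 1 x\<bar>" for x using fun_cong[OF \<psi>(3)[of 1], of x] by (simp add: perp_grad_1)
    ultimately show ?thesis by blast
  qed
  have perp_grad\<eta>: "perp_grad i (\<eta> n) = (\<lambda>x. cutoff (N n) x * a i x + \<psi> x * perp_grad i (cutoff (N n)) x)" for i n
  proof (rule perp_grad_cases[of i])
    fix c k assume r: "\<And>f. perp_grad i f = (\<lambda>x. c * partial_deriv k f x)"
    have "a i = (\<lambda>x. c * partial_deriv k \<psi> x)" using \<psi>(3)[of i] r by simp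
    then show ?thesis
      unfolding r \<eta>_def partial_deriv_mult[OF smooth_cutoff \<psi>(1)] by (simp add: algebra_simps)
  qed
  have d\<eta>: "partial_deriv j (perp_grad i (\<eta> n)) = (\<lambda>x. cutoff (N n) x * partial_deriv j (a i) x +
      (partial_deriv j (cutoff (N n)) x * a i x + partial_deriv j \<psi> x * perp_grad i (cutoff (N n)) x + \<psi> x * partial_deriv j (perp_grad i (cutoff (N n))) x))" for i j n
    unfolding perp_grad\<eta>
    by (simp add: partial_deriv_add partial_deriv_mult smooth_mult smooth_cutoff \<psi>(1) a smooth_perp_grad algebra_simps fun_eq_iff)
  have rchi: "\<bar>perp_grad i (cutoff (N n)) x\<bar> \<le> C / N n * log_weight x"
    "\<bar>partial_deriv j (perp_grad i (cutoff (N n))) x\<bar> \<le> C / N n * (log_weight x / sqrt (bracket_sq x))" for i j n x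
  proof -
    obtain c k where c: "\<bar>c\<bar> = 1" and r: "\<And>f. perp_grad i f = (\<lambda>x. c * partial_deriv k f x)" using perp_grad_cases[of i] by metis
    show "\<bar>perp_grad i (cutoff (N n)) x\<bar> \<le> C / N n * log_weight x" using C(2)[OF N[of n], of k x] c by (simp add: r abs_mult)
    show "\<bar>partial_deriv j (perp_grad i (cutoff (N n))) x\<bar> \<le> C / N n * (log_weight x / sqrt (bracket_sq x))"
      unfolding r using C(3)[OF N[of n], of j k x] c
      by (simp add: partial_deriv_cmult[OF smooth_partial_deriv[OF smooth_cutoff]] abs_mult)
  qed
  have wd: "sq_int (\<lambda>x. log_weight x * partial_deriv k \<psi> x)" for k
  proof -
    obtain i where i: "\<And>x. \<bar>partial_deriv k \<psi> x\<bar> = \<bar>a i x\<bar>" using pd\<psi> by metis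
    have [measurable]: "partial_deriv k \<psi> \<in> borel_measurable borel" by (rule smooth_measurable[OF smooth_partial_deriv[OF \<psi>(1)]])
    show ?thesis
      by (rule sq_int_dominated[OF w[of i], where C=1]) (auto simp: abs_mult i)
  qed
  \<comment> \<open>The weight gains a factor \<open>1 / sqrt bracket_sq\<close>, exactly the one in
    the bound for the second derivatives of the cutoff, which multiply
    \<open>\<psi>\<close>.\<close>
  have w2: "sq_int (\<lambda>x. log_weight x / sqrt (bracket_sq x) * \<psi> x)" by (rule second_log_Hardy[OF \<psi>(1) wd])
  have [measurable]: "\<psi> \<in> borel_measurable borel" "a i \<in> borel_measurable borel"
    "partial_deriv j \<psi> \<in> borel_measurable borel" "partial_deriv j (a i) \<in> borel_measurable borel"
    "perp_grad i (\<eta> n) \<in> borel_measurable borel" "partial_deriv j (perp_grad i (\<eta> n)) \<in> borel_measurable borel" for i j n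
    by (intro smooth_measurable smooth_partial_deriv smooth_perp_grad a \<psi>(1) test_function_smooth \<eta>)+
  \<comment> \<open>A square integrable function independent of \<open>n\<close>; the remainder is
    at most \<open>C / N n\<close> times it, so it is dominated and also tends to zero
    pointwise.\<close>
  define R where "R i j x = \<bar>log_weight x * a i x\<bar> + \<bar>log_weight x * partial_deriv j \<psi> x\<bar> + \<bar>log_weight x / sqrt (bracket_sq x) * \<psi> x\<bar>" for i j x
  have R0: "R i j x \<ge> 0" for i j x by (simp add: R_def)
  have sabs: "sq_int (\<lambda>x. \<bar>h x\<bar>)" if "sq_int h" for h
    using that by (auto simp: sq_int_def)
  have sR: "sq_int (R i j)" for i j
    unfolding R_def[abs_def] by (intro sq_int_add sabs w wd w2)
  have rem: "\<bar>partial_deriv j (cutoff (N n)) x * a i x + partial_deriv j \<psi> x * perp_grad i (cutoff (N n)) x + \<psi> x * partial_deriv j (perp_grad i (cutoff (N n))) x\<bar>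
    \<le> C / N n * R i j x" for i j n x
  proof -
    have 1: "\<bar>partial_deriv j (cutoff (N n)) x * a i x\<bar> \<le> C / N n * \<bar>log_weight x * a i x\<bar>"
      using mult_right_mono[OF C(2)[OF N[of n], of j x] abs_ge_zero[of "a i x"]] log_weight_pos[of x] by (simp add: abs_mult)
    have 2: "\<bar>partial_deriv j \<psi> x * perp_grad i (cutoff (N n)) x\<bar> \<le> C / N n * \<bar>log_weight x * partial_deriv j \<psi> x\<bar>"
      using mult_right_mono[OF rchi(1)[of i n x] abs_ge_zero[of "partial_deriv j \<psi> x"]] log_weight_pos[of x] by (simp add: abs_mult mult_ac)
    have 3: "\<bar>\<psi> x * partial_deriv j (perp_grad i (cutoff (N n))) x\<bar> \<le> C / N n * \<bar>log_weight x / sqrt (bracket_sq x) * \<psi> x\<bar>"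
      using mult_right_mono[OF rchi(2)[of j i n x] abs_ge_zero[of "\<psi> x"]] log_weight_pos[of x] bracket_sq_pos[of x] by (simp add: abs_mult mult_ac)
    show ?thesis unfolding R_def distrib_left using 1 2 3 by linarith
  qed
  have Nlim: "(\<lambda>n. c / N n) \<longlonglongrightarrow> 0" for c
    using tendsto_mult[OF tendsto_const[of c] LIMSEQ_inverse_real_of_nat] by (simp add: N_def divide_inverse)
  have lim: "(\<lambda>n. partial_deriv j (perp_grad i (\<eta> n)) x) \<longlonglongrightarrow> partial_deriv j (a i) x" for i j x
  proof -
    have "(\<lambda>n. C / N n * R i j x) \<longlonglongrightarrow> 0" using tendsto_mult[OF Nlim[of C] tendsto_const[of "R i j x"]] by simp
    then have r0: "(\<lambda>n. partial_deriv j (cutoff (N n)) x * a i x + partial_deriv j \<psi> x * perp_grad i (cutoff (N n)) x + \<psi> x * partial_deriv j (perp_grad i (cutoff (N n))) x) \<longlonglongrightarrow> 0"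
      by (rule Lim_null_comparison[rotated]) (intro always_eventually allI, unfold real_norm_def, rule rem)
    have "(\<lambda>n. cutoff (N n) x) \<longlonglongrightarrow> 1" unfolding N_def by (rule cutoff_tendsto)
    from tendsto_add[OF tendsto_mult[OF this tendsto_const[of "partial_deriv j (a i) x"]] r0]
    show ?thesis unfolding d\<eta> by simp
  qed
  show thesis
  proof (rule that[of \<phi>])
    show "sol_test_field (\<phi> n)" for n unfolding \<phi>_def by (rule sol_test_perp_grad_field(1)[OF \<eta>])
    have grad_entry: "(\<lambda>x. grad (\<phi> n) x $ i $ j) = partial_deriv j (perp_grad i (\<eta> n))" for n i j
      unfolding \<phi>_def sol_test_perp_grad_field(2)[OF \<eta>] by simp
    show "L2_tendsto (\<lambda>n x. grad (\<phi> n) x $ i $ j) (partial_deriv j (a i))" for i j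
      unfolding grad_entry
    proof (rule L2_tendsto_dominated[where g="\<lambda>x. \<bar>partial_deriv j (a i) x\<bar> + C * R i j x"])
      show "sq_int (\<lambda>x. \<bar>partial_deriv j (a i) x\<bar> + C * R i j x)" by (intro sq_int_add sabs g sq_int_cmult sR)
      show "AE x in lborel. (\<lambda>n. partial_deriv j (perp_grad i (\<eta> n)) x) \<longlonglongrightarrow> partial_deriv j (a i) x" by (intro AE_I2 lim)
      show "AE x in lborel. \<bar>partial_deriv j (perp_grad i (\<eta> n)) x\<bar> \<le> \<bar>partial_deriv j (a i) x\<bar> + C * R i j x" for n
      proof (rule AE_I2)
        fix x
        have "\<bar>cutoff (N n) x * partial_deriv j (a i) x\<bar> \<le> \<bar>partial_deriv j (a i) x\<bar>"
          using cutoff_nonneg[of "N n" x] cutoff_le_1[OF N[of n], of x] by (simp add: abs_mult mult_left_le_one_le)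
        moreover have "C / N n * R i j x \<le> C * R i j x"
          using C(1) N[of n] R0 by (intro mult_right_mono) (auto simp: divide_simps)
        ultimately show "\<bar>partial_deriv j (perp_grad i (\<eta> n)) x\<bar> \<le> \<bar>partial_deriv j (a i) x\<bar> + C * R i j x"
          unfolding d\<eta> using rem[of j n x i] by linarith
      qed
    qed measurable
    have ph: "\<phi> n x $ i = cutoff (N n) x * a i x + \<psi> x * perp_grad i (cutoff (N n)) x" for n x i
      by (simp add: \<phi>_def perp_grad_field_def perp_grad\<eta>)
    show "(\<lambda>n. \<phi> n x $ i) \<longlonglongrightarrow> a i x" for i x
    proof -
      have "(\<lambda>n. \<bar>\<psi> x\<bar> * (C / N n * log_weight x)) \<longlonglongrightarrow> \<bar>\<psi> x\<bar> * (0 * log_weight x)"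
        by (rule tendsto_mult[OF tendsto_const tendsto_mult[OF Nlim tendsto_const]])
      then have l0: "(\<lambda>n. \<bar>\<psi> x\<bar> * (C / N n * log_weight x)) \<longlonglongrightarrow> 0" by simp
      have "norm (\<psi> x * perp_grad i (cutoff (N n)) x) \<le> \<bar>\<psi> x\<bar> * (C / N n * log_weight x)" for n
        unfolding real_norm_def abs_mult by (rule mult_left_mono[OF rchi(1) abs_ge_zero])
      then have r0: "(\<lambda>n. \<psi> x * perp_grad i (cutoff (N n)) x) \<longlonglongrightarrow> 0"
        by (intro Lim_null_comparison[OF always_eventually l0] allI)
      have "(\<lambda>n. cutoff (N n) x) \<longlonglongrightarrow> 1" unfolding N_def by (rule cutoff_tendsto)
      from tendsto_add[OF tendsto_mult[OF this tendsto_const[of "a i x"]] r0]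
      show ?thesis unfolding ph by simp
    qed
    show "\<exists>K'. \<forall>n i x. \<bar>\<phi> n x $ i\<bar> \<le> K' * log_weight x" if K: "\<And>i x. \<bar>a i x\<bar> \<le> K * log_weight x" for K
    proof (intro exI allI)
      fix n i x
      have K0: "K \<ge> 0" using K[of 1 0] log_weight_pos[of 0] abs_ge_zero[of "a 1 0"] by (smt (verit) mult_less_0_iff)
      have "\<bar>partial_deriv j \<psi> x\<bar> \<le> K * log_weight x" for j x using pd\<psi>[of j] K by metis
      from log_log_growth[OF \<psi>(1,2) this] have grad_entry: "\<bar>\<psi> x\<bar> \<le> 2 * K * (2 + loglog x)" .
      have 1: "\<bar>cutoff (N n) x * a i x\<bar> \<le> K * log_weight x"
        using mult_mono[OF cutoff_le_1[OF N[of n], of x] K[of i x]] cutoff_nonneg[of "N n" x] by (simp add: abs_mult)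
      \<comment> \<open>Beyond \<open>loglog x \<ge> N n\<close> the derivative of the cutoff
        vanishes. Before that point \<open>2 + loglog x \<le> 3 * N n\<close>, and this growth of
        \<open>\<psi>\<close> cancels the factor \<open>1 / N n\<close>; hence the constant
        \<open>6 = 2 * 3\<close>.\<close>
      have 2: "\<bar>\<psi> x * perp_grad i (cutoff (N n)) x\<bar> \<le> 6 * K * C * log_weight x"
      proof (cases "loglog x \<ge> N n")
        case True
        have "perp_grad i (cutoff (N n)) x = 0"
          unfolding perp_grad_def using cutoff_deriv_zero[OF N[of n] True] by simp
        then show ?thesis using K0 C(1) log_weight_pos[of x] by simp
      next
        case False
        then have "\<bar>\<psi> x\<bar> \<le> 2 * K * (3 * N n)"
          using grad_entry N[of n] K0 by (intro order_trans[OF grad_entry] mult_left_mono) auto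
        then have "\<bar>\<psi> x * perp_grad i (cutoff (N n)) x\<bar> \<le> (2 * K * (3 * N n)) * (C / N n * log_weight x)"
          unfolding abs_mult by (intro mult_mono rchi(1)) (use K0 N[of n] in auto)
        also have "\<dots> = 6 * K * C * log_weight x" using N[of n] by simp
        finally show ?thesis .
      qed
      show "\<bar>\<phi> n x $ i\<bar> \<le> (K + 6 * K * C) * log_weight x"
        unfolding ph distrib_right using 1 2 by linarith
    qed
  qed
qed

subsection \<open>Solenoidal fields with square integrable gradient\<close>

definition div_free :: "(2 \<Rightarrow> plane \<Rightarrow> real) \<Rightarrow> bool" where
  "div_free f \<longleftrightarrow> (\<forall>\<eta>. test_function \<eta> \<longrightarrow> (\<Sum>j\<in>UNIV. \<integral>x. f j x * partial_deriv j \<eta> x \<partial>lborel) = 0)"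

definition tensor_ip :: "(2 \<Rightarrow> 2 \<Rightarrow> plane \<Rightarrow> real) \<Rightarrow> (2 \<Rightarrow> 2 \<Rightarrow> plane \<Rightarrow> real) \<Rightarrow> real" where
  "tensor_ip P Q = (\<Sum>i\<in>UNIV. \<Sum>j\<in>UNIV. \<integral>x. P i j x * Q i j x \<partial>lborel)"

definition grad_entry :: "(plane \<Rightarrow> plane) \<Rightarrow> 2 \<Rightarrow> 2 \<Rightarrow> plane \<Rightarrow> real" where
  "grad_entry \<phi> i j x = grad \<phi> x $ i $ j"

lemma tensor_ip_commute: "tensor_ip P Q = tensor_ip Q P"
  by (simp add: tensor_ip_def mult.commute)

lemma tensor_ip_tendsto:
  assumes "\<And>i j. L2_tendsto (\<lambda>n. P n i j) (P' i j)" "\<And>i j. L2_tendsto (\<lambda>n. Q n i j) (Q' i j)"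
  shows "(\<lambda>n. tensor_ip (P n) (Q n)) \<longlonglongrightarrow> tensor_ip P' Q'"
  unfolding tensor_ip_def by (intro tendsto_sum L2_tendsto_inner assms)

lemma tensor_ip_diff_left:
  assumes "\<And>i j. sq_int (P i j)" "\<And>i j. sq_int (P' i j)" "\<And>i j. sq_int (Q i j)"
  shows "tensor_ip (\<lambda>i j x. P i j x - P' i j x) Q = tensor_ip P Q - tensor_ip P' Q"
  unfolding tensor_ip_def sum_subtractf[symmetric]
  by (intro sum.cong refl) (simp add: left_diff_distrib sq_int_mult assms)

lemma tensor_ip_diff_right:
  assumes "\<And>i j. sq_int (P i j)" "\<And>i j. sq_int (P' i j)" "\<And>i j. sq_int (Q i j)"
  shows "tensor_ip Q (\<lambda>i j x. P i j x - P' i j x) = tensor_ip Q P - tensor_ip Q P'"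
  using tensor_ip_diff_left[OF assms] by (simp add: tensor_ip_commute)

section \<open>Comparison with the weight\<close>

text \<open>A shift by at most 1 changes \<open>bracket_sq\<close> by a factor of at most 3, so its
  root by at most 2 and \<open>log_bracket\<close> by at most 3, because
  \<open>ln 3 \<le> 2\<close>; the product of these is 6.\<close>

lemma log_weight_shift:
  assumes "norm (x - y) \<le> 1" shows "log_weight y \<le> 6 * log_weight x"
proof -
  have "norm x \<le> norm y + 1" using norm_triangle_ineq2[of x y] assms by simp
  then have "(norm x)\<^sup>2 \<le> (norm y + 1)\<^sup>2" by (intro power_mono) auto
  also have "\<dots> \<le> 2 * (norm y)\<^sup>2 + 2" using zero_le_power2[of "norm y - 1"] by (simp add: power2_eq_square algebra_simps)
  finally have q: "bracket_sq x \<le> 3 * bracket_sq y" by (simp add: bracket_sq_def) (smt (verit) zero_le_power2)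
  have "sqrt (bracket_sq x) \<le> sqrt (2\<^sup>2 * bracket_sq y)" using q bracket_sq_pos[of y] by (intro real_sqrt_le_mono) simp
  then have s: "sqrt (bracket_sq x) \<le> 2 * sqrt (bracket_sq y)" by (simp add: real_sqrt_mult)
  have "ln (bracket_sq x) \<le> ln (3 * bracket_sq y)" using q bracket_sq_pos[of x] by (intro ln_mono) auto
  also have "\<dots> = ln 3 + ln (bracket_sq y)" using bracket_sq_pos[of y] by (simp add: ln_mult)
  also have "\<dots> \<le> 2 + ln (bracket_sq y)" using ln_le_minus_one[of "3::real"] by simp
  finally have l: "log_bracket x \<le> 3 * log_bracket y" using log_bracket_ge_1[of y] by (simp add: log_bracket_def)
  have "sqrt (bracket_sq x) * log_bracket x \<le> (2 * sqrt (bracket_sq y)) * (3 * log_bracket y)"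
    using log_bracket_pos[of x] bracket_sq_pos[of y] by (intro mult_mono s l) auto
  then show ?thesis
    using bracket_sq_pos[of x] bracket_sq_pos[of y] log_bracket_pos[of x] log_bracket_pos[of y]
    by (simp add: log_weight_def divide_simps mult_ac)
qed

text \<open>An almost everywhere bound turns into a pointwise one for the mollification, uniformly
  in \<open>n\<close>; the factor 6 is that of \<open>log_weight_shift\<close>.\<close>

lemma conv_mollifier_log_weight_bound:
  assumes l: "loc_int f" and le: "AE x in lborel. \<bar>f x\<bar> \<le> B * log_weight x" and B: "B \<ge> 0"
  shows "\<bar>conv f (mollifier n) x\<bar> \<le> 6 * B * log_weight x"
proof -
  have [measurable]: "f \<in> borel_measurable borel" by (rule loc_int_measurable[OF l])
  have i: "integrable lborel (\<lambda>y. f y * mollifier n (x - y))" by (rule integrable_conv[OF l mollifier_test])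
  have im: "integrable lborel (\<lambda>y. mollifier n (x - y))" by (rule test_function_integrable[OF test_function_reflect[OF mollifier_test]])
  have "\<bar>conv f (mollifier n) x\<bar> \<le> (\<integral>y. \<bar>f y * mollifier n (x - y)\<bar> \<partial>lborel)"
    unfolding conv_def by (rule integral_abs_bound)
  also have "\<dots> \<le> (\<integral>y. 6 * B * log_weight x * mollifier n (x - y) \<partial>lborel)"
  proof (rule integral_mono_AE)
    show "AE y in lborel. \<bar>f y * mollifier n (x - y)\<bar> \<le> 6 * B * log_weight x * mollifier n (x - y)"
      using le
    proof eventually_elim
      case (elim y)
      show ?case
      proof (cases "norm (x - y) \<ge> mollifier_scale n")
        case False
        then have "norm (x - y) \<le> 1" using mollifier_scale_le_1[of n] by simp
        then have "B * log_weight y \<le> B * (6 * log_weight x)" using B by (intro mult_left_mono log_weight_shift)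
        then have "\<bar>f y\<bar> \<le> 6 * B * log_weight x" using elim by simp
        then show ?thesis unfolding abs_mult using mollifier_nonneg[of n "x - y"] by (simp add: mult_right_mono)
      qed (simp add: mollifier_zero)
    qed
  qed (use i im in auto)
  also have "\<dots> = 6 * B * log_weight x" using im by (simp add: integral_reflect mollifier_integral)
  finally show ?thesis .
qed

text \<open>The reciprocal of the weight is at most the smooth function
  \<open>bracket_sq * log_bracket\<close>, and its product with a test function is again a test
  function, hence bounded.\<close>

lemma test_function_le_log_weight:
  fixes f :: "plane \<Rightarrow> real"
  assumes "test_function f"
  shows "\<exists>K. \<forall>x. \<bar>f x\<bar> \<le> K * log_weight x"
proof -
  obtain M where M: "M > 0" "\<And>x. \<bar>f x * (bracket_sq x * log_bracket x)\<bar> \<le> M"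
    using test_function_bounded[OF test_function_mult_left[OF assms smooth_mult[OF smooth_bracket_sq smooth_log_bracket]]] by metis
  have "\<bar>f x\<bar> \<le> M * log_weight x" for x
  proof -
    have pos: "bracket_sq x > 0" "log_bracket x > 0" "sqrt (bracket_sq x) \<ge> 1" using bracket_sq_pos[of x] log_bracket_pos[of x] bracket_sq_ge_1[of x] by auto
    have "\<bar>f x\<bar> * (bracket_sq x * log_bracket x) \<le> M" using M(2)[of x] pos by (simp add: abs_mult)
    moreover have "sqrt (bracket_sq x) * log_bracket x \<le> bracket_sq x * log_bracket x"
      using pos mult_left_mono[of 1 "sqrt (bracket_sq x)" "sqrt (bracket_sq x)"] by (intro mult_right_mono) auto
    then have "\<bar>f x\<bar> * (sqrt (bracket_sq x) * log_bracket x) \<le> \<bar>f x\<bar> * (bracket_sq x * log_bracket x)" by (intro mult_left_mono) auto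
    ultimately have "\<bar>f x\<bar> * (sqrt (bracket_sq x) * log_bracket x) \<le> M" by linarith
    then show ?thesis using pos by (simp add: log_weight_def pos_le_divide_eq)
  qed
  then show ?thesis by blast
qed

text \<open>The decay of \<open>g\<close> provides the weight that \<open>f\<close> needs. In this
  way each convection integral becomes a pairing of two square integrable functions, a gradient and
  such a product.\<close>

lemma sq_int_mult_le_log_weight:
  assumes "sq_int (\<lambda>x. log_weight x * f x)" "f \<in> borel_measurable borel" "g \<in> borel_measurable borel" "AE x in lborel. \<bar>g x\<bar> \<le> K * log_weight x"
  shows "sq_int (\<lambda>x. f x * g x)"
proof (rule sq_int_dominated[OF assms(1), where C=K])
  show "(\<lambda>x. f x * g x) \<in> borel_measurable borel" using assms(2,3) by measurable
  show "AE x in lborel. \<bar>f x * g x\<bar> \<le> K * \<bar>log_weight x * f x\<bar>"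
    using assms(4)
  proof eventually_elim
    case (elim x)
    then show ?case using mult_left_mono[OF elim abs_ge_zero[of "f x"]] log_weight_pos[of x] by (simp add: abs_mult mult_ac)
  qed
qed

lemma sq_int_mult_test:
  assumes "sq_int (\<lambda>x. log_weight x * f x)" "f \<in> borel_measurable borel" "test_function g"
  shows "sq_int (\<lambda>x. f x * g x)"
proof -
  obtain K where "\<And>x. \<bar>g x\<bar> \<le> K * log_weight x" using test_function_le_log_weight[OF assms(3)] by blast
  then show ?thesis
    using assms by (intro sq_int_mult_le_log_weight[of f g K]) (auto simp: smooth_measurable test_function_smooth)
qed

lemma L2_tendsto_mult_le_log_weight:
  assumes w: "sq_int (\<lambda>x. log_weight x * f x)" and [measurable]: "f \<in> borel_measurable borel" "\<And>n. F n \<in> borel_measurable borel" "g \<in> borel_measurable borel"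
    and le: "\<And>n x. \<bar>F n x\<bar> \<le> K * log_weight x" and lim: "AE x in lborel. (\<lambda>n. F n x) \<longlonglongrightarrow> g x"
  shows "L2_tendsto (\<lambda>n x. f x * F n x) (\<lambda>x. f x * g x)"
proof (rule L2_tendsto_dominated[where g="\<lambda>x. K * \<bar>log_weight x * f x\<bar>"])
  show "sq_int (\<lambda>x. K * \<bar>log_weight x * f x\<bar>)" using w by (intro sq_int_cmult) (auto simp: sq_int_def)
  show "AE x in lborel. \<bar>f x * F n x\<bar> \<le> K * \<bar>log_weight x * f x\<bar>" for n
  proof (rule AE_I2)
    fix x
    show "\<bar>f x * F n x\<bar> \<le> K * \<bar>log_weight x * f x\<bar>"
      using mult_left_mono[OF le[of n x] abs_ge_zero[of "f x"]] log_weight_pos[of x] by (simp add: abs_mult mult_ac)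
  qed
  show "AE x in lborel. (\<lambda>n. f x * F n x) \<longlonglongrightarrow> f x * g x"
    using lim by eventually_elim (intro tendsto_mult tendsto_const)
qed measurable

lemma sol_test_component:
  assumes "sol_test_field \<phi>"
  shows "test_function (\<lambda>x. \<phi> x $ i)" "partial_deriv j (\<lambda>x. \<phi> x $ i) = grad_entry \<phi> i j"
proof -
  have t: "test_function \<phi>" using assms by (simp add: sol_test_field_def)
  obtain R where R: "\<forall>x. norm x > R \<longrightarrow> \<phi> x = 0" using t unfolding test_function_iff by blast
  show "test_function (\<lambda>x. \<phi> x $ i)"
  proof (rule test_functionI[of _ R])
    show "smooth (\<lambda>x. \<phi> x $ i)" by (rule smooth_vec_component(1)[OF test_function_smooth[OF t]])
    show "\<phi> x $ i = 0" if "norm x > R" for x using R that by simp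
  qed
  show "partial_deriv j (\<lambda>x. \<phi> x $ i) = grad_entry \<phi> i j"
    unfolding smooth_vec_component(2)[OF test_function_smooth[OF t]] by (simp add: grad_entry_def fun_eq_iff)
qed

lemma test_function_sq_int:
  fixes f :: "plane \<Rightarrow> real"
  assumes "test_function f" shows "sq_int f"
  using test_function_integrable[OF test_function_mult_left[OF assms test_function_smooth[OF assms]]] assms
  by (simp add: sq_int_def power2_eq_square smooth_measurable test_function_smooth)

lemma sol_test_grad_entry:
  assumes "sol_test_field \<phi>"
  shows "test_function (grad_entry \<phi> i j)" "sq_int (grad_entry \<phi> i j)"
proof -
  show "test_function (grad_entry \<phi> i j)"
    using test_function_partial_deriv[OF sol_test_component(1)[OF assms, of i], of j] unfolding sol_test_component(2)[OF assms] .
  then show "sq_int (grad_entry \<phi> i j)" by (rule test_function_sq_int)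
qed

section \<open>Approximation of solenoidal fields by test fields\<close>

text \<open>Component form of the homogeneous solenoidal space: \<open>g i j\<close> stands for the
  \<open>j\<close>-th derivative of \<open>f i\<close>. The weak gradient is a parameter because it
  is fixed only up to null sets.\<close>

locale solenoidal =
  fixes f :: "2 \<Rightarrow> plane \<Rightarrow> real" and g :: "2 \<Rightarrow> 2 \<Rightarrow> plane \<Rightarrow> real"
  assumes wg: "\<And>i. weak_gradient (f i) (g i)" and sg: "\<And>i j. sq_int (g i j)" and dv: "div_free f"
begin

lemma li: "loc_int (f i)"
  using wg by (simp add: weak_gradient_def)

lemma fm [measurable]: "f i \<in> borel_measurable borel"
  by (rule loc_int_measurable[OF li])

lemma swf: "sq_int (\<lambda>x. log_weight x * f i x)"
  by (rule sq_int_log_weight_mult_weak_gradient[OF wg sg])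

definition mollified :: "nat \<Rightarrow> 2 \<Rightarrow> plane \<Rightarrow> real" where "mollified n i = conv (f i) (mollifier n)"

lemma mollified_smooth: "smooth (mollified n i)"
  unfolding mollified_def by (rule smooth_conv[OF li mollifier_test])

lemma mollified_measurable [measurable]: "mollified n i \<in> borel_measurable borel"
  by (rule smooth_measurable[OF mollified_smooth])

lemma mollified_grad: "L2_tendsto (\<lambda>n. partial_deriv j (mollified n i)) (g i j)"
  unfolding mollified_def by (rule L2_tendsto_weak_gradient_conv[OF wg sg])

lemma mollified_grad_sq_int: "sq_int (partial_deriv j (mollified n i))"
  using mollified_grad by (simp add: L2_tendsto_def)

lemma mollified_div: "(\<Sum>i\<in>UNIV. partial_deriv i (mollified n i) x) = 0"
proof -
  have sm: "smooth (mollifier n)" by (rule test_function_smooth[OF mollifier_test])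
  have "partial_deriv i (mollified n i) x = - (\<integral>y. f i y * partial_deriv i (\<lambda>y. mollifier n (x - y)) y \<partial>lborel)" for i
    unfolding mollified_def partial_deriv_conv[OF li mollifier_test] partial_deriv_reflect(2)[OF smooth_diff[OF sm]] by (simp add: conv_def)
  then show ?thesis
    using dv test_function_reflect[OF mollifier_test[of n], of x] by (simp add: sum_negf div_free_def)
qed

lemma mollified_log_weight: "sq_int (\<lambda>x. log_weight x * mollified n i x)"
proof (rule sq_int_log_weight_mult_weak_gradient[OF _ mollified_grad_sq_int])
  show "weak_gradient (mollified n i) (\<lambda>j. partial_deriv j (mollified n i))"
    unfolding weak_gradient_def using integral_by_parts_test[OF _ mollified_smooth]
    by (auto intro: continuous_loc_int smooth_continuous mollified_smooth smooth_partial_deriv)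
qed

lemmas mollified_cutoff = cutoff_fields[OF mollified_smooth mollified_div mollified_grad_sq_int mollified_log_weight]

text \<open>Only gradients are paired, so convergence of the test fields themselves plays no part:
  the cutoff is removed at fixed \<open>n\<close> by \<open>mollified_cutoff\<close>, then the
  mollification. Hence even a field without decay, such as \<open>u\<close>, can be
  inserted.\<close>

lemma orthogonal:
  assumes T: "\<And>i j. sq_int (T i j)" and z: "\<And>\<phi>. sol_test_field \<phi> \<Longrightarrow> tensor_ip T (grad_entry \<phi>) = 0"
  shows "tensor_ip T g = 0"
proof -
  have "tensor_ip T (\<lambda>i j. partial_deriv j (mollified n i)) = 0" for n
  proof (rule mollified_cutoff[of n])
    fix \<phi> assume \<phi>: "\<And>m. sol_test_field (\<phi> m)"
      and lim: "\<And>i j. L2_tendsto (\<lambda>m x. grad (\<phi> m) x $ i $ j) (partial_deriv j (mollified n i))"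
    have "(\<lambda>m. tensor_ip T (grad_entry (\<phi> m))) \<longlonglongrightarrow> tensor_ip T (\<lambda>i j. partial_deriv j (mollified n i))"
      by (rule tensor_ip_tendsto[OF L2_tendsto_const[OF T]]) (use lim in \<open>simp add: grad_entry_def[abs_def]\<close>)
    then show ?thesis unfolding z[OF \<phi>] by (simp add: LIMSEQ_const_iff)
  qed
  moreover have "(\<lambda>n. tensor_ip T (\<lambda>i j. partial_deriv j (mollified n i))) \<longlonglongrightarrow> tensor_ip T g"
    by (rule tensor_ip_tendsto[OF L2_tendsto_const[OF T] mollified_grad])
  ultimately show ?thesis by (simp add: LIMSEQ_const_iff)
qed

end

text \<open>The velocity minus its limit at infinity, with a bound on each component. The bound
  makes the field itself square integrable, as the weight is.\<close>

locale decaying = solenoidal +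
  fixes B :: real
  assumes B: "B \<ge> 0" and decay: "\<And>i. AE x in lborel. \<bar>f i x\<bar> \<le> B * log_weight x"
begin

lemma sf: "sq_int (f i)"
proof (rule sq_int_dominated[OF sq_int_log_weight, where C=B])
  show "AE x in lborel. \<bar>f i x\<bar> \<le> B * \<bar>log_weight x\<bar>" using decay[of i] by eventually_elim (simp add: log_weight_pos less_imp_le)
qed measurable

lemma mollified_bound: "\<bar>mollified n i x\<bar> \<le> 6 * B * log_weight x"
  unfolding mollified_def by (rule conv_mollifier_log_weight_bound[OF li decay B])

lemma mollified_L2: "L2_tendsto (\<lambda>n. mollified n i) (f i)"
  unfolding mollified_def by (rule L2_tendsto_conv_mollifier[OF sf])

text \<open>The squared errors of both components are summed before a subsequence is extracted, so
  that one subsequence serves both.\<close>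

lemma mollified_AE_subseq:
  obtains r where "strict_mono r" "\<And>i. AE x in lborel. (\<lambda>n. mollified (r n) i x) \<longlonglongrightarrow> f i x"
proof -
  define U where "U n x = (\<Sum>i\<in>UNIV. (mollified n i x - f i x)\<^sup>2)" for n x
  have i: "integrable lborel (\<lambda>x. (mollified n i x - f i x)\<^sup>2)" for n i
    using sq_int_diff[OF _ sf] mollified_L2[of i] by (auto simp: L2_tendsto_def sq_int_def)
  have U0: "U n x \<ge> 0" for n x by (simp add: U_def sum_nonneg)
  have Ui: "integrable lborel (U n)" for n unfolding U_def using i by simp
  have "(\<lambda>n. \<Sum>i\<in>UNIV. \<integral>x. (mollified n i x - f i x)\<^sup>2 \<partial>lborel) \<longlonglongrightarrow> (\<Sum>i\<in>(UNIV::2 set). 0)"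
    using mollified_L2 by (intro tendsto_sum) (auto simp: L2_tendsto_def)
  then have "(\<lambda>n. \<integral>x. \<bar>U n x\<bar> \<partial>lborel) \<longlonglongrightarrow> 0"
    using i U0 by (simp add: abs_of_nonneg) (simp add: U_def)
  then obtain r where r: "strict_mono r" "AE x in lborel. (\<lambda>n. U (r n) x) \<longlonglongrightarrow> 0"
    by (rule AE_subseq_L1[OF Ui])
  have "AE x in lborel. (\<lambda>n. mollified (r n) i x) \<longlonglongrightarrow> f i x" for i
    using r(2)
  proof eventually_elim
    case (elim x)
    have "(\<lambda>n. (mollified (r n) i x - f i x)\<^sup>2) \<longlonglongrightarrow> 0"
    proof (rule Lim_null_comparison[OF _ elim])
      have "(mollified (r n) i x - f i x)\<^sup>2 \<le> U (r n) x" for n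
        unfolding U_def by (rule member_le_sum) auto
      then show "\<forall>\<^sub>F n in sequentially. norm ((mollified (r n) i x - f i x)\<^sup>2) \<le> U (r n) x" by simp
    qed
    then have "(\<lambda>n. mollified (r n) i x - f i x) \<longlonglongrightarrow> 0" by (simp add: power_tendsto_0_iff)
    then show ?case by (rule LIM_zero_cancel)
  qed
  with r(1) that show thesis by blast
qed

text \<open>Only the transporting field \<open>v\<close> has to be divergence-free. It may lack
  decay, because the compact support of \<open>\<phi>\<close> makes the products with
  \<open>v\<close> square integrable, while \<open>f\<close> is square integrable by its
  decay.\<close>

lemma convection_by_parts:
  assumes w: "\<And>j. sq_int (\<lambda>x. log_weight x * v j x)" and v: "\<And>j. loc_int (v j)" "div_free v" and \<phi>: "sol_test_field \<phi>"
  shows "tensor_ip g (\<lambda>i j x. v j x * \<phi> x $ i) = - tensor_ip (\<lambda>i j x. f i x * v j x) (grad_entry \<phi>)"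
proof -
  have vm [measurable]: "v j \<in> borel_measurable borel" for j by (rule loc_int_measurable[OF v(1)])
  note t = sol_test_component(1)[OF \<phi>] and tg = sol_test_grad_entry(1)[OF \<phi>]
  have s1: "sq_int (\<lambda>x. v j x * \<phi> x $ i)" for i j by (rule sq_int_mult_test[OF w vm t])
  have s2: "sq_int (\<lambda>x. v j x * grad_entry \<phi> i j x)" for i j by (rule sq_int_mult_test[OF w vm tg])
  have eq: "tensor_ip (\<lambda>i j. partial_deriv j (mollified n i)) (\<lambda>i j x. v j x * \<phi> x $ i) = - tensor_ip (\<lambda>i j. mollified n i) (\<lambda>i j x. v j x * grad_entry \<phi> i j x)" for n
  proof -
    have s: "smooth (\<lambda>x. \<phi> x $ i)" for i by (rule test_function_smooth[OF t])
    \<comment> \<open>The scalar product of the mollified field with \<open>\<phi>\<close> is a test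
      function for the weak divergence of \<open>v\<close>; the product rule then gives the two
      sides of the identity.\<close>
    have tt: "test_function (\<lambda>x. mollified n i x * \<phi> x $ i)" for i by (rule test_function_mult_right[OF t mollified_smooth])
    then have "test_function (\<lambda>x. \<Sum>i\<in>UNIV. mollified n i x * \<phi> x $ i)" by (intro test_function_sum) auto
    then have "0 = (\<Sum>j\<in>UNIV. \<integral>x. v j x * partial_deriv j (\<lambda>x. \<Sum>i\<in>UNIV. mollified n i x * \<phi> x $ i) x \<partial>lborel)"
      using v(2) by (simp add: div_free_def)
    also have "\<dots> = (\<Sum>j\<in>UNIV. \<Sum>i\<in>UNIV. (\<integral>x. partial_deriv j (mollified n i) x * (v j x * \<phi> x $ i) \<partial>lborel) + (\<integral>x. mollified n i x * (v j x * grad_entry \<phi> i j x) \<partial>lborel))"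
    proof (rule sum.cong[OF refl])
      fix j
      have i1: "integrable lborel (\<lambda>x. partial_deriv j (mollified n i) x * (v j x * \<phi> x $ i))" for i
        by (rule sq_int_mult[OF mollified_grad_sq_int s1])
      have i2: "integrable lborel (\<lambda>x. mollified n i x * (v j x * grad_entry \<phi> i j x))" for i
        using mollified_L2[of i] by (intro sq_int_mult[OF _ s2]) (simp add: L2_tendsto_def)
      have "(\<lambda>x. v j x * partial_deriv j (\<lambda>x. \<Sum>i\<in>UNIV. mollified n i x * \<phi> x $ i) x)
        = (\<lambda>x. \<Sum>i\<in>UNIV. partial_deriv j (mollified n i) x * (v j x * \<phi> x $ i) + mollified n i x * (v j x * grad_entry \<phi> i j x))"
        unfolding partial_deriv_sum[OF test_function_smooth[OF tt]] partial_deriv_mult[OF mollified_smooth s] sol_test_component(2)[OF \<phi>]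
        by (rule ext) (simp add: sum_distrib_left algebra_simps)
      then show "(\<integral>x. v j x * partial_deriv j (\<lambda>x. \<Sum>i\<in>UNIV. mollified n i x * \<phi> x $ i) x \<partial>lborel)
        = (\<Sum>i\<in>UNIV. (\<integral>x. partial_deriv j (mollified n i) x * (v j x * \<phi> x $ i) \<partial>lborel) + (\<integral>x. mollified n i x * (v j x * grad_entry \<phi> i j x) \<partial>lborel))"
        using i1 i2 by simp
    qed
    finally show ?thesis
      unfolding tensor_ip_def by (subst (asm) sum.swap) (simp add: sum.distrib)
  qed
  have "(\<lambda>n. tensor_ip (\<lambda>i j. partial_deriv j (mollified n i)) (\<lambda>i j x. v j x * \<phi> x $ i)) \<longlonglongrightarrow> tensor_ip g (\<lambda>i j x. v j x * \<phi> x $ i)"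
    by (rule tensor_ip_tendsto[OF mollified_grad L2_tendsto_const[OF s1]])
  moreover have "(\<lambda>n. - tensor_ip (\<lambda>i j. mollified n i) (\<lambda>i j x. v j x * grad_entry \<phi> i j x)) \<longlonglongrightarrow> - tensor_ip (\<lambda>i j. f i) (\<lambda>i j x. v j x * grad_entry \<phi> i j x)"
    by (rule tendsto_minus[OF tensor_ip_tendsto[OF mollified_L2 L2_tendsto_const[OF s2]]])
  ultimately have "tensor_ip g (\<lambda>i j x. v j x * \<phi> x $ i) = - tensor_ip (\<lambda>i j. f i) (\<lambda>i j x. v j x * grad_entry \<phi> i j x)"
    unfolding eq by (rule LIMSEQ_unique)
  also have "tensor_ip (\<lambda>i j. f i) (\<lambda>i j x. v j x * grad_entry \<phi> i j x) = tensor_ip (\<lambda>i j x. f i x * v j x) (grad_entry \<phi>)"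
    by (simp add: tensor_ip_def mult.assoc)
  finally show ?thesis .
qed

text \<open>Here the convection term must converge as well, against a \<open>u\<close> known only in
  weighted \<open>L^2\<close>. The test fields stay below a multiple of \<open>log_weight\<close>
  during each of the two limits, and almost everywhere convergence then allows domination; for the
  mollification this requires a subsequence.\<close>

lemma admissible:
  assumes P: "\<And>i j. sq_int (P i j)" and G: "\<And>i j. sq_int (G i j)"
    and w: "\<And>j. sq_int (\<lambda>x. log_weight x * u j x)" and um [measurable]: "\<And>j. u j \<in> borel_measurable borel"
    and z: "\<And>\<phi>. sol_test_field \<phi> \<Longrightarrow> tensor_ip P (grad_entry \<phi>) + tensor_ip G (\<lambda>i j x. u j x * \<phi> x $ i) = 0"
  shows "tensor_ip P g + tensor_ip G (\<lambda>i j x. u j x * f i x) = 0"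
proof -
  have eq: "tensor_ip P (\<lambda>i j. partial_deriv j (mollified n i)) + tensor_ip G (\<lambda>i j x. u j x * mollified n i x) = 0" for n
  proof (rule mollified_cutoff[of n])
    fix \<phi> assume \<phi>: "\<And>m. sol_test_field (\<phi> m)"
      and lim: "\<And>i j. L2_tendsto (\<lambda>m x. grad (\<phi> m) x $ i $ j) (partial_deriv j (mollified n i))"
      and pt: "\<And>i x. (\<lambda>m. \<phi> m x $ i) \<longlonglongrightarrow> mollified n i x"
      and bd: "\<And>K. (\<And>i x. \<bar>mollified n i x\<bar> \<le> K * log_weight x) \<Longrightarrow> \<exists>K'. \<forall>m i x. \<bar>\<phi> m x $ i\<bar> \<le> K' * log_weight x"
    obtain K where K: "\<And>m i x. \<bar>\<phi> m x $ i\<bar> \<le> K * log_weight x" using bd[OF mollified_bound] by blast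
    have pm: "(\<lambda>x. \<phi> m x $ i) \<in> borel_measurable borel" for m i
      by (rule smooth_measurable[OF test_function_smooth[OF sol_test_component(1)[OF \<phi>]]])
    have "(\<lambda>m. tensor_ip P (grad_entry (\<phi> m)) + tensor_ip G (\<lambda>i j x. u j x * \<phi> m x $ i)) \<longlonglongrightarrow>
      tensor_ip P (\<lambda>i j. partial_deriv j (mollified n i)) + tensor_ip G (\<lambda>i j x. u j x * mollified n i x)"
    proof (intro tendsto_add tensor_ip_tendsto[OF L2_tendsto_const[OF P]] tensor_ip_tendsto[OF L2_tendsto_const[OF G]])
      show "L2_tendsto (\<lambda>m. grad_entry (\<phi> m) i j) (partial_deriv j (mollified n i))" for i j
        using lim by (simp add: grad_entry_def[abs_def])
      show "L2_tendsto (\<lambda>m x. u j x * \<phi> m x $ i) (\<lambda>x. u j x * mollified n i x)" for i j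
        by (rule L2_tendsto_mult_le_log_weight[OF w um pm mollified_measurable K AE_I2[OF pt]])
    qed
    then show ?thesis unfolding z[OF \<phi>] by (simp add: LIMSEQ_const_iff)
  qed
  obtain r where r: "strict_mono r" "\<And>i. AE x in lborel. (\<lambda>n. mollified (r n) i x) \<longlonglongrightarrow> f i x"
    by (rule mollified_AE_subseq) blast
  have "(\<lambda>n. tensor_ip P (\<lambda>i j. partial_deriv j (mollified (r n) i)) + tensor_ip G (\<lambda>i j x. u j x * mollified (r n) i x)) \<longlonglongrightarrow> tensor_ip P g + tensor_ip G (\<lambda>i j x. u j x * f i x)"
  proof (intro tendsto_add tensor_ip_tendsto[OF L2_tendsto_const[OF P]] tensor_ip_tendsto[OF L2_tendsto_const[OF G]])
    show "L2_tendsto (\<lambda>n. partial_deriv j (mollified (r n) i)) (g i j)" for i j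
      by (rule L2_tendsto_subseq[OF mollified_grad r(1)])
    show "L2_tendsto (\<lambda>n x. u j x * mollified (r n) i x) (\<lambda>x. u j x * f i x)" for i j
      by (rule L2_tendsto_mult_le_log_weight[OF w um mollified_measurable fm mollified_bound r(2)])
  qed
  then show ?thesis unfolding eq by (simp add: LIMSEQ_const_iff)
qed

text \<open>The transport term is the divergence of \<open>d |f|^2 / 2\<close>; the cutoff error is
  controlled by \<open>log_weight * d\<close> and \<open>log_weight\<close>, both square integrable.\<close>

lemma transport_zero:
  assumes w: "\<And>j. sq_int (\<lambda>x. log_weight x * d j x)" and dl: "\<And>j. loc_int (d j)" and dd: "div_free d"
  shows "tensor_ip g (\<lambda>i j x. d j x * f i x) = 0"
proof -
  have dm [measurable]: "d j \<in> borel_measurable borel" for j by (rule loc_int_measurable[OF dl])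
  obtain C where C: "C > 0" "\<And>N j x. N \<ge> 1 \<Longrightarrow> \<bar>partial_deriv j (cutoff N) x\<bar> \<le> C / N * log_weight x"
    using cutoff_bounds by metis
  define N where "N n = real (Suc n)" for n
  have N: "N n \<ge> 1" for n by (simp add: N_def)
  define K where "K = 6 * B"
  have K: "\<bar>mollified n i x\<bar> \<le> K * log_weight x" for n i x unfolding K_def by (rule mollified_bound)
  have K0: "K \<ge> 0" using B by (simp add: K_def)
  have pm [measurable]: "partial_deriv j (cutoff N) \<in> borel_measurable borel" "partial_deriv j (mollified n i) \<in> borel_measurable borel" for j N n i
    by (intro smooth_measurable smooth_partial_deriv smooth_cutoff mollified_smooth)+
  have eq: "tensor_ip (\<lambda>i j. partial_deriv j (mollified n i)) (\<lambda>i j x. d j x * mollified n i x) = 0" for n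
  proof -
    define a where "a i = mollified n i" for i
    have sa: "smooth (a i)" for i unfolding a_def by (rule mollified_smooth)
    have am [measurable]: "a i \<in> borel_measurable borel" for i unfolding a_def by measurable
    have ga: "sq_int (partial_deriv j (a i))" for i j unfolding a_def by (rule mollified_grad_sq_int)
    have Ka: "\<bar>a i x\<bar> \<le> K * log_weight x" for i x unfolding a_def by (rule K)
    \<comment> \<open>The division by \<open>log_weight\<close> is compensated by pairing with
      \<open>log_weight * d\<close>, the form in which \<open>d\<close> is square
      integrable.\<close>
    define e where "e i j m x = partial_deriv j (cutoff (N m)) x * (a i x * a i x) / log_weight x" for i j m x
    have e_le: "\<bar>e i j m x\<bar> \<le> C * K\<^sup>2 / N m * log_weight x" for i j m x
    proof -
      have "\<bar>a i x\<bar> * \<bar>a i x\<bar> \<le> (K * log_weight x) * (K * log_weight x)" by (intro mult_mono Ka) (auto intro: order_trans[OF abs_ge_zero Ka])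
      from mult_mono[OF C(2)[OF N[of m], of j x] this]
      have "\<bar>partial_deriv j (cutoff (N m)) x * (a i x * a i x)\<bar> \<le> (C / N m * log_weight x) * ((K * log_weight x) * (K * log_weight x))"
        using C(1) N[of m] log_weight_pos[of x] by (simp add: abs_mult)
      also have "\<dots> = (C * K\<^sup>2 / N m * log_weight x) * log_weight x * log_weight x" by (simp add: power2_eq_square)
      \<comment> \<open>Three weights are available, one from the cutoff and two from
        \<open>a\<close>. One is cancelled by the division in \<open>e\<close>, one is estimated by
        1, and the last is kept for square integrability.\<close>
      also have "\<dots> \<le> (C * K\<^sup>2 / N m * log_weight x) * log_weight x * 1"
        using C(1) N[of m] log_weight_pos[of x] log_weight_le_1[of x] by (intro mult_left_mono) auto
      finally show ?thesis
        using log_weight_pos[of x] by (simp add: e_def abs_div_pos[symmetric] pos_divide_le_eq)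
    qed
    have e0: "L2_tendsto (e i j) (\<lambda>_. 0)" for i j
    proof (rule L2_tendsto_dominated[where g="\<lambda>x. C * K\<^sup>2 * log_weight x"])
      show "sq_int (\<lambda>x. C * K\<^sup>2 * log_weight x)" by (intro sq_int_cmult sq_int_log_weight)
      show "e i j m \<in> borel_measurable borel" for m unfolding e_def[abs_def] by measurable
      show "AE x in lborel. \<bar>e i j m x\<bar> \<le> C * K\<^sup>2 * log_weight x" for m
      proof (rule AE_I2)
        fix x
        have "C * K\<^sup>2 / N m * log_weight x \<le> C * K\<^sup>2 * log_weight x"
          using frac_le[of "C * K\<^sup>2" "C * K\<^sup>2" 1 "N m"] C(1) N[of m] log_weight_pos[of x] by (intro mult_right_mono) auto
        then show "\<bar>e i j m x\<bar> \<le> C * K\<^sup>2 * log_weight x" using e_le[of i j m x] by linarith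
      qed
      show "AE x in lborel. (\<lambda>m. e i j m x) \<longlonglongrightarrow> 0"
      proof (rule AE_I2)
        fix x
        have "(\<lambda>m. C * K\<^sup>2 * log_weight x * inverse (real (Suc m))) \<longlonglongrightarrow> C * K\<^sup>2 * log_weight x * 0"
          by (intro tendsto_mult tendsto_const LIMSEQ_inverse_real_of_nat)
        then have "(\<lambda>m. C * K\<^sup>2 / N m * log_weight x) \<longlonglongrightarrow> 0" by (simp add: N_def divide_inverse mult_ac)
        then show "(\<lambda>m. e i j m x) \<longlonglongrightarrow> 0"
          by (rule Lim_null_comparison[rotated]) (intro always_eventually allI, unfold real_norm_def, rule e_le)
      qed
    qed simp
    have c1: "L2_tendsto (\<lambda>m x. d j x * (cutoff (N m) x * a i x)) (\<lambda>x. d j x * a i x)" for i j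
    proof (rule L2_tendsto_mult_le_log_weight[OF w dm, where K=K])
      show "\<bar>cutoff (N m) x * a i x\<bar> \<le> K * log_weight x" for m x
        using mult_mono[OF cutoff_le_1[OF N[of m], of x] Ka[of i x]] cutoff_nonneg[of "N m" x] by (simp add: abs_mult)
      have "(\<lambda>m. cutoff (N m) x * a i x) \<longlonglongrightarrow> 1 * a i x" for x
        unfolding N_def by (intro tendsto_mult tendsto_const cutoff_tendsto)
      then show "AE x in lborel. (\<lambda>m. cutoff (N m) x * a i x) \<longlonglongrightarrow> a i x" by simp
    qed measurable
    \<comment> \<open>The weak divergence of \<open>d\<close> is tested with
      \<open>cutoff (N m) * |a|^2\<close>; the factor 2 is the derivative of the square.\<close>
    have z: "tensor_ip (\<lambda>i j. e i j m) (\<lambda>i j x. log_weight x * d j x) + 2 * tensor_ip (\<lambda>i j. partial_deriv j (a i)) (\<lambda>i j x. d j x * (cutoff (N m) x * a i x)) = 0" for m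
    proof -
      have tt: "test_function (\<lambda>x. cutoff (N m) x * (a i x * a i x))" for i
        by (intro test_function_mult_left cutoff_test N smooth_mult sa)
      then have "test_function (\<lambda>x. \<Sum>i\<in>UNIV. cutoff (N m) x * (a i x * a i x))" by (intro test_function_sum) auto
      then have "0 = (\<Sum>j\<in>UNIV. \<integral>x. d j x * partial_deriv j (\<lambda>x. \<Sum>i\<in>UNIV. cutoff (N m) x * (a i x * a i x)) x \<partial>lborel)"
        using dd by (simp add: div_free_def)
      also have "\<dots> = (\<Sum>j\<in>UNIV. \<Sum>i\<in>UNIV. (\<integral>x. e i j m x * (log_weight x * d j x) \<partial>lborel)
          + 2 * (\<integral>x. partial_deriv j (a i) x * (d j x * (cutoff (N m) x * a i x)) \<partial>lborel))"
      proof (rule sum.cong[OF refl])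
        fix j
        have i1: "integrable lborel (\<lambda>x. e i j m x * (log_weight x * d j x))" for i
          using e0[of i j] by (intro sq_int_mult w) (simp add: L2_tendsto_def)
        have i2: "integrable lborel (\<lambda>x. partial_deriv j (a i) x * (d j x * (cutoff (N m) x * a i x)))" for i
          using c1[of j i] by (intro sq_int_mult ga) (simp add: L2_tendsto_def)
        have "d j x * partial_deriv j (\<lambda>x. \<Sum>i\<in>UNIV. cutoff (N m) x * (a i x * a i x)) x
          = (\<Sum>i\<in>UNIV. e i j m x * (log_weight x * d j x) + 2 * (partial_deriv j (a i) x * (d j x * (cutoff (N m) x * a i x))))" for x
        proof -
          have h: "e i j m x * (log_weight x * d j x) = partial_deriv j (cutoff (N m)) x * (a i x * a i x) * d j x" for i
            using log_weight_pos[of x] by (simp add: e_def)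
          then show ?thesis
            unfolding partial_deriv_sum[OF test_function_smooth[OF tt]] partial_deriv_mult[OF smooth_cutoff smooth_mult[OF sa sa]]
              partial_deriv_mult[OF sa sa] h
            by (simp add: sum_distrib_left algebra_simps)
        qed
        then show "(\<integral>x. d j x * partial_deriv j (\<lambda>x. \<Sum>i\<in>UNIV. cutoff (N m) x * (a i x * a i x)) x \<partial>lborel)
          = (\<Sum>i\<in>UNIV. (\<integral>x. e i j m x * (log_weight x * d j x) \<partial>lborel) + 2 * (\<integral>x. partial_deriv j (a i) x * (d j x * (cutoff (N m) x * a i x)) \<partial>lborel))"
          using i1 i2 by simp
      qed
      finally show ?thesis
        unfolding tensor_ip_def sum_distrib_left by (subst (asm) sum.swap) (simp add: sum.distrib)
    qed
    have "(\<lambda>m. tensor_ip (\<lambda>i j. e i j m) (\<lambda>i j x. log_weight x * d j x) + 2 * tensor_ip (\<lambda>i j. partial_deriv j (a i)) (\<lambda>i j x. d j x * (cutoff (N m) x * a i x)))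
      \<longlonglongrightarrow> tensor_ip (\<lambda>i j x. 0) (\<lambda>i j x. log_weight x * d j x) + 2 * tensor_ip (\<lambda>i j. partial_deriv j (a i)) (\<lambda>i j x. d j x * a i x)"
      by (intro tendsto_add tendsto_mult tendsto_const tensor_ip_tendsto e0 c1 L2_tendsto_const w ga)
    then have "tensor_ip (\<lambda>i j. partial_deriv j (a i)) (\<lambda>i j x. d j x * a i x) = 0"
      unfolding z by (simp add: LIMSEQ_const_iff tensor_ip_def)
    then show ?thesis by (simp only: a_def)
  qed
  obtain r where r: "strict_mono r" "\<And>i. AE x in lborel. (\<lambda>n. mollified (r n) i x) \<longlonglongrightarrow> f i x"
    by (rule mollified_AE_subseq) blast
  have "(\<lambda>n. tensor_ip (\<lambda>i j. partial_deriv j (mollified (r n) i)) (\<lambda>i j x. d j x * mollified (r n) i x)) \<longlonglongrightarrow> tensor_ip g (\<lambda>i j x. d j x * f i x)"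
  proof (rule tensor_ip_tendsto)
    show "L2_tendsto (\<lambda>n. partial_deriv j (mollified (r n) i)) (g i j)" for i j
      by (rule L2_tendsto_subseq[OF mollified_grad r(1)])
    show "L2_tendsto (\<lambda>n x. d j x * mollified (r n) i x) (\<lambda>x. d j x * f i x)" for i j
      by (rule L2_tendsto_mult_le_log_weight[OF w dm mollified_measurable fm K r(2)])
  qed
  then show ?thesis unfolding eq by (simp add: LIMSEQ_const_iff)
qed

end

subsection \<open>The weak-strong uniqueness argument\<close>

lemma average_diff:
  assumes A: "A \<in> sets borel" "bounded A" and l: "loc_int f" "loc_int g"
  shows "average A (\<lambda>x. f x - g x) = average A f - average A g"
proof -
  obtain S where "\<forall>x\<in>A. norm x \<le> S" using A(2) bounded_iff by blast
  then have S: "A \<subseteq> cball 0 S" by auto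
  note i = loc_int_indicator[OF _ A(1) S]
  show ?thesis unfolding average_def right_diff_distrib Bochner_Integration.integral_diff[OF i[OF l(1)] i[OF l(2)]]
    by (simp add: diff_divide_distrib)
qed

lemma sq_int_zero_AE:
  assumes "sq_int f" "(\<integral>x. (f x)\<^sup>2 \<partial>lborel) \<le> 0"
  shows "AE x in lborel. f x = 0"
proof -
  have "(\<integral>x. (f x)\<^sup>2 \<partial>lborel) = 0" using assms(2) by (simp add: antisym)
  then have "AE x in lborel. (f x)\<^sup>2 = 0"
    using assms(1) by (subst (asm) integral_nonneg_eq_0_iff_AE) (auto simp: sq_int_def)
  then show ?thesis by simp
qed

lemma tensor_ip_self: "tensor_ip g g = (\<Sum>i\<in>UNIV. dirichlet (g i))"
  by (simp add: tensor_ip_def dirichlet_def power2_eq_square)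

lemma div_free_diff:
  assumes "div_free f" "div_free g" "\<And>i. loc_int (f i)" "\<And>i. loc_int (g i)"
  shows "div_free (\<lambda>i x. f i x - g i x)"
  unfolding div_free_def
proof (intro allI impI)
  fix \<eta> :: "plane \<Rightarrow> real" assume t: "test_function \<eta>"
  have "(\<integral>x. (f j x - g j x) * partial_deriv j \<eta> x \<partial>lborel) = (\<integral>x. f j x * partial_deriv j \<eta> x \<partial>lborel) - (\<integral>x. g j x * partial_deriv j \<eta> x \<partial>lborel)" for j
    using loc_int_mult_test[OF assms(3) test_function_partial_deriv[OF t]] loc_int_mult_test[OF assms(4) test_function_partial_deriv[OF t]]
    by (simp add: left_diff_distrib)
  then show "(\<Sum>j\<in>UNIV. \<integral>x. (f j x - g j x) * partial_deriv j \<eta> x \<partial>lborel) = 0"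
    using assms(1,2) t by (simp add: sum_subtractf div_free_def)
qed

lemma solenoidal_const: "solenoidal (\<lambda>i _. c i) (\<lambda>_ _ _. 0)"
  by unfold_locales (auto simp: weak_gradient_const sq_int_zero div_free_def integral_partial_deriv_test)

lemma solenoidal_diff:
  assumes "solenoidal u G" "solenoidal v H"
  shows "solenoidal (\<lambda>i x. u i x - v i x) (\<lambda>i j x. G i j x - H i j x)"
proof -
  interpret u: solenoidal u G by fact
  interpret v: solenoidal v H by fact
  show ?thesis
    by unfold_locales (auto intro: weak_gradient_diff u.wg v.wg sq_int_diff u.sg v.sg div_free_diff u.dv v.dv u.li v.li)
qed

text \<open>The convection term is written as the pairing of \<open>G\<close> with the tensor of
  entries \<open>u j * \<phi> i\<close>, the form in which both factors are square
  integrable.\<close>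

definition weak_NS :: "(2 \<Rightarrow> 2 \<Rightarrow> plane \<Rightarrow> real) \<Rightarrow> (2 \<Rightarrow> plane \<Rightarrow> real) \<Rightarrow> (2 \<Rightarrow> 2 \<Rightarrow> plane \<Rightarrow> real) \<Rightarrow> bool" where
  "weak_NS F u G \<longleftrightarrow> solenoidal u G \<and>
    (\<forall>\<phi>. sol_test_field \<phi> \<longrightarrow> tensor_ip G (grad_entry \<phi>) + tensor_ip G (\<lambda>i j x. u j x * \<phi> x $ i) = tensor_ip F (grad_entry \<phi>))"

lemma energy_difference_le:
  assumes F: "\<And>i j. sq_int (F i j)" and u: "weak_NS F u G" and v: "weak_NS F v H"
    and eu: "tensor_ip G G \<le> tensor_ip F G" and ev: "tensor_ip H H \<le> tensor_ip F H"
    and B: "B \<ge> 0" and dec: "\<And>i. AE x in lborel. \<bar>v i x - c i\<bar> \<le> B * log_weight x"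
  shows "tensor_ip (\<lambda>i j x. G i j x - H i j x) (\<lambda>i j x. G i j x - H i j x)
    \<le> tensor_ip (\<lambda>i j x. G i j x - H i j x) (\<lambda>i j x. (u j x - v j x) * (v i x - c i))"
proof -
  interpret u: solenoidal u G using u by (simp add: weak_NS_def)
  interpret v: solenoidal v H using v by (simp add: weak_NS_def)
  interpret d: solenoidal "\<lambda>i x. u i x - v i x" "\<lambda>i j x. G i j x - H i j x"
    by (rule solenoidal_diff[OF u.solenoidal_axioms v.solenoidal_axioms])
  \<comment> \<open>Subtracting a constant leaves the gradient unchanged, so \<open>H\<close> serves
    for \<open>v\<close> and for \<open>v - c\<close>.\<close>
  have "solenoidal (\<lambda>i x. v i x - c i) (\<lambda>i j x. H i j x - 0)"
    by (rule solenoidal_diff[OF v.solenoidal_axioms solenoidal_const])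
  then interpret s: solenoidal "\<lambda>i x. v i x - c i" H by simp
  interpret p: decaying "\<lambda>i x. v i x - c i" H B
    by unfold_locales (auto simp: B dec)
  define vp where "vp i x = v i x - c i" for i x
  have vpm [measurable]: "vp i \<in> borel_measurable borel" for i unfolding vp_def by measurable
  have prod: "sq_int (\<lambda>x. h x * vp i x)" if "sq_int (\<lambda>x. log_weight x * h x)" "h \<in> borel_measurable borel" for h i
    using dec[of i] by (intro sq_int_mult_le_log_weight[OF that vpm, where K=B]) (simp add: vp_def)
  have su: "sq_int (\<lambda>x. u j x * vp i x)" and sv: "sq_int (\<lambda>x. v j x * vp i x)" and sd: "sq_int (\<lambda>x. (u j x - v j x) * vp i x)" for i j
    by (rule prod[OF u.swf], measurable) (rule prod[OF v.swf], measurable, rule prod[OF d.swf], measurable)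
  have sv': "sq_int (\<lambda>x. vp i x * v j x)" for i j using sv[of j i] by (simp add: mult.commute)
  have sgr: "sq_int (grad_entry \<phi> i j)" if "sol_test_field \<phi>" for \<phi> i j using sol_test_grad_entry(2)[OF that] .
  \<comment> \<open>Since \<open>v\<close> and \<open>vp\<close> have the same gradient, the
    convection term of \<open>v\<close> equals minus the pairing of \<open>vp i * v j\<close> with
    \<open>grad \<phi>\<close>. The whole equation then states that one square integrable tensor is
    orthogonal to gradients of test fields.\<close>
  have v_eq: "tensor_ip (\<lambda>i j x. (H i j x - F i j x) - vp i x * v j x) (grad_entry \<phi>) = 0" if \<phi>: "sol_test_field \<phi>" for \<phi>
  proof -
    have "tensor_ip (\<lambda>i j x. (H i j x - F i j x) - vp i x * v j x) (grad_entry \<phi>) = tensor_ip H (grad_entry \<phi>) - tensor_ip F (grad_entry \<phi>) - tensor_ip (\<lambda>i j x. vp i x * v j x) (grad_entry \<phi>)"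
      by (simp add: tensor_ip_diff_left sq_int_diff v.sg F sv' sgr[OF \<phi>])
    moreover have "tensor_ip H (grad_entry \<phi>) + tensor_ip H (\<lambda>i j x. v j x * \<phi> x $ i) = tensor_ip F (grad_entry \<phi>)" using v \<phi> by (simp add: weak_NS_def)
    moreover have "tensor_ip H (\<lambda>i j x. v j x * \<phi> x $ i) = - tensor_ip (\<lambda>i j x. vp i x * v j x) (grad_entry \<phi>)"
      unfolding vp_def by (rule p.convection_by_parts[OF v.swf v.li v.dv \<phi>])
    ultimately show ?thesis by linarith
  qed
  \<comment> \<open>The equation of \<open>v\<close> tested with \<open>u\<close>.\<close>
  have "tensor_ip (\<lambda>i j x. (H i j x - F i j x) - vp i x * v j x) G = 0"
    by (rule u.orthogonal[OF _ v_eq]) (intro sq_int_diff v.sg F sv')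
  then have 1: "tensor_ip H G - tensor_ip F G - tensor_ip (\<lambda>i j x. vp i x * v j x) G = 0"
    by (simp add: tensor_ip_diff_left sq_int_diff v.sg u.sg F sv')
  \<comment> \<open>The equation of \<open>u\<close> tested with the decaying field
    \<open>v - c\<close>.\<close>
  have "tensor_ip (\<lambda>i j x. G i j x - F i j x) H + tensor_ip G (\<lambda>i j x. u j x * (v i x - c i)) = 0"
  proof (rule p.admissible[OF _ u.sg u.swf u.fm])
    show "sq_int (\<lambda>x. G i j x - F i j x)" for i j by (intro sq_int_diff u.sg F)
    show "tensor_ip (\<lambda>i j x. G i j x - F i j x) (grad_entry \<phi>) + tensor_ip G (\<lambda>i j x. u j x * \<phi> x $ i) = 0" if \<phi>: "sol_test_field \<phi>" for \<phi>
    proof -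
      have "tensor_ip G (grad_entry \<phi>) + tensor_ip G (\<lambda>i j x. u j x * \<phi> x $ i) = tensor_ip F (grad_entry \<phi>)" using u \<phi> by (simp add: weak_NS_def)
      then show ?thesis unfolding tensor_ip_diff_left[OF u.sg F sgr[OF \<phi>]] by linarith
    qed
  qed
  then have 2: "tensor_ip G H - tensor_ip F H + tensor_ip G (\<lambda>i j x. u j x * vp i x) = 0"
    by (simp add: tensor_ip_diff_left u.sg v.sg F vp_def)
  \<comment> \<open>The cancellation that later allows \<open>G\<close> to be replaced by
    \<open>G - H\<close> in the remaining convection term.\<close>
  have 3: "tensor_ip H (\<lambda>i j x. (u j x - v j x) * vp i x) = 0"
    unfolding vp_def by (rule p.transport_zero[OF d.swf d.li d.dv])
  have 4: "tensor_ip G (\<lambda>i j x. u j x * vp i x) - tensor_ip (\<lambda>i j x. vp i x * v j x) G = tensor_ip G (\<lambda>i j x. (u j x - v j x) * vp i x)"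
    using tensor_ip_diff_right[OF su sv u.sg] by (simp add: left_diff_distrib tensor_ip_commute[of G] mult.commute[of "vp _ _"])
  have 5: "tensor_ip (\<lambda>i j x. G i j x - H i j x) (\<lambda>i j x. (u j x - v j x) * vp i x) = tensor_ip G (\<lambda>i j x. (u j x - v j x) * vp i x)"
    using 3 by (simp add: tensor_ip_diff_left u.sg v.sg sd)
  have "tensor_ip (\<lambda>i j x. G i j x - H i j x) (\<lambda>i j x. G i j x - H i j x) = tensor_ip G G - tensor_ip G H - (tensor_ip H G - tensor_ip H H)"
    by (simp add: tensor_ip_diff_left tensor_ip_diff_right u.sg v.sg d.sg)
  \<comment> \<open>In the expansion \<open>G:G - 2 G:H + H:H\<close> the squares are bounded by
    \<open>F:G\<close> and \<open>F:H\<close>, and the identities 1 and 2 express these through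
    \<open>G:H\<close> and the two convection terms. The products \<open>G:H\<close> cancel.\<close>
  then show ?thesis using 1 2 4 5 eu ev tensor_ip_commute[of H G] unfolding vp_def by linarith
qed

text \<open>The factor 2 in the decay hypothesis is the one lost in passing from the weight of the
  theorem to \<open>log_weight\<close>. The choice of \<open>\<delta>\<close> involves only the
  Hardy constant of \<open>A\<close>.\<close>

lemma weak_strong_uniqueness:
  fixes A :: "plane set"
  assumes A: "A \<in> sets borel" "bounded A" "measure lborel A > 0"
  shows "\<exists>\<delta>>0. \<forall>F u G v H c. (\<forall>i j. sq_int (F i j)) \<longrightarrow> weak_NS F u G \<longrightarrow> weak_NS F v H \<longrightarrow>
    (\<forall>i. average A (u i) = average A (v i)) \<longrightarrow> tensor_ip G G \<le> tensor_ip F G \<longrightarrow> tensor_ip H H \<le> tensor_ip F H \<longrightarrow>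
    (\<forall>i. AE x in lborel. \<bar>v i x - c i\<bar> \<le> 2 * \<delta> * log_weight x) \<longrightarrow> (\<forall>i. AE x in lborel. u i x = v i x)"
proof -
  obtain C where C: "C > 0" "\<And>f g. weak_gradient f g \<Longrightarrow> (\<And>j. sq_int (g j)) \<Longrightarrow>
    sq_int (\<lambda>x. log_weight x * (f x - average A f)) \<and> (\<integral>x. (log_weight x * (f x - average A f))\<^sup>2 \<partial>lborel) \<le> C * dirichlet g"
    using log_Hardy_weak[OF A] by blast
  \<comment> \<open>Chosen so that \<open>2 * \<delta> * sqrt C = 1 / 8\<close>: each of the four
    entries of the pairing is then at most \<open>D / 8\<close>.\<close>
  define \<delta> where "\<delta> = 1 / (16 * sqrt C)"
  have \<delta>: "\<delta> > 0" using C(1) by (simp add: \<delta>_def)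
  have "AE x in lborel. u k x = v k x"
    if F: "\<And>i j. sq_int (F i j)" and u: "weak_NS F u G" and v: "weak_NS F v H"
      and average: "\<And>i. average A (u i) = average A (v i)" and eu: "tensor_ip G G \<le> tensor_ip F G" and ev: "tensor_ip H H \<le> tensor_ip F H"
      and dec: "\<And>i. AE x in lborel. \<bar>v i x - c i\<bar> \<le> 2 * \<delta> * log_weight x" for F u G v H c k
  proof -
    interpret u: solenoidal u G using u by (simp add: weak_NS_def)
    interpret v: solenoidal v H using v by (simp add: weak_NS_def)
    define d where "d i x = u i x - v i x" for i x
    define g where "g i j x = G i j x - H i j x" for i j x
    interpret d: solenoidal d g
      unfolding d_def[abs_def] g_def[abs_def] by (rule solenoidal_diff[OF u.solenoidal_axioms v.solenoidal_axioms])
    have "average A (d j) = 0" for j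
      unfolding d_def using average_diff[OF A(1,2) u.li v.li] average by simp
    then have Hd: "sq_int (\<lambda>x. log_weight x * d j x)" "(\<integral>x. (log_weight x * d j x)\<^sup>2 \<partial>lborel) \<le> C * dirichlet (g j)" for j
      using C(2)[OF d.wg d.sg, of j] by simp_all
    define D where "D = tensor_ip g g"
    have Dj: "dirichlet (g j) \<le> D" for j unfolding D_def tensor_ip_self by (rule member_le_sum) (auto simp: dirichlet_nonneg)
    have D0: "D \<ge> 0" using Dj dirichlet_nonneg order_trans by blast
    have gD: "(\<integral>x. (g i j x)\<^sup>2 \<partial>lborel) \<le> D" for i j
    proof -
      have "(\<integral>x. (g i j x)\<^sup>2 \<partial>lborel) \<le> dirichlet (g i)" unfolding dirichlet_def by (rule member_le_sum) auto
      then show ?thesis using Dj order_trans by blast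
    qed
    define vp where "vp i x = v i x - c i" for i x
    have vpm [measurable]: "vp i \<in> borel_measurable borel" for i unfolding vp_def by measurable
    have sd: "sq_int (\<lambda>x. d j x * vp i x)" for i j
      using dec[of i] by (intro sq_int_mult_le_log_weight[OF Hd(1) d.fm vpm, where K="2 * \<delta>"]) (simp add: vp_def)
    have sdle: "(\<integral>x. (d j x * vp i x)\<^sup>2 \<partial>lborel) \<le> (2 * \<delta>)\<^sup>2 * (C * D)" for i j
    proof -
      have "(\<integral>x. (d j x * vp i x)\<^sup>2 \<partial>lborel) \<le> (\<integral>x. (2 * \<delta>)\<^sup>2 * (log_weight x * d j x)\<^sup>2 \<partial>lborel)"
      proof (rule integral_mono_AE)
        show "AE x in lborel. (d j x * vp i x)\<^sup>2 \<le> (2 * \<delta>)\<^sup>2 * (log_weight x * d j x)\<^sup>2"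
          using dec[of i]
        proof eventually_elim
          case (elim x)
          then have "\<bar>vp i x\<bar>\<^sup>2 \<le> (2 * \<delta> * log_weight x)\<^sup>2" unfolding vp_def by (intro power_mono) auto
          then have "(d j x)\<^sup>2 * (vp i x)\<^sup>2 \<le> (d j x)\<^sup>2 * (2 * \<delta> * log_weight x)\<^sup>2" by (intro mult_left_mono) auto
          then show ?case by (simp add: power_mult_distrib mult_ac)
        qed
      qed (use sd Hd(1) in \<open>auto simp: sq_int_def\<close>)
      also have "\<dots> = (2 * \<delta>)\<^sup>2 * (\<integral>x. (log_weight x * d j x)\<^sup>2 \<partial>lborel)" by simp
      also have "\<dots> \<le> (2 * \<delta>)\<^sup>2 * (C * D)"
        using order_trans[OF Hd(2) mult_left_mono[OF Dj less_imp_le[OF C(1)]]] by (intro mult_left_mono) auto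
      finally show ?thesis .
    qed
    have "D \<le> tensor_ip g (\<lambda>i j x. d j x * vp i x)"
      unfolding D_def g_def d_def vp_def
      by (rule energy_difference_le[OF F u v eu ev _ dec]) (use \<delta> in auto)
    also have "\<dots> \<le> (\<Sum>i\<in>(UNIV::2 set). \<Sum>j\<in>(UNIV::2 set). D / 8)"
      unfolding tensor_ip_def
    proof (intro sum_mono)
      fix i j :: 2
      have "(\<integral>x. g i j x * (d j x * vp i x) \<partial>lborel) \<le> sqrt (\<integral>x. (g i j x)\<^sup>2 \<partial>lborel) * sqrt (\<integral>x. (d j x * vp i x)\<^sup>2 \<partial>lborel)"
        by (rule order_trans[OF abs_ge_self abs_integral_mult_le[OF d.sg sd]])
      also have "\<dots> \<le> sqrt D * sqrt ((2 * \<delta>)\<^sup>2 * (C * D))"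
        using D0 by (intro mult_mono real_sqrt_le_mono gD sdle) auto
      also have "\<dots> = D * (2 * \<delta> * sqrt C)"
        using D0 \<delta> C(1) by (simp add: real_sqrt_mult)
      also have "2 * \<delta> * sqrt C = 1 / 8" using C(1) by (simp add: \<delta>_def)
      finally show "(\<integral>x. g i j x * (d j x * vp i x) \<partial>lborel) \<le> D / 8" by simp
    qed
    also have "\<dots> = D / 2" by simp
    \<comment> \<open>The four entries add up to \<open>D \<le> D / 2\<close>. The Hardy inequality,
      with zero average of \<open>d\<close>, then makes \<open>d\<close> itself vanish and not only
      its gradient.\<close>
    finally have "D = 0" using D0 by simp
    then have "dirichlet (g k) = 0" using Dj[of k] dirichlet_nonneg[of "g k"] by simp
    then have "AE x in lborel. log_weight x * d k x = 0"
      using Hd(2)[of k] by (intro sq_int_zero_AE[OF Hd(1)]) simp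
    then show ?thesis
      by eventually_elim (use log_weight_pos in \<open>auto simp: d_def less_imp_neq[symmetric]\<close>)
  qed
  then show ?thesis using \<delta> by blast
qed

subsection \<open>Borel representatives\<close>

text \<open>Fubini's theorem is applied on \<^term>\<open>lborel\<close> only, so Lebesgue measurable functions are replaced by Borel ones.\<close>

definition borel_rep :: "(plane \<Rightarrow> real) \<Rightarrow> plane \<Rightarrow> real" where
  "borel_rep f = (SOME g. g \<in> borel_measurable borel \<and> (AE x in lborel. f x = g x))"

lemma borel_rep:
  assumes "f \<in> borel_measurable lebesgue"
  shows "borel_rep f \<in> borel_measurable borel" "AE x in lborel. f x = borel_rep f x"
proof -
  have "\<exists>g. g \<in> borel_measurable borel \<and> (AE x in lborel. f x = g x)"
    using completion_ex_borel_measurable_real[OF assms] by auto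
  from someI_ex[OF this] show "borel_rep f \<in> borel_measurable borel" "AE x in lborel. f x = borel_rep f x"
    unfolding borel_rep_def by auto
qed

lemma borel_lebesgue: "f \<in> borel_measurable borel \<Longrightarrow> f \<in> borel_measurable (lebesgue :: plane measure)"
  by (rule measurable_completion) simp

text \<open>The single bridge between the two measures: integrals of Lebesgue measurable functions
  are those of any almost everywhere equal Borel function.\<close>

lemma lebesgue_integral_eq_lborel:
  fixes h h' :: "plane \<Rightarrow> real"
  assumes "h \<in> borel_measurable lebesgue" "h' \<in> borel_measurable borel" "AE x in lborel. h x = h' x"
  shows "(LINT x|lebesgue. h x) = (\<integral>x. h' x \<partial>lborel)" "integrable lebesgue h \<longleftrightarrow> integrable lborel h'"
proof -
  have ae: "AE x in lebesgue. h x = h' x" using assms(3) by (rule AE_completion)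
  have m: "h' \<in> borel_measurable lebesgue" using assms(2) by (rule borel_lebesgue)
  have "(LINT x|lebesgue. h x) = (LINT x|lebesgue. h' x)" by (rule integral_cong_AE[OF assms(1) m ae])
  then show "(LINT x|lebesgue. h x) = (\<integral>x. h' x \<partial>lborel)" using assms(2) by (simp add: integral_completion)
  have "integrable lebesgue h \<longleftrightarrow> integrable lebesgue h'" by (rule integrable_cong_AE[OF assms(1) m ae])
  then show "integrable lebesgue h \<longleftrightarrow> integrable lborel h'" using assms(2) by (simp add: integrable_completion)
qed

lemma locally_integrable_measurable:
  fixes f :: "plane \<Rightarrow> 'a::euclidean_space"
  assumes "locally_integrable f"
  shows "f \<in> borel_measurable lebesgue"
proof (rule borel_measurable_LIMSEQ_metric)
  show "(\<lambda>x. indicator (cball 0 (real n)) x *\<^sub>R f x) \<in> borel_measurable lebesgue" for n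
    using assms compact_cball unfolding locally_integrable_def set_integrable_def by (blast intro: borel_measurable_integrable)
  fix x :: plane
  obtain N where N: "norm x \<le> real N" using real_arch_simple by blast
  have "\<forall>\<^sub>F n in sequentially. indicator (cball 0 (real n)) x *\<^sub>R f x = f x"
    using N by (intro eventually_sequentiallyI[of N]) simp
  then show "(\<lambda>n. indicator (cball 0 (real n)) x *\<^sub>R f x) \<longlonglongrightarrow> f x" by (rule tendsto_eventually)
qed

lemma locally_integrable_loc_int:
  fixes f :: "plane \<Rightarrow> 'a::euclidean_space" and L :: "'a \<Rightarrow> real"
  assumes f: "locally_integrable f" and L: "bounded_linear L"
  shows "(\<lambda>x. L (f x)) \<in> borel_measurable lebesgue" "loc_int (borel_rep (\<lambda>x. L (f x)))"
proof -
  show m: "(\<lambda>x. L (f x)) \<in> borel_measurable lebesgue"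
    using measurable_compose[OF locally_integrable_measurable[OF f] borel_measurable_continuous_onI[OF linear_continuous_on[OF L]]] by simp
  note b = borel_rep[OF m]
  have "integrable lborel (\<lambda>x. indicator (cball 0 R) x * borel_rep (\<lambda>x. L (f x)) x)" for R
  proof -
    have "integrable lebesgue (\<lambda>x. indicator (cball 0 R) x *\<^sub>R f x)"
      using f compact_cball unfolding locally_integrable_def set_integrable_def by blast
    then have i: "integrable lebesgue (\<lambda>x. L (indicator (cball 0 R) x *\<^sub>R f x))"
      by (rule integrable_bounded_linear[OF L])
    have "integrable lebesgue (\<lambda>x. L (indicator (cball 0 R) x *\<^sub>R f x)) \<longleftrightarrow> integrable lborel (\<lambda>x. indicator (cball 0 R) x * borel_rep (\<lambda>x. L (f x)) x)"
    proof (rule lebesgue_integral_eq_lborel(2)[OF borel_measurable_integrable[OF i]])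
      show "(\<lambda>x. indicator (cball 0 R) x * borel_rep (\<lambda>x. L (f x)) x) \<in> borel_measurable borel"
        by (intro borel_measurable_times borel_measurable_indicator b(1)) simp
      show "AE x in lborel. L (indicator (cball 0 R) x *\<^sub>R f x) = indicator (cball 0 R) x * borel_rep (\<lambda>x. L (f x)) x"
        using b(2) by eventually_elim (simp add: linear_scale[OF bounded_linear.linear[OF L]])
    qed
    with i show ?thesis by blast
  qed
  then show "loc_int (borel_rep (\<lambda>x. L (f x)))" using b(1) by (simp add: loc_int_def)
qed

lemma borel_rep_integral_mult:
  assumes "f \<in> borel_measurable lebesgue" "g \<in> borel_measurable borel"
  shows "(LINT x|lebesgue. f x * g x) = (\<integral>x. borel_rep f x * g x \<partial>lborel)"
proof (rule lebesgue_integral_eq_lborel(1))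
  show "(\<lambda>x. f x * g x) \<in> borel_measurable lebesgue" using assms borel_lebesgue by (intro borel_measurable_times) auto
  show "(\<lambda>x. borel_rep f x * g x) \<in> borel_measurable borel" using borel_rep[OF assms(1)] assms(2) by (intro borel_measurable_times) auto
  show "AE x in lborel. f x * g x = borel_rep f x * g x" using borel_rep(2)[OF assms(1)] by eventually_elim simp
qed

subsection \<open>Weak solutions in components\<close>

abbreviation vc :: "(plane \<Rightarrow> plane) \<Rightarrow> 2 \<Rightarrow> plane \<Rightarrow> real" where
  "vc u i \<equiv> borel_rep (\<lambda>x. u x $ i)"

abbreviation tc :: "(plane \<Rightarrow> tensor) \<Rightarrow> 2 \<Rightarrow> 2 \<Rightarrow> plane \<Rightarrow> real" where
  "tc W i j \<equiv> borel_rep (\<lambda>x. W x $ i $ j)"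

lemma bounded_linear_entry: "bounded_linear (\<lambda>A::tensor. A $ i $ j)"
  using bounded_linear_compose[OF bounded_linear_vec_nth bounded_linear_vec_nth] .

lemma in_L2_entry:
  fixes W :: "plane \<Rightarrow> tensor"
  assumes W: "in_L2 W"
  shows "(\<lambda>x. W x $ i $ j) \<in> borel_measurable lebesgue" "sq_int (tc W i j)"
proof -
  have Wm: "W \<in> borel_measurable lebesgue" and Wi: "integrable lebesgue (\<lambda>x. (norm (W x))\<^sup>2)" using W by (auto simp: in_L2_def)
  show m: "(\<lambda>x. W x $ i $ j) \<in> borel_measurable lebesgue"
    using measurable_compose[OF Wm borel_measurable_continuous_onI[OF linear_continuous_on[OF bounded_linear_entry]]] by simp
  have i: "integrable lebesgue (\<lambda>x. (W x $ i $ j)\<^sup>2)"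
  proof (rule Bochner_Integration.integrable_bound[OF Wi])
    show "(\<lambda>x. (W x $ i $ j)\<^sup>2) \<in> borel_measurable lebesgue" using m by simp
    have "\<bar>W x $ i $ j\<bar> \<le> norm (W x)" for x
      using order_trans[OF component_le_norm_cart Finite_Cartesian_Product.norm_nth_le] by blast
    then have "\<bar>W x $ i $ j\<bar>\<^sup>2 \<le> (norm (W x))\<^sup>2" for x by (intro power_mono) auto
    then show "AE x in lebesgue. norm ((W x $ i $ j)\<^sup>2) \<le> norm ((norm (W x))\<^sup>2)" by simp
  qed
  have "integrable lebesgue (\<lambda>x. (W x $ i $ j)\<^sup>2) \<longleftrightarrow> integrable lborel (\<lambda>x. (tc W i j x)\<^sup>2)"
  proof (rule lebesgue_integral_eq_lborel(2)[OF borel_measurable_integrable[OF i]])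
    show "(\<lambda>x. (tc W i j x)\<^sup>2) \<in> borel_measurable borel" using borel_rep(1)[OF m] by simp
    show "AE x in lborel. (W x $ i $ j)\<^sup>2 = (tc W i j x)\<^sup>2" using borel_rep(2)[OF m] by eventually_elim simp
  qed
  then show "sq_int (tc W i j)" using i borel_rep(1)[OF m] by (simp add: sq_int_def)
qed

lemma lebesgue_integral_eq_tensor_ip:
  assumes P: "\<And>i j. sq_int (P i j)" and Q: "\<And>i j. sq_int (Q i j)"
    and h: "h \<in> borel_measurable lebesgue" "AE x in lborel. h x = (\<Sum>i\<in>UNIV. \<Sum>j\<in>UNIV. P i j x * Q i j x)"
  shows "(LINT x|lebesgue. h x) = tensor_ip P Q"
proof -
  have [measurable]: "P i j \<in> borel_measurable borel" "Q i j \<in> borel_measurable borel" for i j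
    using P Q by (auto simp: sq_int_def)
  have "(LINT x|lebesgue. h x) = (\<integral>x. (\<Sum>i\<in>UNIV. \<Sum>j\<in>UNIV. P i j x * Q i j x) \<partial>lborel)"
    by (rule lebesgue_integral_eq_lborel(1)[OF h(1) _ h(2)]) measurable
  also have "\<dots> = tensor_ip P Q" unfolding tensor_ip_def using sq_int_mult[OF P Q] by simp
  finally show ?thesis .
qed

lemma tensor_inner: "(A::tensor) \<bullet> B = (\<Sum>i\<in>UNIV. \<Sum>j\<in>UNIV. A $ i $ j * B $ i $ j)"
  by (simp add: inner_vec_def)

lemma AE_all_2: "(\<And>i::2. AE x in M. P i x) \<Longrightarrow> AE x in M. \<forall>i. P i x"
  by (simp add: AE_all_countable)

lemma L2_inner_eq_tensor_ip:
  assumes V: "in_L2 V" and W: "in_L2 W"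
  shows "L2_inner V W = tensor_ip (tc V) (tc W)"
  unfolding L2_inner_def
proof (rule lebesgue_integral_eq_tensor_ip[OF in_L2_entry(2)[OF V] in_L2_entry(2)[OF W]])
  show "(\<lambda>x. V x \<bullet> W x) \<in> borel_measurable lebesgue" using V W by (intro borel_measurable_inner) (auto simp: in_L2_def)
  have "AE x in lborel. \<forall>i j. V x $ i $ j = tc V i j x" "AE x in lborel. \<forall>i j. W x $ i $ j = tc W i j x"
    by (intro AE_all_2 borel_rep(2) in_L2_entry(1) V W)+
  then show "AE x in lborel. V x \<bullet> W x = (\<Sum>i\<in>UNIV. \<Sum>j\<in>UNIV. tc V i j x * tc W i j x)"
    by eventually_elim (simp add: tensor_inner)
qed

lemma grad_measurable:
  assumes "sol_test_field \<phi>" shows "grad \<phi> \<in> borel_measurable lebesgue" "\<phi> \<in> borel_measurable lebesgue"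
proof -
  have "grad \<phi> = (\<lambda>x. \<chi> i j. grad_entry \<phi> i j x)" by (simp add: grad_entry_def vec_eq_iff fun_eq_iff)
  moreover have "continuous_on UNIV (\<lambda>x. \<chi> i j. grad_entry \<phi> i j x)"
    by (intro continuous_intros smooth_continuous test_function_smooth sol_test_grad_entry(1)[OF assms])
  ultimately show "grad \<phi> \<in> borel_measurable lebesgue" by (metis borel_lebesgue borel_measurable_continuous_onI)
  have "smooth \<phi>" using assms by (simp add: sol_test_field_def test_function_smooth)
  then show "\<phi> \<in> borel_measurable lebesgue" by (intro borel_lebesgue smooth_measurable)
qed

lemma L2_inner_grad_eq_tensor_ip:
  assumes V: "in_L2 V" and \<phi>: "sol_test_field \<phi>"
  shows "L2_inner V (grad \<phi>) = tensor_ip (tc V) (grad_entry \<phi>)"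
  unfolding L2_inner_def
proof (rule lebesgue_integral_eq_tensor_ip[OF in_L2_entry(2)[OF V] sol_test_grad_entry(2)[OF \<phi>]])
  show "(\<lambda>x. V x \<bullet> grad \<phi> x) \<in> borel_measurable lebesgue" using V grad_measurable[OF \<phi>] by (intro borel_measurable_inner) (auto simp: in_L2_def)
  have "AE x in lborel. \<forall>i j. V x $ i $ j = tc V i j x"
    by (intro AE_all_2 borel_rep(2) in_L2_entry(1) V)
  then show "AE x in lborel. V x \<bullet> grad \<phi> x = (\<Sum>i\<in>UNIV. \<Sum>j\<in>UNIV. tc V i j x * grad_entry \<phi> i j x)"
    by eventually_elim (simp add: tensor_inner grad_entry_def)
qed

lemma weak_solution_components:
  assumes F: "in_L2 F" and u: "weak_solution F u"
  shows "locally_integrable u" "in_L2 (weak_grad u)" "weak_NS (tc F) (vc u) (tc (weak_grad u))"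
proof -
  let ?W = "weak_grad u"
  have H: "H1_dot u" "weakly_div_free u" using u by (auto simp: weak_solution_def H1_dot_sigma_def)
  show lu: "locally_integrable u" and W2: "in_L2 ?W" using H(1) by (auto simp: H1_dot_def)
  have "\<exists>G. has_weak_gradient u G" using H(1) by (simp add: H1_dot_def)
  \<comment> \<open>The choice in \<open>weak_grad\<close> is justified because
    \<open>H1_dot\<close> asserts that a weak gradient exists.\<close>
  then have W: "has_weak_gradient u ?W" unfolding weak_grad_def by (rule someI_ex)
  then have lW: "locally_integrable ?W" by (simp add: has_weak_gradient_def)
  note um = locally_integrable_loc_int[OF lu bounded_linear_vec_nth]
  note Wm = locally_integrable_loc_int[OF lW bounded_linear_entry]
  have sol: "solenoidal (vc u) (tc ?W)"
  proof
    fix i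
    show "weak_gradient (vc u i) (tc ?W i)"
      unfolding weak_gradient_def
    proof (intro conjI allI impI um Wm)
      fix \<eta> :: "plane \<Rightarrow> real" and j assume t: "test_function \<eta>"
      have "(LINT x|lebesgue. u x $ i * partial_deriv j \<eta> x) = - (LINT x|lebesgue. ?W x $ i $ j * \<eta> x)"
        using W t by (simp add: has_weak_gradient_def)
      then show "(\<integral>x. vc u i x * partial_deriv j \<eta> x \<partial>lborel) = - (\<integral>x. tc ?W i j x * \<eta> x \<partial>lborel)"
        using borel_rep_integral_mult[OF um(1), of "partial_deriv j \<eta>" i] borel_rep_integral_mult[OF Wm(1), of \<eta> i j] t
        by (simp add: smooth_measurable smooth_partial_deriv test_function_smooth)
    qed
  next
    show "sq_int (tc ?W i j)" for i j by (rule in_L2_entry(2)[OF W2])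
  next
    show "div_free (vc u)"
      unfolding div_free_def
    proof (intro allI impI)
      fix \<eta> :: "plane \<Rightarrow> real" assume t: "test_function \<eta>"
      have [measurable]: "partial_deriv j \<eta> \<in> borel_measurable borel" for j by (intro smooth_measurable smooth_partial_deriv test_function_smooth t)
      have [measurable]: "vc u j \<in> borel_measurable borel" for j by (rule borel_rep(1)[OF um(1)])
      have "0 = (LINT x|lebesgue. (\<Sum>j\<in>UNIV. u x $ j * partial_deriv j \<eta> x))" using H(2) t by (simp add: weakly_div_free_def)
      also have "\<dots> = (\<integral>x. (\<Sum>j\<in>UNIV. vc u j x * partial_deriv j \<eta> x) \<partial>lborel)"
      proof (rule lebesgue_integral_eq_lborel(1))
        show "(\<lambda>x. \<Sum>j\<in>UNIV. u x $ j * partial_deriv j \<eta> x) \<in> borel_measurable lebesgue"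
          by (intro borel_measurable_sum borel_measurable_times um(1) borel_lebesgue) measurable
        show "(\<lambda>x. \<Sum>j\<in>UNIV. vc u j x * partial_deriv j \<eta> x) \<in> borel_measurable borel" by measurable
        have "AE x in lborel. \<forall>j. u x $ j = vc u j x" by (intro AE_all_2 borel_rep(2) um(1))
        then show "AE x in lborel. (\<Sum>j\<in>UNIV. u x $ j * partial_deriv j \<eta> x) = (\<Sum>j\<in>UNIV. vc u j x * partial_deriv j \<eta> x)"
          by eventually_elim simp
      qed
      also have "\<dots> = (\<Sum>j\<in>UNIV. \<integral>x. vc u j x * partial_deriv j \<eta> x \<partial>lborel)"
        by (intro Bochner_Integration.integral_sum loc_int_mult_test um(2) test_function_partial_deriv t)
      finally show "(\<Sum>j\<in>UNIV. \<integral>x. vc u j x * partial_deriv j \<eta> x \<partial>lborel) = 0" by simp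
    qed
  qed
  then interpret solenoidal "vc u" "tc ?W" .
  show "weak_NS (tc F) (vc u) (tc ?W)"
    unfolding weak_NS_def
  proof (intro conjI allI impI sol)
    fix \<phi> assume \<phi>: "sol_test_field \<phi>"
    have "L2_inner ?W (grad \<phi>) + L2_inner (convection u u) \<phi> = L2_inner F (grad \<phi>)"
      using u \<phi> by (simp add: weak_solution_def)
    moreover have "L2_inner (convection u u) \<phi> = tensor_ip (tc ?W) (\<lambda>i j x. vc u j x * \<phi> x $ i)"
      unfolding L2_inner_def
    proof (rule lebesgue_integral_eq_tensor_ip[OF sg])
      show "sq_int (\<lambda>x. vc u j x * \<phi> x $ i)" for i j
        by (rule sq_int_mult_test[OF swf fm sol_test_component(1)[OF \<phi>]])
      have eq: "convection u u x \<bullet> \<phi> x = (\<Sum>i\<in>UNIV. \<Sum>j\<in>UNIV. ?W x $ i $ j * (u x $ j * \<phi> x $ i))" for x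
        by (simp add: convection_def inner_vec_def matrix_vector_mult_def sum_distrib_right mult.assoc)
      have "(\<lambda>x. \<phi> x $ i) \<in> borel_measurable lebesgue" for i
        by (intro borel_lebesgue smooth_measurable test_function_smooth sol_test_component(1)[OF \<phi>])
      then show "(\<lambda>x. convection u u x \<bullet> \<phi> x) \<in> borel_measurable lebesgue"
        unfolding eq by (intro borel_measurable_sum borel_measurable_times um(1) Wm(1))
      have "AE x in lborel. \<forall>j. u x $ j = vc u j x" "AE x in lborel. \<forall>i j. ?W x $ i $ j = tc ?W i j x"
        by (intro AE_all_2 borel_rep(2) um(1) Wm(1))+
      then show "AE x in lborel. convection u u x \<bullet> \<phi> x = (\<Sum>i\<in>UNIV. \<Sum>j\<in>UNIV. tc ?W i j x * (vc u j x * \<phi> x $ i))"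
        by eventually_elim (simp add: eq)
    qed
    ultimately show "tensor_ip (tc ?W) (grad_entry \<phi>) + tensor_ip (tc ?W) (\<lambda>i j x. vc u j x * \<phi> x $ i) = tensor_ip (tc F) (grad_entry \<phi>)"
      by (simp add: L2_inner_grad_eq_tensor_ip[OF _ \<phi>] W2 F)
  qed
qed

lemma energy_components:
  assumes "in_L2 F" "in_L2 (weak_grad u)" "energy_inequality F u"
  shows "tensor_ip (tc (weak_grad u)) (tc (weak_grad u)) \<le> tensor_ip (tc F) (tc (weak_grad u))"
proof -
  have "(L2_norm (weak_grad u))\<^sup>2 = L2_inner (weak_grad u) (weak_grad u)"
    by (simp add: L2_norm_def L2_inner_def power2_norm_eq_inner)
  then show ?thesis using assms by (simp add: energy_inequality_def L2_inner_eq_tensor_ip)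
qed

text \<open>Coordinate projection commutes with the vector integral, and both
  \<open>\<omega>\<close> and \<open>u\<close> may be changed on null sets. It transfers the
  hypothesis of equal means to Borel data.\<close>

lemma mean_value_components:
  assumes u: "locally_integrable u" and w: "\<omega> \<in> sets lebesgue" "bounded \<omega>"
    and A: "A \<in> sets borel" "AE x in lborel. x \<in> \<omega> \<longleftrightarrow> x \<in> A"
  shows "mean_value \<omega> u $ i = average A (vc u i)"
proof -
  note um = locally_integrable_loc_int(1)[OF u bounded_linear_vec_nth]
  have m: "measure lebesgue \<omega> = measure lborel A"
  proof -
    have "AE x in lebesgue. x \<in> \<omega> \<longleftrightarrow> x \<in> A" using A(2) by (rule AE_completion)
    then have "emeasure lebesgue \<omega> = emeasure lebesgue A" using w(1) A(1) by (intro emeasure_eq_AE) auto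
    then show ?thesis using A(1) by (simp add: measure_def)
  qed
  obtain R where "\<forall>x\<in>\<omega>. norm x \<le> R" using w(2) bounded_iff by blast
  then have R: "\<omega> \<subseteq> cball 0 R" by auto
  have "integrable lebesgue (\<lambda>x. indicator (cball 0 R) x *\<^sub>R u x)"
    using u compact_cball unfolding locally_integrable_def set_integrable_def by blast
  then have "integrable lebesgue (\<lambda>x. indicator \<omega> x *\<^sub>R (indicator (cball 0 R) x *\<^sub>R u x))"
    by (rule integrable_mult_indicator[OF w(1)])
  moreover have "(\<lambda>x. indicator \<omega> x *\<^sub>R (indicator (cball 0 R) x *\<^sub>R u x)) = (\<lambda>x. indicator \<omega> x *\<^sub>R u x)"
    using R by (auto simp: indicator_def fun_eq_iff)
  ultimately have i: "integrable lebesgue (\<lambda>x. indicator \<omega> x *\<^sub>R u x)" by (simp only:)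
  have "(LINT x:\<omega>|lebesgue. u x) $ i = (LINT x|lebesgue. (indicator \<omega> x *\<^sub>R u x) $ i)"
    unfolding set_lebesgue_integral_def by (rule integral_bounded_linear[OF bounded_linear_vec_nth i, symmetric])
  also have "\<dots> = (\<integral>x. indicator A x * vc u i x \<partial>lborel)"
  proof (rule lebesgue_integral_eq_lborel(1))
    show "(\<lambda>x. (indicator \<omega> x *\<^sub>R u x) $ i) \<in> borel_measurable lebesgue"
      by (rule borel_measurable_integrable[OF integrable_bounded_linear[OF bounded_linear_vec_nth i]])
    show "(\<lambda>x. indicator A x * vc u i x) \<in> borel_measurable borel"
      by (intro borel_measurable_times borel_measurable_indicator borel_rep(1)[OF um] A(1))
    show "AE x in lborel. (indicator \<omega> x *\<^sub>R u x) $ i = indicator A x * vc u i x"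
      using A(2) borel_rep(2)[OF um, of i] by eventually_elim (simp add: indicator_def)
  qed
  finally show ?thesis by (simp add: mean_value_def average_def m)
qed

text \<open>From \<open>bracket_sq x \<le> (1 + norm x)^2\<close> the root of
  \<open>bracket_sq\<close> is at most \<open>1 + norm x\<close>, while its logarithm is at most
  twice \<open>ln (1 + norm x)\<close>; this doubling is the factor 2.\<close>

lemma jbracket_weight_le: "1 / (jbracket x * jbracket (ln (jbracket x))) \<le> 2 * log_weight x"
proof -
  have n: "norm x \<ge> 0" by simp
  have l0: "ln (1 + norm x) \<ge> 0" by simp
  have j: "jbracket x = 1 + norm x" "jbracket (ln (jbracket x)) = 1 + ln (1 + norm x)"
    using l0 by (auto simp: jbracket_def)
  have q: "bracket_sq x \<le> (1 + norm x)\<^sup>2" by (simp add: bracket_sq_def power2_eq_square algebra_simps)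
  have s: "sqrt (bracket_sq x) \<le> 1 + norm x" using q by (intro real_le_lsqrt) auto
  have "ln (bracket_sq x) \<le> ln ((1 + norm x)\<^sup>2)" using q bracket_sq_pos[of x] by (intro ln_mono) auto
  also have "\<dots> = 2 * ln (1 + norm x)" using n by (subst ln_realpow) auto
  finally have l: "log_bracket x \<le> 2 * (1 + ln (1 + norm x))" by (simp add: log_bracket_def)
  have p: "0 < sqrt (bracket_sq x) * log_bracket x" using bracket_sq_pos[of x] log_bracket_pos[of x] by simp
  have "sqrt (bracket_sq x) * log_bracket x \<le> (1 + norm x) * (2 * (1 + ln (1 + norm x)))"
    using log_bracket_pos[of x] by (intro mult_mono s l) auto
  then have "2 / ((1 + norm x) * (2 * (1 + ln (1 + norm x)))) \<le> 2 / (sqrt (bracket_sq x) * log_bracket x)"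
    using p bracket_sq_pos[of x] log_bracket_pos[of x] by (intro divide_left_mono mult_pos_pos) (auto intro: add_pos_nonneg l0)
  moreover have "2 / (a * (2 * b)) = 1 / (a * b)" for a b :: real by simp
  ultimately have "1 / ((1 + norm x) * (1 + ln (1 + norm x))) \<le> 2 / (sqrt (bracket_sq x) * log_bracket x)" by metis
  then show ?thesis unfolding j(2) unfolding j(1) log_weight_def by simp
qed

text \<open>Choosing \<open>\<delta>\<close> before \<open>F\<close>, \<open>u\<close>,
  \<open>v\<close> and \<open>uinf\<close> expresses that it depends on \<open>\<omega>\<close>
  only. Equality and decay are almost everywhere because the fields are determined only up to null
  sets.\<close>

theorem theorem9:
  fixes \<omega> :: "(real^2) set"
  assumes "\<omega> \<in> sets lebesgue" and "bounded \<omega>" and "measure lebesgue \<omega> > 0"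
  shows "\<exists>\<delta>>0. \<forall>(F :: real^2 \<Rightarrow> real^2^2) (u :: real^2 \<Rightarrow> real^2) (v :: real^2 \<Rightarrow> real^2) (uinf :: real^2).
           in_L2 F \<longrightarrow> weak_solution F u \<longrightarrow> weak_solution F v \<longrightarrow>
           mean_value \<omega> u = mean_value \<omega> v \<longrightarrow>
           energy_inequality F u \<longrightarrow> energy_inequality F v \<longrightarrow>
           (AE x in lebesgue. norm (v x - uinf) \<le> \<delta> / (jbracket x * jbracket (ln (jbracket x)))) \<longrightarrow>
           (AE x in lebesgue. u x = v x)"
proof -
  \<comment> \<open>\<open>\<omega>\<close> is merely Lebesgue measurable. It is replaced by a Borel
    subset of full measure, which is still bounded, so that the Hardy inequality over Borel sets
    applies.\<close>
  obtain A T where AT: "fsigma A" "T \<in> null_sets lebesgue" "A \<union> T = \<omega>"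
    using lebesgue_set_almost_fsigma[OF assms(1)] by metis
  have A: "A \<in> sets borel" using AT(1) by cases (auto intro: borel_closed)
  have bA: "bounded A" using AT(3) assms(2) by (auto intro: bounded_subset)
  have "AE x in lebesgue. x \<in> \<omega> \<longleftrightarrow> x \<in> A"
    using AE_not_in[OF AT(2)] by eventually_elim (use AT(3) in auto)
  then have AE_A: "AE x in lborel. x \<in> \<omega> \<longleftrightarrow> x \<in> A" by (simp add: AE_completion_iff)
  have "emeasure lebesgue \<omega> = emeasure lebesgue A"
    using assms(1) A AE_completion[OF AE_A] by (intro emeasure_eq_AE) auto
  then have mA: "measure lborel A > 0" using assms(3) A by (simp add: measure_def)
  obtain \<delta> where \<delta>: "\<delta> > 0" and uniq: "\<And>F u G v H c. (\<forall>i j. sq_int (F i j)) \<Longrightarrow> weak_NS F u G \<Longrightarrow> weak_NS F v H \<Longrightarrow>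
    (\<forall>i. average A (u i) = average A (v i)) \<Longrightarrow> tensor_ip G G \<le> tensor_ip F G \<Longrightarrow> tensor_ip H H \<le> tensor_ip F H \<Longrightarrow>
    (\<forall>i. AE x in lborel. \<bar>v i x - c i\<bar> \<le> 2 * \<delta> * log_weight x) \<Longrightarrow> (\<forall>i. AE x in lborel. u i x = v i x)"
    using weak_strong_uniqueness[OF A bA mA] by blast
  show ?thesis
  proof (intro exI[of _ \<delta>] conjI \<delta> allI impI)
    fix F :: "plane \<Rightarrow> tensor" and u v :: "plane \<Rightarrow> plane" and uinf :: plane
    assume F: "in_L2 F" and u: "weak_solution F u" and v: "weak_solution F v"
      and mean: "mean_value \<omega> u = mean_value \<omega> v"
      and eu: "energy_inequality F u" and ev: "energy_inequality F v"
      and dec: "AE x in lebesgue. norm (v x - uinf) \<le> \<delta> / (jbracket x * jbracket (ln (jbracket x)))"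
    note cu = weak_solution_components[OF F u] and cv = weak_solution_components[OF F v]
    have um: "(\<lambda>x. u x $ i) \<in> borel_measurable lebesgue" and vm: "(\<lambda>x. v x $ i) \<in> borel_measurable lebesgue" for i
      by (rule locally_integrable_loc_int(1)[OF cu(1) bounded_linear_vec_nth])
        (rule locally_integrable_loc_int(1)[OF cv(1) bounded_linear_vec_nth])
    have "\<forall>i. AE x in lborel. vc u i x = vc v i x"
    proof (rule uniq[OF _ cu(3) cv(3)])
      show "\<forall>i j. sq_int (tc F i j)" using in_L2_entry(2)[OF F] by blast
      show "\<forall>i. average A (vc u i) = average A (vc v i)"
        using mean mean_value_components[OF cu(1) assms(1,2) A AE_A] mean_value_components[OF cv(1) assms(1,2) A AE_A] by metis
      show "tensor_ip (tc (weak_grad u)) (tc (weak_grad u)) \<le> tensor_ip (tc F) (tc (weak_grad u))"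
        by (rule energy_components[OF F cu(2) eu])
      show "tensor_ip (tc (weak_grad v)) (tc (weak_grad v)) \<le> tensor_ip (tc F) (tc (weak_grad v))"
        by (rule energy_components[OF F cv(2) ev])
      show "\<forall>i. AE x in lborel. \<bar>vc v i x - uinf $ i\<bar> \<le> 2 * \<delta> * log_weight x"
      proof
        fix i
        have "AE x in lborel. norm (v x - uinf) \<le> \<delta> / (jbracket x * jbracket (ln (jbracket x)))"
          using dec by (simp add: AE_completion_iff)
        then show "AE x in lborel. \<bar>vc v i x - uinf $ i\<bar> \<le> 2 * \<delta> * log_weight x"
          using borel_rep(2)[OF vm[of i]]
        proof eventually_elim
          case (elim x)
          have "\<bar>vc v i x - uinf $ i\<bar> \<le> norm (v x - uinf)"
            using component_le_norm_cart[of "v x - uinf" i] elim(2) by simp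
          also have "\<dots> \<le> \<delta> * (1 / (jbracket x * jbracket (ln (jbracket x))))" using elim(1) by simp
          also have "\<dots> \<le> \<delta> * (2 * log_weight x)" using \<delta> by (intro mult_left_mono jbracket_weight_le) auto
          finally show ?case by simp
        qed
      qed
    qed
    then have "AE x in lborel. \<forall>i. vc u i x = vc v i x" by (intro AE_all_2) blast
    moreover have "AE x in lborel. \<forall>i. u x $ i = vc u i x" "AE x in lborel. \<forall>i. v x $ i = vc v i x"
      by (intro AE_all_2 borel_rep(2) um vm)+
    ultimately have "AE x in lborel. u x = v x"
      by eventually_elim (simp add: vec_eq_iff)
    then show "AE x in lebesgue. u x = v x" by (rule AE_completion)
  qed
qed

end
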